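(* Let $k$ be a positive integer and let $$G = \langle a_1, \ldots, a_n \mid a_i^2 = 1,\ i = 1, \ldots, n;\ (a_i a_j)^{m_{ij}} = 1,\ 1 \leq i < j \leq n \rangle$$ be a Coxeter group (where $m_{ij}=\infty$ is allowed and means that there is no relation between $a_i$ and $a_j$) such that $m_{ij} \geq 3k+1$ for all $i < j$. Then the following hold: 1. Every torsion-free $k$-generated subgroup of $G$ is free and quasiconvex in $G$. 2. Every $k$-generated subgroup of $G$ which does not contain any conjugates of the generators $a_i$ is quasiconvex in $G$. 3. If all finite $m_{ij}$ are even, then every subgroup of $G$ generated by at most $(k+1)/2$ elements is quasiconvex in $G$.
   Context: A $k$-generated group is a group which can be generated by $k$ or fewer elements. Each $m_{ij}$ is a positive integer or $\infty$. The condition $m_{ij}\ge 3k+1\geq 4$ implies that $G$ is word-hyperbolic. A subgroup $H$ of a word-hyperbolic group $G$ is quasiconvex if for some (equivalently, any) finite generating set $A$ of $G$ with the corresponding word-metric there is a fixed bound $B$ such that, for any geodesic representative (word over $A$) of any element of $H$, the group element represented by any initial segment of that word is within distance $B$ of an element of $H$. *)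

theory Defs
  imports Complex_Main "HOL-Algebra.Generated_Groups" "HOL-Library.Extended_Nat"
begin

text \<open>
  A group word over a set of generators is a list of signed letters: \<open>(x, True)\<close> stands for
  the generator \<open>x\<close> and \<open>(x, False)\<close> for its formal inverse. Two words are identified if one
  can be transformed into the other by inserting and deleting relators and trivial pairs
  \<open>x x\<inverse>\<close>, \<open>x\<inverse> x\<close>. The classes form the quotient of the free group on the generators by the
  normal closure of the relators.
\<close>

type_synonym 'g group_word = "('g \<times> bool) list"

abbreviation group_words :: "'g set \<Rightarrow> 'g group_word set" where
  "group_words X \<equiv> lists (X \<times> UNIV)"

inductive pres_eq :: "'g set \<Rightarrow> 'g group_word set \<Rightarrow> 'g group_word \<Rightarrow> 'g group_word \<Rightarrow> bool"
  for X R where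
  refl: "u \<in> group_words X \<Longrightarrow> pres_eq X R u u"
| sym: "pres_eq X R u v \<Longrightarrow> pres_eq X R v u"
| trans: "pres_eq X R u v \<Longrightarrow> pres_eq X R v w \<Longrightarrow> pres_eq X R u w"
| cancel: "u \<in> group_words X \<Longrightarrow> v \<in> group_words X \<Longrightarrow> x \<in> X \<Longrightarrow>
    pres_eq X R (u @ [(x, b), (x, \<not> b)] @ v) (u @ v)"
| relator: "u \<in> group_words X \<Longrightarrow> v \<in> group_words X \<Longrightarrow> r \<in> R \<Longrightarrow> r \<in> group_words X \<Longrightarrow>
    pres_eq X R (u @ r @ v) (u @ v)"

definition pres_rel :: "'g set \<Rightarrow> 'g group_word set \<Rightarrow> ('g group_word \<times> 'g group_word) set" where
  "pres_rel X R = {(u, v). pres_eq X R u v}"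

definition presented_group :: "'g set \<Rightarrow> 'g group_word set \<Rightarrow> 'g group_word set monoid" where
  "presented_group X R =
    \<lparr>carrier = group_words X // pres_rel X R,
     mult = (\<lambda>C D. \<Union>c\<in>C. \<Union>d\<in>D. pres_rel X R `` {c @ d}),
     one = pres_rel X R `` {[]}\<rparr>"

lemma pres_eq_words:
  assumes "pres_eq X R u v"
  shows "u \<in> group_words X" "v \<in> group_words X"
  using assms by (induction rule: pres_eq.induct) auto

lemma equiv_pres_rel: "equiv (group_words X) (pres_rel X R)"
proof (rule equivI)
  show "pres_rel X R \<subseteq> group_words X \<times> group_words X"
    unfolding pres_rel_def using pres_eq_words by blast
  show "refl_on (group_words X) (pres_rel X R)"
    unfolding pres_rel_def refl_on_def using pres_eq.refl by blast
  show "sym (pres_rel X R)"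
    unfolding pres_rel_def sym_def using pres_eq.sym by blast
  show "trans (pres_rel X R)"
    unfolding pres_rel_def trans_def using pres_eq.trans by blast
qed

lemma pres_eq_append_left:
  assumes "pres_eq X R u v" "w \<in> group_words X"
  shows "pres_eq X R (w @ u) (w @ v)"
  using assms(1)
proof induction
  case (refl u)
  then show ?case using assms(2) by (intro pres_eq.refl) simp
next
  case (sym u v)
  from sym.IH show ?case by (rule pres_eq.sym)
next
  case (trans u v w)
  from trans.IH show ?case by (rule pres_eq.trans)
next
  case (cancel u v x b)
  then show ?case using pres_eq.cancel[of "w @ u" X v x R b] assms(2) by simp
next
  case (relator u v r)
  then show ?case using pres_eq.relator[of "w @ u" X v r R] assms(2) by simp
qed

lemma pres_eq_append_right:
  assumes "pres_eq X R u v" "w \<in> group_words X"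
  shows "pres_eq X R (u @ w) (v @ w)"
  using assms(1)
proof induction
  case (refl u)
  then show ?case using assms(2) by (intro pres_eq.refl) simp
next
  case (sym u v)
  from sym.IH show ?case by (rule pres_eq.sym)
next
  case (trans u v w)
  from trans.IH show ?case by (rule pres_eq.trans)
next
  case (cancel u v x b)
  then show ?case using pres_eq.cancel[of u X "v @ w" x R b] assms(2) by simp
next
  case (relator u v r)
  then show ?case using pres_eq.relator[of u X "v @ w" r R] assms(2) by simp
qed

lemma presented_group_mult:
  assumes "u \<in> group_words X" "v \<in> group_words X"
  shows "(pres_rel X R `` {u}) \<otimes>\<^bsub>presented_group X R\<^esub> (pres_rel X R `` {v}) = pres_rel X R `` {u @ v}"
proof -
  have "pres_rel X R `` {c @ d} = pres_rel X R `` {u @ v}"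
    if "pres_eq X R u c" "pres_eq X R v d" for c d
  proof -
    have "pres_eq X R (u @ v) (c @ d)"
      by (rule pres_eq.trans[OF pres_eq_append_left[OF that(2) assms(1)]
            pres_eq_append_right[OF that(1) pres_eq_words(2)[OF that(2)]]])
    then have "(u @ v, c @ d) \<in> pres_rel X R" by (simp add: pres_rel_def)
    then show ?thesis by (rule equiv_class_eq[OF equiv_pres_rel, symmetric])
  qed
  moreover have "u \<in> pres_rel X R `` {u}" "v \<in> pres_rel X R `` {v}"
    using pres_eq.refl[OF assms(1)] pres_eq.refl[OF assms(2)] by (simp_all add: pres_rel_def)
  moreover have "pres_eq X R u c" if "c \<in> pres_rel X R `` {u}" for u c
    using that by (simp add: pres_rel_def)
  ultimately have "(\<Union>c\<in>pres_rel X R `` {u}. \<Union>d\<in>pres_rel X R `` {v}. pres_rel X R `` {c @ d})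
      = pres_rel X R `` {u @ v}" by blast
  then show ?thesis by (simp add: presented_group_def)
qed

lemma inverse_word_closed:
  assumes "u \<in> group_words X"
  shows "rev (map (\<lambda>(x, b). (x, \<not> b)) u) \<in> group_words X"
  using assms by (induction u) (auto simp del: in_lists_conv_set)

lemma pres_eq_inverse:
  assumes "u \<in> group_words X"
  shows "pres_eq X R (rev (map (\<lambda>(x, b). (x, \<not> b)) u) @ u) []"
  using assms
proof (induction u rule: list.induct)
  case Nil
  then show ?case by (auto intro: pres_eq.refl)
next
  case (Cons a u)
  obtain x b where a: "a = (x, b)" by force
  let ?v = "rev (map (\<lambda>(x, b). (x, \<not> b)) u)"
  have "?v \<in> group_words X" by (rule inverse_word_closed) (use Cons.prems in simp)
  then have "pres_eq X R (?v @ [(x, \<not> b), (x, \<not> \<not> b)] @ u) (?v @ u)"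
    using Cons.prems a by (intro pres_eq.cancel) auto
  then have "pres_eq X R (?v @ [(x, \<not> b), (x, b)] @ u) (?v @ u)" by simp
  moreover have "pres_eq X R (?v @ u) []" using Cons by simp
  ultimately have "pres_eq X R (?v @ [(x, \<not> b), (x, b)] @ u) []" by (rule pres_eq.trans)
  then show ?case by (simp add: a)
qed

lemma group_presented_group: "group (presented_group X R)"
proof (rule groupI)
  let ?G = "presented_group X R" and ?r = "\<lambda>u. pres_rel X R `` {u}"
  have carr: "x \<in> carrier ?G \<longleftrightarrow> (\<exists>u\<in>group_words X. x = ?r u)" for x
    by (auto simp: presented_group_def quotient_def)
  have one: "\<one>\<^bsub>?G\<^esub> = ?r []" by (simp add: presented_group_def)
  show "\<one>\<^bsub>?G\<^esub> \<in> carrier ?G" unfolding carr one by (intro bexI[of _ "[]"]) auto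
  fix x assume x: "x \<in> carrier ?G"
  then obtain u where u: "u \<in> group_words X" "x = ?r u" using carr by blast
  show "\<one>\<^bsub>?G\<^esub> \<otimes>\<^bsub>?G\<^esub> x = x"
    using u presented_group_mult[of "[]" X u R] by (simp add: one)
  let ?v = "rev (map (\<lambda>(x, b). (x, \<not> b)) u)"
  have v: "?v \<in> group_words X" using u(1) by (rule inverse_word_closed)
  have "?r (?v @ u) = ?r []"
    by (rule equiv_class_eq[OF equiv_pres_rel])
      (use pres_eq_inverse[OF u(1), of R] in \<open>simp add: pres_rel_def\<close>)
  then have "?r ?v \<otimes>\<^bsub>?G\<^esub> x = \<one>\<^bsub>?G\<^esub>"
    using presented_group_mult[OF v u(1), of R] u(2) one by simp
  then show "\<exists>y\<in>carrier ?G. y \<otimes>\<^bsub>?G\<^esub> x = \<one>\<^bsub>?G\<^esub>" using v carr by blast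
  fix y assume "y \<in> carrier ?G"
  then obtain w where w: "w \<in> group_words X" "y = ?r w" using carr by blast
  have uw: "u @ w \<in> group_words X" using u w by auto
  show "x \<otimes>\<^bsub>?G\<^esub> y \<in> carrier ?G"
    using presented_group_mult[OF u(1) w(1), of R] u(2) w(2) uw carr by metis
  fix z assume "z \<in> carrier ?G"
  then obtain t where t: "t \<in> group_words X" "z = ?r t" using carr by blast
  have wt: "w @ t \<in> group_words X" using t w by auto
  show "x \<otimes>\<^bsub>?G\<^esub> y \<otimes>\<^bsub>?G\<^esub> z = x \<otimes>\<^bsub>?G\<^esub> (y \<otimes>\<^bsub>?G\<^esub> z)"
    using presented_group_mult[OF u(1) w(1), of R] presented_group_mult[OF w(1) t(1), of R]
      presented_group_mult[OF uw t(1), of R] presented_group_mult[OF u(1) wt, of R] u w t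
    by (simp del: append_in_lists_conv)
qed

text \<open>
  A free basis of a group is a subset of its carrier, so it is no restriction to take the
  basis from the type of group elements.
\<close>

definition free_group :: "('a, 'b) monoid_scheme \<Rightarrow> bool" where
  "free_group G \<longleftrightarrow> group G \<and> (\<exists>S :: 'a set. G \<cong> presented_group S {})"

definition torsion_free :: "('a, 'b) monoid_scheme \<Rightarrow> bool" where
  "torsion_free G \<longleftrightarrow> (\<forall>x\<in>carrier G. \<forall>p::nat. p > 0 \<longrightarrow> x [^]\<^bsub>G\<^esub> p = \<one>\<^bsub>G\<^esub> \<longrightarrow> x = \<one>\<^bsub>G\<^esub>)"

definition generated_by_at_most :: "('a, 'b) monoid_scheme \<Rightarrow> real \<Rightarrow> 'a set \<Rightarrow> bool" where
  "generated_by_at_most G c H \<longleftrightarrow>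
    (\<exists>S. S \<subseteq> carrier G \<and> finite S \<and> real (card S) \<le> c \<and> H = generate G S)"

definition letters :: "('a, 'b) monoid_scheme \<Rightarrow> 'a set \<Rightarrow> 'a set" where
  "letters G A = A \<union> m_inv G ` A"

definition word_val :: "('a, 'b) monoid_scheme \<Rightarrow> 'a list \<Rightarrow> 'a" where
  "word_val G w = foldr (mult G) w \<one>\<^bsub>G\<^esub>"

definition word_length :: "('a, 'b) monoid_scheme \<Rightarrow> 'a set \<Rightarrow> 'a \<Rightarrow> nat" where
  "word_length G A g = (LEAST l. \<exists>w\<in>lists (letters G A). length w = l \<and> word_val G w = g)"

text \<open>
  The word metric is left invariant, so that the initial segments of a word trace out a path
  from the identity.
\<close>

definition word_dist :: "('a, 'b) monoid_scheme \<Rightarrow> 'a set \<Rightarrow> 'a \<Rightarrow> 'a \<Rightarrow> nat" where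
  "word_dist G A x y = word_length G A (inv\<^bsub>G\<^esub> x \<otimes>\<^bsub>G\<^esub> y)"

definition geodesic_word :: "('a, 'b) monoid_scheme \<Rightarrow> 'a set \<Rightarrow> 'a list \<Rightarrow> bool" where
  "geodesic_word G A w \<longleftrightarrow> w \<in> lists (letters G A) \<and> length w = word_length G A (word_val G w)"

text \<open>
  In a word-hyperbolic group, quasiconvexity with respect to one finite generating set implies
  quasiconvexity with respect to every finite generating set.
\<close>

definition quasiconvex_subgroup :: "'a set \<Rightarrow> ('a, 'b) monoid_scheme \<Rightarrow> bool" where
  "quasiconvex_subgroup H G \<longleftrightarrow> subgroup H G \<and>
    (\<exists>A. finite A \<and> A \<subseteq> carrier G \<and> generate G A = carrier G \<and>
      (\<exists>B::nat. \<forall>w. geodesic_word G A w \<and> word_val G w \<in> H \<longrightarrow>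
        (\<forall>i\<le>length w. \<exists>h\<in>H. word_dist G A (word_val G (take i w)) h \<le> B)))"

text \<open>Only the values \<open>m i j\<close> with \<open>1 \<le> i < j \<le> n\<close> matter.\<close>

definition coxeter_relators :: "nat \<Rightarrow> (nat \<Rightarrow> nat \<Rightarrow> enat) \<Rightarrow> nat group_word set" where
  "coxeter_relators n m =
    {[(i, True), (i, True)] | i. 1 \<le> i \<and> i \<le> n} \<union>
    {concat (replicate p [(i, True), (j, True)]) | i j p.
      1 \<le> i \<and> i < j \<and> j \<le> n \<and> m i j = enat p}"

definition coxeter_group :: "nat \<Rightarrow> (nat \<Rightarrow> nat \<Rightarrow> enat) \<Rightarrow> nat group_word set monoid" where
  "coxeter_group n m = presented_group {1..n} (coxeter_relators n m)"

definition coxeter_gen :: "nat \<Rightarrow> (nat \<Rightarrow> nat \<Rightarrow> enat) \<Rightarrow> nat \<Rightarrow> nat group_word set" where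
  "coxeter_gen n m i = pres_rel {1..n} (coxeter_relators n m) `` {[(i, True)]}"

end

theory Submission
  imports Defs
begin

text \<open>
  The subgroup \<open>H\<close> is represented by a finite graph \<open>\<Gamma>\<close> of first Betti number at most \<open>k\<close> with edges
  labelled by the generators, chosen with as few edges as possible. Minimality forces \<open>\<Gamma>\<close> to be
  folded, and forces a shortest closed path for an element of \<open>H\<close> to have a good label: one without
  cancellation and without an alternating subword of length \<open>2 m\<^sub>i\<^sub>j - 3\<close> in \<open>a\<^sub>i, a\<^sub>j\<close>. Indeed a long
  alternating subword is read either along an embedded path, where an arc of \<open>\<Gamma>\<close> can be exchanged for
  a shorter one by means of the relator, or around a short cycle, where it can be shortened.

  A good word stays uniformly close to all geodesics with the same endpoints and is nontrivial. This
  is shown by following its prefixes through the cosets of the dihedral subgroups; the lengths of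
  elements are controlled by the geometric representation. Hence \<open>H\<close> is quasiconvex. If \<open>H\<close> is
  torsion free, then \<open>\<Gamma>\<close> has no short alternating cycles, all reduced closed paths are good, and a
  spanning tree of \<open>\<Gamma>\<close> yields a free basis. In the third statement a subgroup with \<open>r\<close> generators is
  replaced by its elements of even length, which form a subgroup with \<open>2 r - 1\<close> generators that
  contains no conjugate of a generator.
\<close>

section \<open>The geometric representation\<close>

text \<open>The bound 3 k + 1 comes from one count. In a graph of Betti number at most k without
  vertices of degree one, the degree sum leaves room for at most 2 k - 2 branch vertices. An
  alternating path of 2 m - 3 edges has 2 m - 4 inner vertices; for m \<ge> 3 k + 1 these contain 2
  k - 1 disjoint triples of consecutive vertices, so some triple avoids the branch vertices. Cutting
  out its four edges and inserting the three missing letters of the relator keeps the Betti number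
  and saves an edge. The price is that good words are far from geodesic: only subwords of length 2 m
  - 3 are forbidden, so a good word may climb over the top of a dihedral coset and descend almost to
  its bottom. The comparison with geodesics therefore rests on two facts special to large labels: no
  element has more than two descents, and as long as some depth is left in a coset the way down is
  unique. Conjugates of generators are excluded from the subgroup because they would appear as
  loops, while every exchange in the graph presupposes edges with two distinct ends.\<close>

declare comp_apply [simp del] id_apply [simp del]
declare in_listsD [rule del] in_listsI [rule del]

lemma rev_in_lists [simp]: "rev w \<in> lists A \<longleftrightarrow> w \<in> lists A"
  by (simp add: in_lists_conv_set)

fun alt :: "'a \<Rightarrow> 'a \<Rightarrow> nat \<Rightarrow> 'a list" where
  "alt a b 0 = []"
| "alt a b (Suc q) = a # alt b a q"

lemma length_alt [simp]: "length (alt a b q) = q"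
  by (induction q arbitrary: a b) auto

lemma alt_snoc: "alt a b (Suc q) = alt a b q @ [if even q then a else b]"
  by (induction q arbitrary: a b) auto

lemma alt_add: "alt a b (p + q) = alt a b p @ (if even p then alt a b q else alt b a q)"
  by (induction p arbitrary: a b) auto

lemma rev_alt: "rev (alt a b q) = (if even q then alt b a q else alt a b q)"
proof (induction q arbitrary: a b)
  case (Suc q)
  then show ?case using alt_snoc[of a b q] alt_snoc[of b a q] by auto
qed simp

lemma alt_in_lists: "a \<in> A \<Longrightarrow> b \<in> A \<Longrightarrow> alt a b q \<in> lists A"
  by (induction q arbitrary: a b) auto

text \<open>Chebyshev polynomials of the second kind, shifted and rescaled: \<open>cheb t r\<close>
  is U_(r-1)(t/2). At t = 2 cos \<theta> it equals sin(r \<theta>) / sin \<theta> whenever sin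
  \<theta> is nonzero, which makes it the coefficient in the roots of a finite dihedral group; at t
  = 2 it degenerates to r, the infinite case.\<close>

fun cheb :: "real \<Rightarrow> nat \<Rightarrow> real" where
  "cheb t 0 = 0"
| "cheb t (Suc 0) = 1"
| "cheb t (Suc (Suc r)) = t * cheb t (Suc r) - cheb t r"

lemma cheb_sin: "cheb (2 * cos \<theta>) r * sin \<theta> = sin (real r * \<theta>)"
proof (induction "2 * cos \<theta>" r rule: cheb.induct)
  case (3 r)
  have "sin (real (Suc (Suc r)) * \<theta>) = sin (real (Suc r) * \<theta> + \<theta>)"
    by (simp add: algebra_simps)
  moreover have "sin (real r * \<theta>) = sin (real (Suc r) * \<theta> - \<theta>)"
    by (simp add: algebra_simps)
  ultimately have "sin (real (Suc (Suc r)) * \<theta>) = 2 * cos \<theta> * sin (real (Suc r) * \<theta>) - sin (real r * \<theta>)"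
    by (simp add: sin_add sin_diff)
  then show ?case using 3 by (simp add: algebra_simps)
qed auto

lemma cheb_2: "cheb 2 r = real r"
  by (induction "2::real" r rule: cheb.induct) auto

text \<open>The bound 4 is the hypothesis m \<ge> 3 k + 1 at k = 1. It governs the geometry of the
  Cayley graph; the number k enters later, with the graphs that represent a subgroup.\<close>

locale coxeter =
  fixes S :: "nat set" and m :: "nat \<Rightarrow> nat \<Rightarrow> enat"
  assumes finite_S: "finite S"
    and m_sym: "m i j = m j i"
    and m_ge4: "i \<in> S \<Longrightarrow> j \<in> S \<Longrightarrow> i \<noteq> j \<Longrightarrow> 4 \<le> m i j"
begin

text \<open>The Tits form B with B(e_i, e_i) = 1 is behind these formulas: \<open>kap i j\<close> is
  -2 B(e_i, e_j) for distinct i and j, \<open>bil i x\<close> is 2 B(e_i, x), and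
  \<open>sref i\<close> is the reflection in the root e_i. Vectors are functions on all natural
  numbers; reflections with index in S leave the coordinates outside S alone.\<close>

definition kap :: "nat \<Rightarrow> nat \<Rightarrow> real" where
  "kap i j = (case m i j of enat q \<Rightarrow> 2 * cos (pi / real q) | \<infinity> \<Rightarrow> 2)"

definition bil :: "nat \<Rightarrow> (nat \<Rightarrow> real) \<Rightarrow> real" where
  "bil i x = (\<Sum>j\<in>S. (if j = i then 2 else - kap i j) * x j)"

definition sref :: "nat \<Rightarrow> (nat \<Rightarrow> real) \<Rightarrow> (nat \<Rightarrow> real)" where
  "sref i x = x(i := x i - bil i x)"

definition basis :: "nat \<Rightarrow> nat \<Rightarrow> real" where
  "basis i = (\<lambda>j. if j = i then 1 else 0)"

text \<open>These linear maps stand for the group elements until the transfer at the end. That words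
  with the same map are equal in the presented group is obtained from
  \<open>val_eq_equivalent\<close>.\<close>

fun val :: "nat list \<Rightarrow> (nat \<Rightarrow> real) \<Rightarrow> (nat \<Rightarrow> real)" where
  "val [] = id"
| "val (i # w) = sref i \<circ> val w"

lemma val_append: "val (u @ v) = val u \<circ> val v"
  by (induction u) (simp_all add: comp_assoc)

lemma kap_sym: "kap i j = kap j i"
  by (simp add: kap_def m_sym[of i j])

lemma bil_upd:
  assumes "i \<in> S"
  shows "bil j (x(i := x i - c)) = bil j x - (if j = i then 2 else - kap i j) * c"
proof -
  have "bil j (x(i := x i - c)) =
    (\<Sum>l\<in>S. (if l = j then 2 else - kap j l) * x l - (if l = i then (if i = j then 2 else - kap j i) * c else 0))"
    unfolding bil_def by (rule sum.cong) (auto simp: algebra_simps)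
  also have "\<dots> = bil j x - (if i = j then 2 else - kap j i) * c"
    using assms finite_S by (simp add: sum_subtractf bil_def)
  finally show ?thesis by (auto simp: kap_sym)
qed

lemma bil_sref_same: "i \<in> S \<Longrightarrow> bil i (sref i x) = - bil i x"
  by (simp add: sref_def bil_upd)

lemma bil_sref_diff: "i \<in> S \<Longrightarrow> j \<noteq> i \<Longrightarrow> bil j (sref i x) = bil j x + kap i j * bil i x"
  by (simp add: sref_def bil_upd)

lemma sref_sref [simp]: "i \<in> S \<Longrightarrow> sref i (sref i x) = x"
  using bil_sref_same[of i x] by (auto simp: sref_def)

lemma sref_comp_sref [simp]: "i \<in> S \<Longrightarrow> sref i \<circ> sref i = id"
  by (rule ext) (simp add: comp_apply id_apply)

lemma comp_sref_sref [simp]: "i \<in> S \<Longrightarrow> g \<circ> sref i \<circ> sref i = g"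
  by (simp add: comp_assoc)

lemma val_rev_left: "w \<in> lists S \<Longrightarrow> val (rev w) \<circ> val w = id"
proof (induction w)
  case (Cons i w)
  have "val (rev (i # w)) \<circ> val (i # w) = val (rev w) \<circ> (sref i \<circ> sref i) \<circ> val w"
    by (simp add: val_append comp_assoc)
  also have "\<dots> = val (rev w) \<circ> val w" using Cons.prems by (simp add: comp_assoc)
  also have "\<dots> = id" using Cons by (intro Cons.IH) simp
  finally show ?case .
qed simp

lemma val_rev_right: "w \<in> lists S \<Longrightarrow> val w \<circ> val (rev w) = id"
  using val_rev_left[of "rev w"] by simp

lemma bil_linear: "bil i (\<lambda>j. a * x j + b * y j) = a * bil i x + b * bil i y"
  by (simp add: bil_def sum_distrib_left sum.distrib[symmetric] algebra_simps)

lemma sref_linear: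
  "sref i (\<lambda>j. a * x j + b * y j) = (\<lambda>j. a * sref i x j + b * sref i y j)"
  by (auto simp: sref_def bil_linear fun_eq_iff algebra_simps)

lemma val_linear:
  "val w (\<lambda>j. a * x j + b * y j) = (\<lambda>j. a * val w x j + b * val w y j)"
  by (induction w) (simp_all add: sref_linear comp_apply id_apply)

lemma bil_basis: "j \<in> S \<Longrightarrow> bil i (basis j) = (if j = i then 2 else - kap i j)"
  using finite_S by (simp add: bil_def basis_def if_distrib[of "\<lambda>x. _ * x"] cong: if_cong)

text \<open>Applying the reflections \<open>b, a, b, \<dots>\<close> to \<open>x\<close> subtracts multiples \<open>c r\<close> of basis
  vectors which obey the recurrence of \<open>cheb\<close>.\<close>

lemma alternating_orbit:
  assumes ab: "a \<in> S" "b \<in> S" "a \<noteq> b"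
    and c0: "c 0 = bil b x" and c1: "c (Suc 0) = bil a x + kap a b * c 0"
    and crec: "\<And>r. c (Suc (Suc r)) = kap a b * c (Suc r) - c r"
  shows "bil b (val (alt a b (2 * r)) x) = c (2 * r)
    \<and> bil a (val (alt a b (2 * r)) x) = c (Suc (2 * r)) - kap a b * c (2 * r)
    \<and> val (alt a b (2 * r)) x
      = (\<lambda>j. x j - (if j = b then \<Sum>i<r. c (2 * i) else 0) - (if j = a then \<Sum>i<r. c (Suc (2 * i)) else 0))"
proof (induction r)
  case 0
  then show ?case using c0 c1 by (simp add: fun_eq_iff id_apply)
next
  case (Suc r)
  let ?x = "val (alt a b (2 * r)) x"
  have step: "val (alt a b (2 * Suc r)) x = sref a (sref b ?x)" by (simp add: comp_apply)
  have b: "bil b ?x = c (2 * r)" and a: "bil a ?x = c (Suc (2 * r)) - kap a b * c (2 * r)"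
    and e: "?x = (\<lambda>j. x j - (if j = b then \<Sum>i<r. c (2 * i) else 0)
      - (if j = a then \<Sum>i<r. c (Suc (2 * i)) else 0))"
    using Suc by blast+
  have b1: "bil b (sref b ?x) = - c (2 * r)" using bil_sref_same ab b by simp
  have a1: "bil a (sref b ?x) = c (Suc (2 * r))"
    using bil_sref_diff[of b a ?x] ab a b kap_sym[of a b] by simp
  have a2: "bil a (sref a (sref b ?x)) = - c (Suc (2 * r))"
    using bil_sref_same ab a1 by simp
  have b2: "bil b (sref a (sref b ?x)) = c (Suc (Suc (2 * r)))"
    using bil_sref_diff[of a b "sref b ?x"] ab a1 b1 crec by simp
  have "sref a (sref b ?x) = (?x(b := ?x b - c (2 * r)))(a := ?x a - c (Suc (2 * r)))"
    using a1 b ab by (simp add: sref_def)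
  also have "\<dots> = (\<lambda>j. x j - (if j = b then \<Sum>i<Suc r. c (2 * i) else 0)
      - (if j = a then \<Sum>i<Suc r. c (Suc (2 * i)) else 0))"
    unfolding e using ab by (auto simp: fun_eq_iff)
  finally show ?case using a2 b2 crec[of "Suc (2 * r)"] unfolding step by simp
qed

lemma kap_finite:
  assumes "a \<in> S" "b \<in> S" "a \<noteq> b" "m a b = enat q"
  shows "kap a b = 2 * cos (pi / real q)" "4 \<le> q" "0 < sin (pi / real q)"
proof -
  show "kap a b = 2 * cos (pi / real q)" using assms by (simp add: kap_def)
  show q: "4 \<le> q" using m_ge4[OF assms(1-3)] assms(4) by (simp add: numeral_eq_enat)
  show "0 < sin (pi / real q)" using q by (intro sin_gt_zero) (auto simp: field_simps)
qed

text \<open>The corrections \<open>c r\<close> of \<open>alternating_orbit\<close> have period 2 q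
  because the sine has. By the recurrence their sums A and B over the even and the odd indices of
  one period satisfy t B = 2 A and t A = 2 B; as t * t \<noteq> 4, both sums vanish and x is
  fixed.\<close>

lemma val_alt_relator:
  assumes ab: "a \<in> S" "b \<in> S" "a \<noteq> b" and q: "m a b = enat q"
  shows "val (alt a b (2 * q)) = id"
proof
  fix x
  define t where "t = kap a b"
  define \<theta> where "\<theta> = pi / real q"
  note kf = kap_finite[OF ab q]
  have t: "t = 2 * cos \<theta>" and q4: "4 \<le> q" and s0: "0 < sin \<theta>" using kf by (auto simp: t_def \<theta>_def)
  \<comment> \<open>The solution of the recurrence with initial values \<open>bil b x\<close> and
    \<open>bil a x + t * bil b x\<close>. The entry -1 for r = 0 is \<open>cheb\<close> continued
    backwards to the index -1.\<close>
  define c where "c r = (bil a x + t * bil b x) * cheb t r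
    - bil b x * (if r = 0 then - 1 else cheb t (r - 1))" for r
  have crec: "c (Suc (Suc r)) = t * c (Suc r) - c r" for r
    by (cases r) (auto simp: c_def algebra_simps)
  have orbit: "val (alt a b (2 * q)) x
      = (\<lambda>j. x j - (if j = b then \<Sum>i<q. c (2 * i) else 0) - (if j = a then \<Sum>i<q. c (Suc (2 * i)) else 0))"
    using alternating_orbit[of a b c x q] ab crec by (simp add: c_def t_def)
  have per: "cheb t (r + 2 * q) = cheb t r" for r
  proof -
    have "sin (real (r + 2 * q) * \<theta>) = sin (real r * \<theta> + 2 * pi)"
      using q4 by (simp add: \<theta>_def field_simps)
    then have "cheb t (r + 2 * q) * sin \<theta> = cheb t r * sin \<theta>"
      unfolding t cheb_sin by simp
    then show ?thesis using s0 by simp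
  qed
  have ceq: "c (Suc r) = (bil a x + t * bil b x) * cheb t (Suc r) - bil b x * cheb t r" for r
    by (simp add: c_def)
  have cper1: "c (Suc r + 2 * q) = c (Suc r)" for r
    unfolding add_Suc ceq using per[of r] per[of "Suc r"] by simp
  have cper0: "c (2 * q) = c 0"
    using crec[of 0] crec[of "2 * q"] cper1[of 0] cper1[of 1] by simp
  have shift: "(\<Sum>i<q. f (Suc i)) = (\<Sum>i<q. f i)" if "f q = f 0" for f :: "nat \<Rightarrow> real"
    using sum.lessThan_Suc_shift[of f q] sum.lessThan_Suc[of f q] that by simp
  define A where "A = (\<Sum>i<q. c (2 * i))"
  define B where "B = (\<Sum>i<q. c (Suc (2 * i)))"
  have "t * B = (\<Sum>i<q. c (2 * Suc i) + c (2 * i))"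
    unfolding B_def sum_distrib_left by (rule sum.cong) (auto simp: crec)
  also have "\<dots> = 2 * A"
    using shift[of "\<lambda>i. c (2 * i)"] cper0 by (simp add: sum.distrib A_def)
  finally have 1: "t * B = 2 * A" .
  have "t * A = t * (\<Sum>i<q. c (2 * Suc i))"
    unfolding A_def using shift[of "\<lambda>i. c (2 * i)"] cper0 by simp
  also have "\<dots> = (\<Sum>i<q. c (Suc (2 * Suc i)) + c (Suc (2 * i)))"
    unfolding sum_distrib_left by (rule sum.cong) (auto simp: crec)
  also have "\<dots> = 2 * B"
    using shift[of "\<lambda>i. c (Suc (2 * i))"] cper1[of 0] by (simp add: sum.distrib B_def)
  finally have 2: "t * A = 2 * B" .
  have "cos \<theta> < 1"
    using s0 sin_cos_squared_add[of \<theta>] cos_le_one[of \<theta>]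
    by (metis add_cancel_left_left less_eq_real_def one_power2 power_zero_numeral less_irrefl zero_eq_power2)
  moreover have "0 \<le> cos \<theta>" 
  proof (rule cos_ge_zero)
    show "\<theta> \<le> pi / 2" using q4 by (simp add: \<theta>_def field_simps)
    have "0 \<le> \<theta>" by (simp add: \<theta>_def)
    then show "- (pi / 2) \<le> \<theta>" using pi_gt_zero by linarith
  qed
  ultimately have "(cos \<theta>)\<^sup>2 < 1" by (simp add: power2_eq_square mult_less_cancel_left2 
      abs_square_less_1[unfolded power2_eq_square])
  then have "t * t \<noteq> 4" by (simp add: t power2_eq_square)
  moreover have "t * t * A = 4 * A" using 1 2 by algebra
  ultimately have "A = 0" by simp
  moreover have "B = 0" using 2 \<open>A = 0\<close> by simp
  ultimately show "val (alt a b (2 * q)) x = id x" using orbit by (simp add: A_def B_def fun_eq_iff id_apply)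
qed

lemma val_braid:
  assumes ab: "a \<in> S" "b \<in> S" "a \<noteq> b" and q: "m a b = enat q"
  shows "val (alt a b q) = val (alt b a q)"
proof -
  have l: "alt b a q \<in> lists S" using ab by (simp add: alt_in_lists)
  have "id = val (alt a b (q + q))" using val_alt_relator[OF assms] by (simp add: mult_2)
  also have "\<dots> = val (alt a b q) \<circ> val (rev (alt b a q))"
    unfolding alt_add rev_alt by (simp add: val_append)
  finally have "val (alt a b q) \<circ> val (rev (alt b a q)) \<circ> val (alt b a q) = val (alt b a q)" by simp
  then show ?thesis using val_rev_left[OF l] by (simp add: comp_assoc)
qed

text \<open>Roots of the dihedral subgroup in terms of its two simple roots. By
  \<open>cheb_kap_nonneg\<close> both coefficients are nonnegative as long as q < m a b, and every
  ascent argument rests on this.\<close>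

lemma val_alt_basis:
  assumes ab: "a \<in> S" "b \<in> S" "a \<noteq> b"
  shows "val (rev (alt a b q)) (basis b) =
    (\<lambda>j. cheb (kap a b) (Suc q) * basis (if even q then b else a) j + cheb (kap a b) q * basis (if even q then a else b) j)"
proof (induction q)
  case 0
  then show ?case by (simp add: id_apply)
next
  case (Suc q)
  let ?x = "if even q then a else b" and ?y = "if even q then b else a"
  have x: "?x \<in> S" "?y \<in> S" "?x \<noteq> ?y" using ab by auto
  have "bil ?x (basis ?y) = - kap a b" "bil ?x (basis ?x) = 2"
    using x by (auto simp: bil_basis kap_sym)
  then have r: "sref ?x (basis ?y) = (\<lambda>j. basis ?y j + kap a b * basis ?x j)"
    "sref ?x (basis ?x) = (\<lambda>j. - basis ?x j)"
    unfolding sref_def by (auto simp: fun_eq_iff basis_def)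
  have "val (rev (alt a b (Suc q))) (basis b) = sref ?x (val (rev (alt a b q)) (basis b))"
    by (simp add: alt_snoc comp_apply del: alt.simps)
  also have "\<dots> = (\<lambda>j. cheb (kap a b) (Suc q) * (basis ?y j + kap a b * basis ?x j) - cheb (kap a b) q * basis ?x j)"
    unfolding Suc sref_linear r by simp
  finally show ?case by (auto simp: fun_eq_iff algebra_simps)
qed

lemma cheb_kap_nonneg:
  assumes ab: "a \<in> S" "b \<in> S" "a \<noteq> b" and q: "enat q \<le> m a b"
  shows "0 \<le> cheb (kap a b) q"
proof (cases "m a b")
  case (enat p)
  note kf = kap_finite[OF ab enat]
  have "0 \<le> sin (real q * (pi / real p))"
    using q enat kf(2) by (intro sin_ge_zero) (auto simp: field_simps)
  then have "0 \<le> cheb (kap a b) q * sin (pi / real p)" using kf(1) by (simp add: cheb_sin)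
  then show ?thesis using kf(3) by (simp add: zero_le_mult_iff)
next
  case infinity
  then show ?thesis by (simp add: kap_def cheb_2)
qed

section \<open>Length and descents\<close>

definition W :: "((nat \<Rightarrow> real) \<Rightarrow> nat \<Rightarrow> real) set" where
  "W = val ` lists S"

definition len :: "((nat \<Rightarrow> real) \<Rightarrow> nat \<Rightarrow> real) \<Rightarrow> nat" where
  "len g = (LEAST l. \<exists>w\<in>lists S. length w = l \<and> val w = g)"

definition desc :: "((nat \<Rightarrow> real) \<Rightarrow> nat \<Rightarrow> real) \<Rightarrow> nat \<Rightarrow> bool" where
  "desc g i \<longleftrightarrow> len (g \<circ> sref i) < len g"

lemma val_in_W [intro]: "w \<in> lists S \<Longrightarrow> val w \<in> W"
  by (simp add: W_def)

lemma W_comp_val [intro]: "g \<in> W \<Longrightarrow> w \<in> lists S \<Longrightarrow> g \<circ> val w \<in> W"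
  unfolding W_def by (auto simp: val_append[symmetric] )

lemma W_comp_sref [intro]: "g \<in> W \<Longrightarrow> i \<in> S \<Longrightarrow> g \<circ> sref i \<in> W"
  using W_comp_val[of g "[i]"] by simp

lemma reduced_word:
  assumes "g \<in> W" obtains w where "w \<in> lists S" "val w = g" "length w = len g"
proof -
  obtain v where "v \<in> lists S" "val v = g" using assms by (auto simp: W_def)
  then have "\<exists>l. \<exists>w\<in>lists S. length w = l \<and> val w = g" by blast
  from LeastI_ex[OF this] show ?thesis using that unfolding len_def by blast
qed

lemma len_val_le: "w \<in> lists S \<Longrightarrow> len (val w) \<le> length w"
  unfolding len_def by (rule Least_le) blast

lemma len_comp_val_le: "g \<in> W \<Longrightarrow> w \<in> lists S \<Longrightarrow> len (g \<circ> val w) \<le> len g + length w"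
  by (metis append_in_lists_conv len_val_le length_append reduced_word val_append)

lemma len_comp_sref_le: "g \<in> W \<Longrightarrow> i \<in> S \<Longrightarrow> len (g \<circ> sref i) \<le> Suc (len g)"
  using len_comp_val_le[of g "[i]"] by simp

lemma len_le_comp_sref: "g \<in> W \<Longrightarrow> i \<in> S \<Longrightarrow> len g \<le> Suc (len (g \<circ> sref i))"
  using len_comp_sref_le[of "g \<circ> sref i" i] W_comp_sref[of g i] by simp

lemma len_id [simp]: "len id = 0"
  using len_val_le[of "[]"] by simp

lemma W_inj:
  assumes "g \<in> W" "g x = g y" shows "x = y"
proof -
  obtain w where w: "w \<in> lists S" "g = val w" using assms(1) by (auto simp: W_def)
  then show ?thesis using assms(2) val_rev_left[OF w(1)] by (metis comp_apply id_apply)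
qed

lemma W_linear:
  "g \<in> W \<Longrightarrow> g (\<lambda>j. a * x j + b * y j) = (\<lambda>j. a * g x j + b * g y j)"
  unfolding W_def by (auto simp: val_linear)

text \<open>A prepended letter either cancels against the first letter of the alternating word or
  lengthens it. At full length m the braid relation lets the word start with either letter, so there
  the letter always cancels, and the bound on q survives.\<close>

lemma dihedral_normal_form:
  assumes ab: "a \<in> S" "b \<in> S" "a \<noteq> b" and p: "p \<in> lists {a, b}"
  shows "\<exists>x y q. {x, y} = {a, b} \<and> q \<le> length p \<and> enat q \<le> m a b \<and> val p = val (alt x y q)"
  using p
proof (induction p)
  case Nil
  have "val [] = val (alt a b 0)" "enat 0 \<le> m a b" by (auto simp: zero_enat_def[symmetric])
  then show ?case by (metis order.refl list.size(3))
next
  case (Cons i p)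
  then obtain x y q where IH: "{x, y} = {a, b}" "q \<le> length p" "enat q \<le> m a b" "val p = val (alt x y q)"
    by auto
  have xy: "x \<in> S" "y \<in> S" "x \<noteq> y" using IH(1) ab by (auto simp: doubleton_eq_iff)
  have mxy: "m x y = m a b" using IH(1) m_sym[of a b] by (auto simp: doubleton_eq_iff)
  have i: "i = x \<or> i = y" using Cons IH(1) by auto
  have down: ?case if ex: "\<exists>y. {i, y} = {a, b} \<and> val p = val (alt i y q)" and "q > 0"
  proof -
    obtain y where y: "{i, y} = {a, b}" "val p = val (alt i y q)" using ex by blast
    obtain q' where q': "q = Suc q'" using \<open>q > 0\<close> by (cases q) auto
    have "i \<in> S" using y ab by auto
    then have "val (i # p) = val (alt y i q')" using y(2) q' by (simp add: o_assoc)
    moreover have "{y, i} = {a, b}" using y(1) by auto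
    moreover have "q' \<le> length (i # p)" "enat q' \<le> m a b"
      using IH(2,3) q' order.trans[OF _ IH(3), of "enat q'"] by auto
    ultimately show ?case by blast
  qed
  show ?case
  proof (cases "q > 0 \<and> (i = x \<or> enat q = m a b)")
    case True
    have "\<exists>y. {i, y} = {a, b} \<and> val p = val (alt i y q)"
    proof (cases "i = x")
      case True then show ?thesis using IH by blast
    next
      case False
      then have "m x y = enat q" "i = y" using \<open>q > 0 \<and> _\<close> i mxy by auto
      then show ?thesis using val_braid[OF xy] IH by (metis insert_commute)
    qed
    then show ?thesis using down True by blast
  next
    case False
    show ?thesis
    proof (cases "q = 0")
      case True
      obtain z where z: "{i, z} = {a, b}" using i IH(1) by blast
      have "val (i # p) = val (alt i z (Suc 0))" using IH(4) True by simp
      moreover have "enat (Suc 0) \<le> m a b"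
        using m_ge4[OF ab] order.trans[of "enat 1" 4] by (simp add: numeral_eq_enat)
      moreover have "Suc 0 \<le> length (i # p)" by simp
      ultimately show ?thesis using z by blast
    next
      case q: False
      then have iy: "i = y" and lt: "enat q < m a b" using False i IH(3) by auto
      have "val (i # p) = val (alt y x (Suc q))" using iy IH(4) by simp
      moreover have "{y, x} = {a, b}" using IH(1) by blast
      moreover have "enat (Suc q) \<le> m a b" using lt by (simp add: Suc_ile_eq)
      moreover have "Suc q \<le> length (i # p)" using IH(2) by simp
      ultimately show ?thesis by blast
    qed
  qed
qed

text \<open>The classical link between length and positive roots. A reduced word of g ends in some t
  \<noteq> s; among all factorisations of g into v and an element of the subgroup of s and t with
  additive lengths, take one with shortest v. Then v ascends along both s and t, so by induction it
  maps both simple roots to nonnegative vectors, and \<open>g (basis s)\<close> is a nonnegative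
  combination of these. The hypothesis is the weak inequality because equality of lengths is ruled
  out only in \<open>len_asc\<close>.\<close>

theorem ascent_imp_nonneg:
  assumes "g \<in> W" "s \<in> S" "len g \<le> len (g \<circ> sref s)"
  shows "0 \<le> g (basis s) j"
  using assms
proof (induction "len g" arbitrary: g s j rule: less_induct)
  case less
  show ?case
  proof (cases "g = id")
    case True then show ?thesis by (simp add: basis_def id_apply)
  next
    case False
    obtain w where w: "w \<in> lists S" "val w = g" "length w = len g" using less.prems(1) by (rule reduced_word)
    with False have "w \<noteq> []" by auto
    then obtain w' t where wt: "w = w' @ [t]" by (metis rev_exhaust)
    have tS: "t \<in> S" and w': "w' \<in> lists S" using w(1) wt by auto
    have gt: "g = val w' \<circ> sref t" using w(2) wt by (simp add: val_append)
    have gt2: "g \<circ> sref t = val w'" using gt tS by simp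
    have lt: "len (val w') < len g" using len_val_le[OF w'] w(3) wt by simp
    have st: "s \<noteq> t" using lt less.prems(3) gt2 by auto
    define A where "A v p \<longleftrightarrow> v \<in> W \<and> p \<in> lists {s, t} \<and> g = v \<circ> val p \<and> len v + length p = len g" for v p
    have "len g \<le> Suc (len (val w'))" using len_comp_sref_le[OF val_in_W[OF w'] tS] gt by simp
    then have "len (val w') + 1 = len g" using lt by simp
    then have Aw: "A (val w') [t]" unfolding A_def using gt val_in_W[OF w'] by simp
    then have ex: "\<exists>v p. A v p" by (intro exI)
    define l where "l = (LEAST l. \<exists>v p. A v p \<and> len v = l)"
    have "\<exists>v p. A v p \<and> len v = l" unfolding l_def
      by (rule LeastI_ex) (use ex in metis)
    then obtain v p where v: "A v p" "len v = l" by blast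
    have lmin: "l \<le> len v'" if "A v' p'" for v' p'
      unfolding l_def using that by (intro Least_le) blast
    have vW: "v \<in> W" and p: "p \<in> lists {s, t}" and gv: "g = v \<circ> val p" and gl: "len v + length p = len g"
      using v(1) by (auto simp: A_def )
    have lv: "len v < len g" using lmin[OF Aw] v(2) lt by simp
    have asc: "len v \<le> len (v \<circ> sref z)" if z: "z \<in> {s, t}" for z
    proof (rule ccontr)
      assume "\<not> ?thesis"
      then have 1: "len (v \<circ> sref z) < len v" by simp
      have zS: "z \<in> S" using z tS less.prems by auto
      have e: "g = (v \<circ> sref z) \<circ> val (z # p)" using gv zS by (simp add: o_assoc)
      have zp: "z # p \<in> lists S"
        using p zS tS less.prems(2) lists_mono[of "{s, t}" S] by auto
      have "len g \<le> len (v \<circ> sref z) + Suc (length p)"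
        using len_comp_val_le[OF W_comp_sref[OF vW zS] zp] e by simp
      with 1 gl have "len (v \<circ> sref z) + length (z # p) = len g" by simp
      then have "A (v \<circ> sref z) (z # p)" unfolding A_def using e vW zS p z by auto
      from lmin[OF this] 1 v(2) show False by simp
    qed
    have sS: "s \<in> S" by fact
    have pos: "0 \<le> v (basis z) i" if "z \<in> {s, t}" for z i
      using less.hyps[OF lv vW _ asc[OF that]] that sS tS by auto
    obtain x y q where n: "{x, y} = {s, t}" "q \<le> length p" "enat q \<le> m s t" "val p = val (alt x y q)"
      using dihedral_normal_form[OF sS tS st p] by blast
    have xy: "x \<in> S" "y \<in> S" "x \<noteq> y" and mxy: "m x y = m s t"
      using n(1) sS tS st m_sym[of s t] by (auto simp: doubleton_eq_iff)
    \<comment> \<open>A word for p of this kind, ending in s, would show that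
      \<open>g \<circ> sref s\<close> is shorter than g, against the ascent.\<close>
    have no: "val p \<noteq> val (u @ [s])" if "u \<in> lists S" "length u < length p" for u
    proof
      assume e: "val p = val (u @ [s])"
      have "g \<circ> sref s = v \<circ> val u \<circ> (sref s \<circ> sref s)" using gv e by (simp add: val_append comp_assoc)
      then have "g \<circ> sref s = v \<circ> val u" using sS by simp
      then have "len (g \<circ> sref s) \<le> len v + length u" using len_comp_val_le[OF vW that(1)] by simp
      then show False using that(2) gl less.prems(3) by simp
    qed
    have al: "alt x' y' q' \<in> lists S" if "{x', y'} = {s, t}" for x' y' q'
      using that sS tS by (intro alt_in_lists) auto
    define e where "e = rev (alt t s q)"
    \<comment> \<open>So p is empty or alternates with last letter t, and it is not the longest
      element, which by the braid relation could also end in s. This leaves room for the coefficient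
      with index q + 1.\<close>
    have ve: "val p = val e \<and> enat (Suc q) \<le> m s t"
    proof (cases q)
      case 0
      have "enat 1 \<le> m s t" using m_ge4[OF sS tS st] order.trans[of "enat 1" 4] by (simp add: numeral_eq_enat)
      with 0 show ?thesis using n(4) by (simp add: e_def)
    next
      case (Suc r)
      define c where "c = (if even r then x else y)"
      have as: "alt x y q = alt x y r @ [c]" unfolding Suc alt_snoc c_def ..
      have cs: "c \<noteq> s" using no[of "alt x y r"] n(2,4) as Suc al[OF n(1)]
        by (metis Suc_le_lessD length_alt)
      then have ct: "c = t" using n(1) unfolding c_def by auto
      have 1: "alt x y q = rev (alt t s q)"
        using ct n(1) st Suc unfolding rev_alt c_def by (auto simp: doubleton_eq_iff split: if_splits)
      have "enat q \<noteq> m s t"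
      proof
        assume q: "enat q = m s t"
        have "val p = val (alt y x q)" using val_braid[OF xy, of q] n(4) q mxy by simp
        moreover have "alt y x q = alt y x r @ [s]"
          unfolding Suc alt_snoc using ct n(1) st unfolding c_def by (auto simp: doubleton_eq_iff split: if_splits)
        moreover have "alt y x r \<in> lists S" using n(1) by (intro al) auto
        ultimately show False using no[of "alt y x r"] n(2) Suc
          by (metis Suc_le_lessD length_alt)
      qed
      then have "enat q < m s t" using n(3) by simp
      then show ?thesis using 1 n(4) by (simp add: e_def Suc_ile_eq)
    qed
    have q: "enat q \<le> m s t" by fact
    have "g (basis s) = v (val (rev (alt t s q)) (basis s))" using gv ve by (simp add: e_def comp_apply)
    also have "\<dots> = (\<lambda>j. cheb (kap t s) (Suc q) * v (basis (if even q then s else t)) j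
        + cheb (kap t s) q * v (basis (if even q then t else s)) j)"
      using st by (simp only: val_alt_basis[OF tS sS st[symmetric]] W_linear[OF vW])
    finally show ?thesis
      using pos cheb_kap_nonneg[OF sS tS st, of q] cheb_kap_nonneg[OF sS tS st, of "Suc q"] ve n(3)
      by (simp add: kap_sym[of t s] del: cheb.simps)
  qed
qed

lemma pos_root: "g \<in> W \<Longrightarrow> i \<in> S \<Longrightarrow> \<not> desc g i \<Longrightarrow> 0 \<le> g (basis i) j"
  using ascent_imp_nonneg by (simp add: desc_def)

lemma sref_basis:
  assumes "i \<in> S" shows "sref i (basis i) = (\<lambda>j. (-1) * basis i j + 0 * basis i j)"
  unfolding sref_def bil_basis[OF assms] by (auto simp: basis_def fun_eq_iff)

lemma neg_root:
  assumes "g \<in> W" "i \<in> S" "desc g i" shows "g (basis i) j \<le> 0"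
proof -
  have "(g \<circ> sref i) (basis i) j = - g (basis i) j"
    using W_linear[OF assms(1), of "-1" "basis i" 0 "basis i"] sref_basis[OF assms(2)] by (simp add: comp_apply)
  moreover have "0 \<le> (g \<circ> sref i) (basis i) j"
    using assms by (intro ascent_imp_nonneg) (auto simp: desc_def)
  ultimately show ?thesis by simp
qed

lemma root_nonzero:
  assumes "g \<in> W" shows "g (basis i) \<noteq> (\<lambda>j. 0)"
proof
  assume "g (basis i) = (\<lambda>j. 0)"
  also have "\<dots> = g (\<lambda>j. 0)" using W_linear[OF assms, of 0 "basis i" 0 "basis i"] by simp
  finally have "basis i = (\<lambda>j. 0)" by (rule W_inj[OF assms])
  then show False by (metis basis_def zero_neq_one)
qed

lemma nonneg_imp_ascent:
  assumes "g \<in> W" "i \<in> S" "\<And>j. 0 \<le> g (basis i) j" shows "\<not> desc g i"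
proof
  assume "desc g i"
  then have "g (basis i) = (\<lambda>j. 0)"
    using neg_root[OF assms(1,2)] assms(3) by (auto simp: fun_eq_iff antisym)
  then show False using root_nonzero[OF assms(1)] by simp
qed

text \<open>Equal lengths are excluded by signs instead of parity: neither g nor
  \<open>g \<circ> sref i\<close> would descend along i, so the root and its negative would both be
  nonnegative, hence zero.\<close>

lemma len_asc: 
  assumes "g \<in> W" "i \<in> S" "\<not> desc g i" shows "len (g \<circ> sref i) = Suc (len g)"
proof -
  have "\<not> len (g \<circ> sref i) = len g"
  proof
    assume e: "len (g \<circ> sref i) = len g"
    then have "\<not> desc (g \<circ> sref i) i" using assms(2) by (simp add: desc_def)
    then have "0 \<le> (g \<circ> sref i) (basis i) j" for j
      using pos_root[OF W_comp_sref[OF assms(1,2)] assms(2)] by blast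
    moreover have "(g \<circ> sref i) (basis i) j = - g (basis i) j" for j
      using W_linear[OF assms(1), of "-1" "basis i" 0 "basis i"] sref_basis[OF assms(2)] by (simp add: comp_apply)
    ultimately have "g (basis i) = (\<lambda>j. 0)"
      using pos_root[OF assms] by (force simp: fun_eq_iff intro: antisym)
    then show False using root_nonzero[OF assms(1)] by simp
  qed
  then show ?thesis using assms(3) len_comp_sref_le[OF assms(1,2)] by (simp add: desc_def)
qed

lemma len_desc: "g \<in> W \<Longrightarrow> i \<in> S \<Longrightarrow> desc g i \<Longrightarrow> len g = Suc (len (g \<circ> sref i))"
  using len_le_comp_sref[of g i] by (simp add: desc_def)

lemma desc_comp_sref: "g \<in> W \<Longrightarrow> i \<in> S \<Longrightarrow> desc (g \<circ> sref i) i \<longleftrightarrow> \<not> desc g i"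
  using len_asc[of g i] unfolding desc_def by fastforce

text \<open>As h has no descent in the coset, it maps both simple roots to nonnegative vectors, and
  below the top the next root is a nonnegative combination of these.\<close>

lemma dihedral_ascent:
  assumes h: "h \<in> W" and ab: "a \<in> S" "b \<in> S" "a \<noteq> b" and nd: "\<not> desc h a" "\<not> desc h b"
    and q: "enat q < m a b"
  shows "\<not> desc (h \<circ> val (alt a b q)) (if even q then a else b)"
proof (rule nonneg_imp_ascent)
  define l where "l = (if even q then a else b)"
  define l' where "l' = (if even q then b else a)"
  have S: "l' \<in> S" "l \<in> S" "l' \<noteq> l" using ab by (auto simp: l_def l'_def)
  have "val (alt a b q) = val (rev (alt l' l q))" by (simp add: rev_alt l_def l'_def)
  then have e: "(h \<circ> val (alt a b q)) (basis l)
    = (\<lambda>j. cheb (kap l' l) (Suc q) * h (basis (if even q then l else l')) j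
        + cheb (kap l' l) q * h (basis (if even q then l' else l)) j)"
    by (simp only: comp_apply val_alt_basis[OF S] W_linear[OF h])
  have "0 \<le> h (basis l) j" "0 \<le> h (basis l') j" for j
    using pos_root[OF h] ab nd by (auto simp: l_def l'_def)
  moreover have "kap l' l = kap a b" using kap_sym by (simp add: l_def l'_def)
  moreover have "0 \<le> cheb (kap a b) q" "0 \<le> cheb (kap a b) (Suc q)"
    using cheb_kap_nonneg[OF ab] q by (auto simp: Suc_ile_eq order.strict_implies_order simp del: cheb.simps)
  ultimately show "0 \<le> (h \<circ> val (alt a b q)) (basis (if even q then a else b)) j" for j
    unfolding l_def[symmetric] e by (simp del: cheb.simps)
qed (use h ab alt_in_lists[OF ab(1,2)] in auto)

lemma len_dihedral:
  assumes h: "h \<in> W" and ab: "a \<in> S" "b \<in> S" "a \<noteq> b" and nd: "\<not> desc h a" "\<not> desc h b"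
  shows "enat q \<le> m a b \<Longrightarrow> len (h \<circ> val (alt a b q)) = len h + q"
proof (induction q)
  case (Suc q)
  have lt: "enat q < m a b" using Suc.prems by (simp add: Suc_ile_eq)
  have "h \<circ> val (alt a b (Suc q)) = h \<circ> val (alt a b q) \<circ> sref (if even q then a else b)"
    unfolding alt_snoc by (simp add: val_append comp_assoc)
  moreover have "len \<dots> = Suc (len (h \<circ> val (alt a b q)))"
    using ab by (intro len_asc dihedral_ascent[OF h ab nd lt]) (auto intro!: W_comp_val[OF h] alt_in_lists)
  ultimately show ?case using Suc.IH lt by (simp del: alt.simps)
qed simp

text \<open>\<open>dep a b g\<close> is the length of the dihedral part of \<open>g\<close> in the decomposition of \<open>g\<close>
  along the coset of the subgroup generated by the reflections \<open>a\<close> and \<open>b\<close>.\<close>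

definition dep :: "nat \<Rightarrow> nat \<Rightarrow> ((nat \<Rightarrow> real) \<Rightarrow> nat \<Rightarrow> real) \<Rightarrow> nat" where
  "dep a b g = len g - (LEAST l. \<exists>p\<in>lists {a, b}. l = len (g \<circ> val p))"

lemma dep_sym: "dep a b g = dep b a g"
  by (simp add: dep_def insert_commute)

lemma dihedral_lists: "a \<in> S \<Longrightarrow> b \<in> S \<Longrightarrow> p \<in> lists {a, b} \<Longrightarrow> p \<in> lists S"
  using lists_mono[of "{a, b}" S] by auto

text \<open>By the normal form and \<open>len_dihedral\<close> every element of the coset has length
  \<open>len h + r\<close> for some r, so h is a shortest one and the subtraction in
  \<open>dep\<close> yields q.\<close>

lemma dep_decomp:
  assumes h: "h \<in> W" and ab: "a \<in> S" "b \<in> S" "a \<noteq> b" and nd: "\<not> desc h a" "\<not> desc h b"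
    and q: "enat q \<le> m a b"
  shows "dep a b (h \<circ> val (alt a b q)) = q"
proof -
  let ?g = "h \<circ> val (alt a b q)"
  have "(LEAST l. \<exists>p\<in>lists {a, b}. l = len (?g \<circ> val p)) = len h"
  proof (rule Least_equality)
    have "?g \<circ> val (rev (alt a b q)) = h"
      using val_rev_right[OF alt_in_lists[OF ab(1,2)]] by (simp add: comp_assoc)
    moreover have "rev (alt a b q) \<in> lists {a, b}" by (simp add: alt_in_lists)
    ultimately show "\<exists>p\<in>lists {a, b}. len h = len (?g \<circ> val p)" by metis
  next
    fix l assume "\<exists>p\<in>lists {a, b}. l = len (?g \<circ> val p)"
    then obtain p where p: "p \<in> lists {a, b}" "l = len (?g \<circ> val p)" by blast
    have ap: "alt a b q @ p \<in> lists {a, b}" using p by (simp add: alt_in_lists)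
    obtain x y r where r: "{x, y} = {a, b}" "enat r \<le> m a b" "val (alt a b q @ p) = val (alt x y r)"
      using dihedral_normal_form[OF ab ap] by blast
    have "l = len (h \<circ> val (alt x y r))" using p(2) r(3) by (simp add: val_append comp_assoc)
    also have "\<dots> = len h + r"
      using r ab nd m_sym[of a b] by (intro len_dihedral[OF h]) (auto simp: doubleton_eq_iff)
    finally show "len h \<le> l" by simp
  qed
  then show ?thesis unfolding dep_def len_dihedral[OF h ab nd q] by simp
qed

lemma dihedral_decomp:
  assumes g: "g \<in> W" and ab: "a \<in> S" "b \<in> S" "a \<noteq> b"
  obtains h x y where "h \<in> W" "\<not> desc h a" "\<not> desc h b" "{x, y} = {a, b}" "enat (dep a b g) \<le> m a b"
    "g = h \<circ> val (alt x y (dep a b g))"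
proof -
  let ?P = "\<lambda>l. \<exists>p\<in>lists {a, b}. l = len (g \<circ> val p)"
  have "?P (len (g \<circ> val []))" by (intro bexI[of _ "[]"]) auto
  then have "?P (LEAST l. ?P l)" by (rule LeastI)
  then obtain p where p: "p \<in> lists {a, b}" "(LEAST l. ?P l) = len (g \<circ> val p)" by blast
  have pS: "p \<in> lists S" using dihedral_lists[OF ab(1,2) p(1)] .
  let ?h = "g \<circ> val p"
  have h: "?h \<in> W" using g pS by blast
  have nd: "\<not> desc ?h z" if "z \<in> {a, b}" for z
  proof -
    have "?P (len (g \<circ> val (p @ [z])))" using p(1) that by (intro bexI[of _ "p @ [z]"]) auto
    then have "len ?h \<le> len (g \<circ> val (p @ [z]))" using p(2) Least_le[of ?P] by metis
    then show ?thesis by (simp add: desc_def val_append comp_assoc)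
  qed
  have rp: "rev p \<in> lists {a, b}" using p by simp
  obtain x y q where q: "{x, y} = {a, b}" "enat q \<le> m a b" "val (rev p) = val (alt x y q)"
    using dihedral_normal_form[OF ab rp] by blast
  have ge: "g = ?h \<circ> val (alt x y q)" using val_rev_right[OF pS] q(3) by (simp add: comp_assoc)
  have "dep x y (?h \<circ> val (alt x y q)) = q"
    using q(1,2) ab nd m_sym[of a b] by (intro dep_decomp[OF h]) (auto simp: doubleton_eq_iff)
  then have "dep a b g = q" using ge q(1) dep_sym[of a b] by (auto simp: doubleton_eq_iff)
  then show ?thesis using that[OF h nd nd q(1)] q(2) ge by simp
qed

text \<open>A dihedral coset is a polygon with 2 m vertices, or a line if m is infinite, standing on
  its shortest element: both letters descend only at the top, and neither descends only at the
  bottom.\<close>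

lemma desc_cases_dihedral:
  assumes g: "g \<in> W" and ab: "a \<in> S" "b \<in> S" "a \<noteq> b"
  shows "desc g a \<and> desc g b \<longleftrightarrow> m a b = enat (dep a b g)"
    and "desc g a \<or> desc g b \<longleftrightarrow> 0 < dep a b g"
proof -
  obtain h x y where h: "h \<in> W" "\<not> desc h a" "\<not> desc h b" "{x, y} = {a, b}" "enat (dep a b g) \<le> m a b"
    "g = h \<circ> val (alt x y (dep a b g))" by (rule dihedral_decomp[OF g ab])
  define q where "q = dep a b g"
  have xy: "x \<in> S" "y \<in> S" "x \<noteq> y" and ndx: "\<not> desc h x" "\<not> desc h y" and mxy: "m x y = m a b"
    using h(2-4) ab m_sym[of a b] by (auto simp: doubleton_eq_iff)
  have gq: "g = h \<circ> val (alt x y q)" and qm: "enat q \<le> m x y" using h mxy by (auto simp: q_def)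
  have last: "desc g (if even r then x else y)" if "q = Suc r" for r
  proof -
    have gr: "g = (h \<circ> val (alt x y r)) \<circ> sref (if even r then x else y)"
      using gq that unfolding \<open>q = Suc r\<close> alt_snoc by (simp add: val_append comp_assoc)
    have "enat r < m x y" using qm that by (simp add: Suc_ile_eq)
    from dihedral_ascent[OF h(1) xy ndx this]
    show ?thesis unfolding gr using xy
      by (subst desc_comp_sref) (auto intro!: W_comp_val[OF h(1)] alt_in_lists)
  qed
  have "desc g x \<and> desc g y \<longleftrightarrow> m x y = enat q"
  proof
    assume "desc g x \<and> desc g y"
    then have "\<not> enat q < m x y" using dihedral_ascent[OF h(1) xy ndx, of q] gq by metis
    then show "m x y = enat q" using qm by simp
  next
    assume mq: "m x y = enat q"
    then have "4 \<le> q" using kap_finite[OF xy] by simp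
    then obtain r where r: "q = Suc r" by (cases q) auto
    have 2: "g = h \<circ> val (alt y x q)" using gq val_braid[OF xy mq] by simp
    have gr: "g = (h \<circ> val (alt y x r)) \<circ> sref (if even r then y else x)"
      using 2 unfolding r alt_snoc by (simp add: val_append comp_assoc)
    have "enat r < m y x" using mq r m_sym[of x y] by simp
    from dihedral_ascent[OF h(1) xy(2,1) xy(3)[symmetric] ndx(2,1) this]
    have "desc g (if even r then y else x)" unfolding gr using xy
      by (subst desc_comp_sref) (auto intro!: W_comp_val[OF h(1)] alt_in_lists)
    then show "desc g x \<and> desc g y" using last[OF r] by (auto split: if_splits)
  qed
  then show "desc g a \<and> desc g b \<longleftrightarrow> m a b = enat (dep a b g)"
    using h(4) mxy by (auto simp: q_def doubleton_eq_iff)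
  have "desc g x \<or> desc g y \<longleftrightarrow> 0 < q"
  proof (cases q)
    case 0 then show ?thesis using gq ndx by simp
  next
    case (Suc r) then show ?thesis using last[OF Suc] by (auto split: if_splits)
  qed
  then show "desc g a \<or> desc g b \<longleftrightarrow> 0 < dep a b g"
    using h(4) by (auto simp: q_def doubleton_eq_iff)
qed

lemma coset_min_eq:
  assumes "z \<in> {a, b}" "z \<in> S"
  shows "(LEAST l. \<exists>p\<in>lists {a, b}. l = len (g \<circ> sref z \<circ> val p))
    = (LEAST l. \<exists>p\<in>lists {a, b}. l = len (g \<circ> val p))"
proof (rule arg_cong[where f = Least], rule ext, rule iffI)
  fix l assume "\<exists>p\<in>lists {a, b}. l = len (g \<circ> sref z \<circ> val p)"
  then obtain p where "p \<in> lists {a, b}" "l = len (g \<circ> val (z # p))" by (auto simp: comp_assoc)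
  then show "\<exists>p\<in>lists {a, b}. l = len (g \<circ> val p)" using assms by (intro bexI[of _ "z # p"]) auto
next
  fix l assume "\<exists>p\<in>lists {a, b}. l = len (g \<circ> val p)"
  then obtain p where p: "p \<in> lists {a, b}" "l = len (g \<circ> val p)" by auto
  have "g \<circ> sref z \<circ> val (z # p) = g \<circ> (sref z \<circ> sref z) \<circ> val p" by (simp add: comp_assoc)
  then have "l = len (g \<circ> sref z \<circ> val (z # p))" using p assms by simp
  then show "\<exists>p\<in>lists {a, b}. l = len (g \<circ> sref z \<circ> val p)" using assms p by (intro bexI[of _ "z # p"]) auto
qed

lemma dep_desc:
  assumes g: "g \<in> W" and ab: "a \<in> S" "b \<in> S" "a \<noteq> b" and z: "z \<in> {a, b}" "desc g z"
  shows "dep a b g = Suc (dep a b (g \<circ> sref z))"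
proof -
  have zS: "z \<in> S" using z ab by auto
  have "0 < dep a b g" using desc_cases_dihedral(2)[OF g ab] z by auto
  then show ?thesis
    unfolding dep_def coset_min_eq[OF z(1) zS] len_desc[OF g zS z(2)] by simp
qed

lemma dep_asc:
  assumes g: "g \<in> W" and ab: "a \<in> S" "b \<in> S" "a \<noteq> b" and z: "z \<in> {a, b}" "\<not> desc g z"
  shows "dep a b (g \<circ> sref z) = Suc (dep a b g)"
proof -
  have zS: "z \<in> S" using z ab by auto
  show ?thesis
    using dep_desc[OF W_comp_sref[OF g zS] ab z(1)] desc_comp_sref[OF g zS] z(2) zS by simp
qed

text \<open>The configuration reproduces itself at \<open>g \<circ> sref s\<close> with the letters rotated,
  so it would descend forever.\<close>

lemma no_chain_aux:
  assumes "g \<in> W" "s \<in> S" "t \<in> S" "u \<in> S" "s \<noteq> t" "t \<noteq> u" "s \<noteq> u"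
    and "desc g s" "desc g t" "desc (g \<circ> sref s) t" "desc (g \<circ> sref s) u"
  shows False
  using assms
proof (induction "len g" arbitrary: g s t u rule: less_induct)
  case less
  note W = less.prems(1) and S = less.prems(2-4) and d = less.prems(5-7)
  have g1: "g \<circ> sref s \<in> W" using W S by blast
  have g2: "g \<circ> sref s \<circ> sref t \<in> W" using g1 S by blast
  \<comment> \<open>g is the top of its coset for s and t, and \<open>g \<circ> sref s\<close> the
    top of its coset for t and u. Tops have depth at least 4, so after a further step along t both s
    and u still descend.\<close>
  have "m s t = enat (dep s t g)" using desc_cases_dihedral(1)[OF W S(1,2) d(1)] less.prems by blast
  then have "4 \<le> dep s t g" using kap_finite(2)[OF S(1,2) d(1)] by simp
  moreover have "dep s t g = Suc (dep s t (g \<circ> sref s))"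
    using dep_desc[OF W S(1,2) d(1)] less.prems by blast
  moreover have "dep s t (g \<circ> sref s) = Suc (dep s t (g \<circ> sref s \<circ> sref t))"
    using dep_desc[OF g1 S(1,2) d(1)] less.prems by blast
  ultimately have "0 < dep s t (g \<circ> sref s \<circ> sref t)" by simp
  moreover have "\<not> desc (g \<circ> sref s \<circ> sref t) t"
    using desc_comp_sref[OF g1 S(2)] less.prems by blast
  ultimately have ds: "desc (g \<circ> sref s \<circ> sref t) s"
    using desc_cases_dihedral(2)[OF g2 S(1,2) d(1)] by blast
  have "m t u = enat (dep t u (g \<circ> sref s))"
    using desc_cases_dihedral(1)[OF g1 S(2,3) d(2)] less.prems by blast
  then have "4 \<le> dep t u (g \<circ> sref s)" using kap_finite(2)[OF S(2,3) d(2)] by simp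
  moreover have "dep t u (g \<circ> sref s) = Suc (dep t u (g \<circ> sref s \<circ> sref t))"
    using dep_desc[OF g1 S(2,3) d(2)] less.prems by blast
  ultimately have "0 < dep t u (g \<circ> sref s \<circ> sref t)" by simp
  then have du: "desc (g \<circ> sref s \<circ> sref t) u"
    using desc_cases_dihedral(2)[OF g2 S(2,3) d(2)] desc_comp_sref[OF g1 S(2)] less.prems by blast
  show False
  proof (rule less.hyps[OF _ g1 S(2,3,1) d(2) _ _ less.prems(10,11) du ds])
    show "len (g \<circ> sref s) < len g" using less.prems(8) by (simp add: desc_def)
  qed (use d in auto)
qed

text \<open>An element with two descents is a top of depth at least 4, so a step along one of them
  keeps the others. A third letter descending at g or at \<open>g \<circ> sref s\<close> would
  therefore produce the forbidden configuration. In particular no element has more than two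
  descents.\<close>

lemma no_chain:
  assumes "g \<in> W" "s \<in> S" "t \<in> S" "u \<in> S" "s \<noteq> t" "u \<noteq> t" "u \<noteq> s"
    and "desc g s" "desc g t"
  shows "\<not> desc (g \<circ> sref s) u" "\<not> desc g u"
proof -
  have desc1: "desc (g \<circ> sref s) v" if "desc g v" "v \<in> S" "v \<noteq> s" for v
  proof -
    have "m s v = enat (dep s v g)" using desc_cases_dihedral(1)[OF assms(1,2)] that assms by blast
    then have "4 \<le> dep s v g" using kap_finite(2)[OF assms(2)] that by simp
    moreover have "dep s v g = Suc (dep s v (g \<circ> sref s))"
      using dep_desc[OF assms(1,2)] that assms by blast
    ultimately have "0 < dep s v (g \<circ> sref s)" by simp
    then show ?thesis
      using desc_cases_dihedral(2)[of "g \<circ> sref s" s v] desc_comp_sref[OF assms(1,2)] that assms by blast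
  qed
  show 1: "\<not> desc (g \<circ> sref s) u"
    using no_chain_aux[of g s t u] desc1[of t] assms by blast
  show "\<not> desc g u" using 1 desc1[of u] assms by blast
qed

section \<open>Good words\<close>

lemma not_desc_id: "i \<in> S \<Longrightarrow> \<not> desc id i"
  by (simp add: desc_def)

lemma id_in_W [simp]: "id \<in> W"
  using val_in_W[of "[]"] by simp

lemma desc_top:
  assumes "g \<in> W" "a \<in> S" "b \<in> S" "a \<noteq> b" "desc g a" "desc g b"
  shows "m a b = enat (dep a b g)" "4 \<le> dep a b g"
proof -
  show "m a b = enat (dep a b g)" using desc_cases_dihedral(1)[OF assms(1-4)] assms(5,6) by blast
  then show "4 \<le> dep a b g" using kap_finite(2)[OF assms(2-4)] by simp
qed

lemma dep_eq_0:
  assumes "g \<in> W" "a \<in> S" "b \<in> S" "a \<noteq> b" "\<not> desc g a" "\<not> desc g b"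
  shows "dep a b g = 0"
  using desc_cases_dihedral(2)[OF assms(1-4)] assms(5,6) by simp

lemma dep_pos:
  assumes "g \<in> W" "a \<in> S" "b \<in> S" "a \<noteq> b" "0 < dep a b g" "\<not> desc g a"
  shows "desc g b"
  using desc_cases_dihedral(2)[OF assms(1-4)] assms(5,6) by blast

lemma desc_step:
  assumes "g \<in> W" "a \<in> S" "b \<in> S" "a \<noteq> b" "desc g a" "2 \<le> dep a b g"
  shows "desc (g \<circ> sref a) b"
proof -
  have "dep a b g = Suc (dep a b (g \<circ> sref a))" using dep_desc[OF assms(1-4)] assms(5) by blast
  then show ?thesis
    using dep_pos[OF W_comp_sref[OF assms(1,2)] assms(2-4)] desc_comp_sref[OF assms(1,2)] assms(5,6) by simp
qed

text \<open>With depth at least two, b descends at \<open>g \<circ> sref a\<close>; another descent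
  z of g would contradict \<open>no_chain\<close>.\<close>

lemma desc_unique:
  assumes "g \<in> W" "a \<in> S" "b \<in> S" "z \<in> S" "a \<noteq> b" "z \<noteq> a" "z \<noteq> b" "desc g a" "2 \<le> dep a b g"
  shows "\<not> desc g z"
  using no_chain(1)[of g a z b] desc_step[OF assms(1-3,5,8,9)] assms by blast

text \<open>A forbidden subword leaves only three of the 2 q letters of the relator, so a good word
  may pass over the top of a coset and need not be geodesic. As both orders of a and b are covered,
  an alternating subword has at most 2 q - 4 letters.\<close>

definition good :: "nat list \<Rightarrow> bool" where
  "good w \<longleftrightarrow> w \<in> lists S \<and> (\<forall>u a v. w \<noteq> u @ [a, a] @ v) \<and>
    (\<forall>u a b q v. a \<in> S \<longrightarrow> b \<in> S \<longrightarrow> a \<noteq> b \<longrightarrow> m a b = enat q \<longrightarrow> w \<noteq> u @ alt a b (2 * q - 3) @ v)"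

lemma good_prefix: "good (u @ v) \<Longrightarrow> good u"
  unfolding good_def by (metis append.assoc append_in_lists_conv)

lemma good_lists: "good w \<Longrightarrow> w \<in> lists S"
  by (simp add: good_def)

lemma good_alt_length:
  assumes "good w" "w = u @ rev (alt y x l)" "x \<in> S" "y \<in> S" "x \<noteq> y" "m x y = enat q"
  shows "l + 4 \<le> 2 * q"
proof (rule ccontr)
  assume n: "\<not> ?thesis"
  have q4: "4 \<le> q" using kap_finite(2)[OF assms(3-6)] .
  define N where "N = 2 * q - 3"
  \<comment> \<open>The odd length makes the alternating word a palindrome, so the reversal in the
    hypothesis is harmless.\<close>
  have l: "l = N + (l - N)" and odd: "odd N" using n q4 by (auto simp: N_def)
  obtain p where "alt y x l = alt y x N @ p" using alt_add[of y x N "l - N"] l by metis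
  then have "w = (u @ rev p) @ alt y x N @ []" using assms(2) odd by (simp add: rev_alt)
  moreover have "m y x = enat q" using assms(6) m_sym by simp
  ultimately show False using assms(1,3-5) unfolding good_def N_def by blast
qed

text \<open>Reading a good word from left to right, the current group element \<open>g\<close> either has just
  gone up along the last letter \<open>y\<close>, and then its depth in every dihedral coset exceeds the number of
  letters read in that coset by at most one; or it is on its way down a coset of type \<open>{x, y}\<close>
  and, as at most \<open>2 m x y - 4\<close> letters are read there, its depth remains at least three.\<close>

definition going_up :: "nat list \<Rightarrow> nat \<Rightarrow> bool" where
  "going_up w y \<longleftrightarrow> desc (val w) y \<and>
    (\<forall>x\<in>S. x \<noteq> y \<longrightarrow> (\<exists>u l. 1 \<le> l \<and> w = u @ rev (alt y x l) \<and> dep x y (val w) \<le> Suc l))"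

definition going_down :: "nat list \<Rightarrow> nat \<Rightarrow> nat \<Rightarrow> bool" where
  "going_down w y x \<longleftrightarrow> \<not> desc (val w) y \<and> x \<in> S \<and> x \<noteq> y \<and> desc (val w) x \<and>
    (\<exists>u l q. m x y = enat q \<and> w = u @ rev (alt y x l) \<and> 2 * q \<le> Suc (l + dep x y (val w)))"

text \<open>At most 2 q - 4 letters have been read in the coset, which leaves depth at least three.
  Hence x is the only descent now, and y is the only one after the next step.\<close>

lemma going_down_facts:
  assumes w: "good w" "going_down w y x" and y: "y \<in> S"
  shows "3 \<le> dep x y (val w)" "z \<in> S \<Longrightarrow> z \<noteq> x \<Longrightarrow> \<not> desc (val w) z"
    "desc (val w \<circ> sref x) y" "z \<in> S \<Longrightarrow> z \<noteq> y \<Longrightarrow> \<not> desc (val w \<circ> sref x) z"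
proof -
  have g: "val w \<in> W" using good_lists[OF w(1)] by blast
  from w(2) obtain u l q where d: "\<not> desc (val w) y" "x \<in> S" "x \<noteq> y" "desc (val w) x"
    "m x y = enat q" "w = u @ rev (alt y x l)" "2 * q \<le> Suc (l + dep x y (val w))"
    unfolding going_down_def by blast
  show 3: "3 \<le> dep x y (val w)" using good_alt_length[OF w(1) d(6,2) y d(3,5)] d(7) by simp
  show "\<not> desc (val w) z" if "z \<in> S" "z \<noteq> x" for z
    using desc_unique[OF g d(2) y that(1) d(3) that(2) _ d(4)] 3 d(1) by fastforce
  show 4: "desc (val w \<circ> sref x) y" using desc_step[OF g d(2) y d(3,4)] 3 by simp
  have g1: "val w \<circ> sref x \<in> W" using g d(2) by blast
  have nx: "\<not> desc (val w \<circ> sref x) x" using desc_comp_sref[OF g d(2)] d(4) by blast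
  have "dep x y (val w) = Suc (dep x y (val w \<circ> sref x))" using dep_desc[OF g d(2) y d(3)] d(4) by blast
  then have "2 \<le> dep y x (val w \<circ> sref x)" using 3 dep_sym[of x y] by simp
  then show "\<not> desc (val w \<circ> sref x) z" if "z \<in> S" "z \<noteq> y" for z
    using desc_unique[OF g1 y d(2) that(1) _ that(2) _ 4] d(3) nx by (cases "z = x") auto
qed

text \<open>After an upward step the next letter goes up again or, if it is a second descent, starts
  the way down from a top. On the way down the alternating letter continues the descent, and any
  other letter goes up from an element whose descent is unique.\<close>

lemma good_up_or_down:
  "good w \<Longrightarrow> w = w' @ [y] \<Longrightarrow> going_up w y \<or> (\<exists>x. going_down w y x)"
proof (induction w' arbitrary: w y rule: rev_induct)
  case Nil
  have y: "y \<in> S" using good_lists[OF Nil(1)] Nil(2) by simp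
  have e: "val w = id \<circ> sref y" using Nil by simp
  have "desc (val w) y" unfolding e using desc_comp_sref[OF id_in_W y] not_desc_id[OF y] by blast
  moreover have "dep x y (val w) = 1" if "x \<in> S" "x \<noteq> y" for x
    unfolding e using dep_asc[OF id_in_W that(1) y that(2)] dep_eq_0[OF id_in_W that(1) y that(2)]
      not_desc_id y that(1) by simp
  moreover have "w = [] @ rev (alt y x 1)" for x using Nil by simp
  ultimately have "going_up w y" unfolding going_up_def by (metis le_SucI order.refl)
  then show ?case ..
next
  case (snoc y w' v z)
  define w where "w = w' @ [y]"
  have v: "v = w @ [z]" using snoc.prems(2) w_def by simp
  have gw: "good w" using good_prefix snoc.prems(1) v by blast
  have S: "w \<in> lists S" "y \<in> S" "z \<in> S" using good_lists[OF snoc.prems(1)] v w_def by auto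
  have zy: "z \<noteq> y"
  proof
    assume "z = y"
    then have "v = w' @ [y, y] @ []" using v w_def by simp
    then show False using snoc.prems(1) unfolding good_def by blast
  qed
  define g where "g = val w"
  have g: "g \<in> W" using S g_def by blast
  have vv: "val v = g \<circ> sref z" by (simp add: v g_def val_append)
  have gz: "g \<circ> sref z \<in> W" using g S by blast
  have asc1: "dep x z (g \<circ> sref z) = Suc (dep x z g)" if "x \<in> S" "x \<noteq> z" "\<not> desc g z" for x
    using dep_asc[OF g that(1) S(3) that(2)] that(3) by blast
  have "going_up w y \<or> (\<exists>x. going_down w y x)" by (rule snoc.IH[OF gw w_def])
  then show ?case
  proof (elim disjE exE)
    assume up: "going_up w y"
    then have dy: "desc g y" and lx: "\<And>x. x \<in> S \<Longrightarrow> x \<noteq> y \<Longrightarrow>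
        \<exists>u l. 1 \<le> l \<and> w = u @ rev (alt y x l) \<and> dep x y g \<le> Suc l"
      unfolding going_up_def g_def by auto
    obtain u l where l: "1 \<le> l" "w = u @ rev (alt y z l)" "dep z y g \<le> Suc l" using lx[OF S(3) zy] by blast
    have vl: "v = u @ rev (alt z y (Suc l))" using l(2) v by simp
    show ?case
    proof (cases "desc g z")
      case False
      have "\<exists>u l. 1 \<le> l \<and> v = u @ rev (alt z x l) \<and> dep x z (g \<circ> sref z) \<le> Suc l" if x: "x \<in> S" "x \<noteq> z" for x
      proof (cases "x = y")
        case True
        have "dep x z (g \<circ> sref z) \<le> Suc (Suc l)"
          using asc1[OF x False] l(3) dep_sym[of y z] True by simp
        then show ?thesis using vl True by (metis le_SucI[OF l(1)])
      next
        case xy: False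
        \<comment> \<open>The source of the surplus one in \<open>going_up\<close>: x may be a
          second descent of g although no letter of the coset of x and z has been read. Then
          \<open>no_chain\<close> keeps the depth down to one.\<close>
        have "dep x z g \<le> 1"
        proof (cases "desc g x")
          case True
          have gx: "g \<circ> sref x \<in> W" using g x by blast
          have "\<not> desc (g \<circ> sref x) z" using no_chain(1)[OF g x(1) S(2,3)] xy x zy True dy by blast
          moreover have "\<not> desc (g \<circ> sref x) x" using desc_comp_sref[OF g x(1)] True by blast
          ultimately have "dep x z (g \<circ> sref x) = 0" using dep_eq_0[OF gx x(1) S(3) x(2)] by blast
          then show ?thesis using dep_desc[OF g x(1) S(3) x(2), of x] True by simp
        next
          case nx: False
          then show ?thesis using dep_eq_0[OF g x(1) S(3) x(2) nx False] by simp
        qed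
        then have "dep x z (g \<circ> sref z) \<le> Suc 1" using asc1[OF x False] by simp
        moreover have "v = w @ rev (alt z x 1)" using v by simp
        ultimately show ?thesis by (metis order.refl)
      qed
      then have "going_up v z"
        unfolding going_up_def vv using desc_comp_sref[OF g S(3)] False by blast
      then show ?thesis ..
    next
      case dz: True
      \<comment> \<open>Two descents make g a top, so m z y is its depth, which is at most l + 1.
        With the new letter l + 1 letters have been read and depth m z y - 1 is left, which gives
        the inequality of \<open>going_down\<close>.\<close>
      have q: "m z y = enat (dep z y g)" "4 \<le> dep z y g" using desc_top[OF g S(3,2) zy dz dy] by auto
      have dd: "dep z y g = Suc (dep z y (g \<circ> sref z))" using dep_desc[OF g S(3,2) zy] dz by blast
      have nz: "\<not> desc (g \<circ> sref z) z" using desc_comp_sref[OF g S(3)] dz by blast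
      have "desc (g \<circ> sref z) y" using desc_step[OF g S(3,2) zy dz] q(2) by simp
      moreover have "m y z = enat (dep z y g)" using q m_sym by simp
      moreover have "2 * dep z y g \<le> Suc (Suc l + dep y z (g \<circ> sref z))"
        using dd l(3) dep_sym[of y z] by simp
      ultimately have "going_down v z y"
        unfolding going_down_def vv using nz S zy vl by blast
      then show ?thesis by blast
    qed
  next
    fix x assume dn: "going_down w y x"
    then obtain u l q where d: "\<not> desc g y" "x \<in> S" "x \<noteq> y" "desc g x"
      "m x y = enat q" "w = u @ rev (alt y x l)" "2 * q \<le> Suc (l + dep x y g)"
      unfolding going_down_def g_def by blast
    note f = going_down_facts[OF gw dn S(2), folded g_def]
    show ?case
    proof (cases "z = x")
      case True
      have "dep x y g = Suc (dep x y (g \<circ> sref x))" using dep_desc[OF g d(2) S(2) d(3)] d(4) by blast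
      then have "2 * q \<le> Suc (Suc l + dep y x (g \<circ> sref x))" using d(7) dep_sym[of x y] by simp
      moreover have "v = u @ rev (alt z y (Suc l))" using d(6) v True by simp
      moreover have "m y x = enat q" using d(5) m_sym by simp
      ultimately have "going_down v z y"
        unfolding going_down_def vv using f(3) True S zy desc_comp_sref[OF g d(2)] d(4) by blast
      then show ?thesis by blast
    next
      case zx: False
      have nz: "\<not> desc g z" using f(2) S zx by blast
      have "\<exists>u l. 1 \<le> l \<and> v = u @ rev (alt z t l) \<and> dep t z (g \<circ> sref z) \<le> Suc l" if t: "t \<in> S" "t \<noteq> z" for t
      proof (cases "t = x")
        case True
        have "\<not> desc (g \<circ> sref x) z" using f(4) S zy by blast
        moreover have "\<not> desc (g \<circ> sref x) x" using f(4) d(2,3) by blast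
        ultimately have "dep x z (g \<circ> sref x) = 0"
          using dep_eq_0[OF W_comp_sref[OF g d(2)] d(2) S(3)] zx by blast
        then have "dep x z g = 1" using dep_desc[OF g d(2) S(3), of x] d(4) zx by auto
        then have "dep t z (g \<circ> sref z) \<le> Suc 1" using asc1[OF t nz] True by simp
        moreover have "v = w @ rev (alt z t 1)" using v by simp
        ultimately show ?thesis by (metis order.refl)
      next
        case False
        have "\<not> desc g t" using f(2) t False by blast
        then have "dep t z g = 0" using dep_eq_0[OF g t(1) S(3) t(2)] nz by blast
        then have "dep t z (g \<circ> sref z) \<le> Suc 1" using asc1[OF t nz] by simp
        moreover have "v = w @ rev (alt z t 1)" using v by simp
        ultimately show ?thesis by (metis order.refl)
      qed
      then have "going_up v z"
        unfolding going_up_def vv using desc_comp_sref[OF g S(3)] nz by blast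
      then show ?thesis ..
    qed
  qed
qed

text \<open>The invariant exhibits a descent of \<open>val w\<close>, whereas the identity has none.
  The freeness of the basis will come from this.\<close>

theorem good_val_neq_id:
  assumes "good w" "w \<noteq> []" shows "val w \<noteq> id"
proof
  assume e: "val w = id"
  obtain w' y where w: "w = w' @ [y]" using assms(2) by (metis rev_exhaust)
  have "\<exists>z\<in>S. desc (val w) z"
    using good_up_or_down[OF assms(1) w] good_lists[OF assms(1)] w
    unfolding going_up_def going_down_def by auto
  then show False using not_desc_id e by simp
qed

section \<open>The weak order and prefixes close to geodesics\<close>

inductive pre :: "((nat \<Rightarrow> real) \<Rightarrow> nat \<Rightarrow> real) \<Rightarrow> ((nat \<Rightarrow> real) \<Rightarrow> nat \<Rightarrow> real) \<Rightarrow> bool" where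
  pre_refl: "pre g g"
| pre_step: "v \<in> S \<Longrightarrow> desc g v \<Longrightarrow> pre x (g \<circ> sref v) \<Longrightarrow> pre x g"

definition near :: "nat \<Rightarrow> ((nat \<Rightarrow> real) \<Rightarrow> nat \<Rightarrow> real) \<Rightarrow> ((nat \<Rightarrow> real) \<Rightarrow> nat \<Rightarrow> real) \<Rightarrow> bool" where
  "near C x y \<longleftrightarrow> (\<exists>u\<in>lists S. length u \<le> C \<and> y = x \<circ> val u)"

lemma near_I: "u \<in> lists S \<Longrightarrow> length u \<le> C \<Longrightarrow> y = x \<circ> val u \<Longrightarrow> near C x y"
  unfolding near_def by blast

lemma near_refl: "near C x x"
  by (rule near_I[of "[]"]) auto

lemma near_trans: "near C x y \<Longrightarrow> near D y z \<Longrightarrow> near (C + D) x z"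
  unfolding near_def
proof (elim bexE conjE)
  fix u v assume "u \<in> lists S" "v \<in> lists S" "length u \<le> C" "length v \<le> D" "y = x \<circ> val u" "z = y \<circ> val v"
  then show "\<exists>u\<in>lists S. length u \<le> C + D \<and> z = x \<circ> val u"
    by (intro bexI[of _ "u @ v"]) (auto simp: val_append comp_assoc)
qed

lemma near_mono: "near C x y \<Longrightarrow> C \<le> D \<Longrightarrow> near D x y"
  unfolding near_def using order.trans by blast

lemma near_left: "near C x y \<Longrightarrow> near C (g \<circ> x) (g \<circ> y)"
  unfolding near_def by (auto simp: comp_assoc)

lemma pre_id: "pre x id \<Longrightarrow> x = id"
  by (erule pre.cases) (auto simp: not_desc_id)

text \<open>Strictly below the top of a coset an element of depth at least two has a single descent,
  so every way down follows the flank until it reaches \<open>h \<circ> sref a\<close>.\<close>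

lemma pre_dihedral:
  assumes h: "h \<in> W" and ab: "a \<in> S" "b \<in> S" "a \<noteq> b" and nd: "\<not> desc h a" "\<not> desc h b"
  shows "enat (Suc j) < m a b \<Longrightarrow> pre x (h \<circ> val (alt a b (Suc j))) \<Longrightarrow>
    (\<exists>i\<le>Suc j. x = h \<circ> val (alt a b i)) \<or> pre x (h \<circ> sref a)"
proof (induction j)
  case 0
  then show ?case by simp
next
  case (Suc j)
  let ?g = "h \<circ> val (alt a b (Suc (Suc j)))"
  define l where "l = (if even (Suc j) then a else b)"
  define l' where "l' = (if even (Suc j) then b else a)"
  have gW: "?g \<in> W" using h alt_in_lists[OF ab(1,2)] by blast
  have gW': "h \<circ> val (alt a b (Suc j)) \<in> W" using h alt_in_lists[OF ab(1,2)] by blast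
  have ll: "l \<in> S" "l' \<in> S" "l \<noteq> l'" "{l, l'} = {a, b}" using ab by (auto simp: l_def l'_def)
  have lt: "enat (Suc j) < m a b" using Suc.prems(1) by (meson enat_ord_simps(2) lessI order.strict_trans)
  have g: "?g = h \<circ> val (alt a b (Suc j)) \<circ> sref l"
    unfolding l_def by (subst alt_snoc) (simp add: val_append comp_assoc)
  have gl: "?g \<circ> sref l = h \<circ> val (alt a b (Suc j))" unfolding g using ll by simp
  have dl: "desc ?g l"
    using desc_comp_sref[OF gW' ll(1)] dihedral_ascent[OF h ab nd lt] unfolding g l_def by blast
  have "dep a b ?g = Suc (Suc j)"
    using Suc.prems(1) by (intro dep_decomp[OF h ab nd]) simp
  then have dp: "dep l l' ?g = Suc (Suc j)" using ll dep_sym[of a b] by (auto simp: doubleton_eq_iff)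
  have mm: "m l l' = m a b" using ll m_sym[of a b] by (auto simp: doubleton_eq_iff)
  have nl': "\<not> desc ?g l'" using desc_top(1)[OF gW ll(1-3) dl] dp mm Suc.prems(1) by auto
  show ?case using Suc.prems(2)
  proof (cases rule: pre.cases)
    case pre_refl
    then show ?thesis by blast
  next
    case (pre_step v)
    have "v = l" using desc_unique[OF gW ll(1,2) pre_step(1) ll(3) _ _ dl] dp nl' pre_step(2) by fastforce
    then show ?thesis using pre_step(3) Suc.IH[OF lt] gl le_SucI by metis
  qed
qed

definition fellow :: "nat \<Rightarrow> ((nat \<Rightarrow> real) \<Rightarrow> nat \<Rightarrow> real) \<Rightarrow> nat list \<Rightarrow> bool" where
  "fellow C x w \<longleftrightarrow> (\<exists>p r. w = p @ r \<and> near C x (val p))"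

lemma fellow_append: "fellow C x w \<Longrightarrow> fellow C x (w @ v)"
  unfolding fellow_def by (metis append.assoc)

lemma fellow_I: "near C x (val w) \<Longrightarrow> fellow C x (w @ v)"
  unfolding fellow_def by blast


text \<open>If \<open>x\<close> lies below \<open>val w \<circ> sref s\<close> but not below \<open>val w\<close>, then the last letters of
  \<open>w\<close> climb the coset at whose top \<open>val w \<circ> sref s\<close> sits, and \<open>x\<close> is found either in this coset or
  below its other flank; there the same situation recurs with a shorter prefix of \<open>w\<close>.\<close>

lemma good_fellow:
  assumes M: "\<And>a b q. a \<in> S \<Longrightarrow> b \<in> S \<Longrightarrow> a \<noteq> b \<Longrightarrow> m a b = enat q \<Longrightarrow> q \<le> M" and M2: "2 \<le> M"
  shows "good w \<Longrightarrow> s \<in> S \<Longrightarrow> pre x (val w \<circ> sref s) \<Longrightarrow> fellow M x w"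
proof (induction w arbitrary: s x rule: length_induct)
  case (1 w)
  have IH: "fellow M x w0" if "length w0 < length w" "good w0" "s \<in> S" "pre x (val w0 \<circ> sref s)" for w0 s x
    using 1(1) that by blast
  have IH': "fellow M x w0" if "length w0 \<le> length w" "good w0" "pre x (val w0)" for w0 x
  proof (cases w0 rule: rev_cases)
    case Nil
    then have "x = id" using pre_id that(3) by simp
    then show ?thesis using Nil by (auto simp: fellow_def near_refl)
  next
    case (snoc w1 y)
    have "fellow M x w1"
    proof (rule IH)
      show "length w1 < length w" using that snoc by simp
      show "good w1" using good_prefix that(2) snoc by blast
      show "y \<in> S" using good_lists[OF that(2)] snoc by simp
      show "pre x (val w1 \<circ> sref y)" using that(3) snoc by (simp add: val_append)
    qed
    then show ?thesis using snoc fellow_append by blast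
  qed
  note gw = 1(2) and s = 1(3) and px = 1(4)
  define g where "g = val w"
  have wS: "w \<in> lists S" using good_lists[OF gw] .
  have g: "g \<in> W" using wS by (auto simp: g_def)
  define G where "G = g \<circ> sref s"
  have G: "G \<in> W" using g s by (auto simp: G_def)
  have Gs: "G \<circ> sref s = g" using s by (simp add: G_def)
  have pG: "pre x G" using px by (simp add: G_def g_def)
  have P: "fellow M x w" if "pre x g" using IH'[OF order.refl gw] that by (simp add: g_def)
  show ?case
  proof (cases "desc g s")
    case True
    then show ?thesis using P[OF pre_step[OF s True]] pG by (simp add: G_def)
  next
    case ns: False
    have dGs: "desc G s" using desc_comp_sref[OF g s] ns by (simp add: G_def)
    from pG show ?thesis
    proof (cases rule: pre.cases)
      case pre_refl
      have "near M x (val w)" using pre_refl s M2 Gs by (intro near_I[of "[s]"]) (auto simp: g_def)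
      then show ?thesis using fellow_I[of M x w "[]"] by simp
    next
      case (pre_step v)
      note v = pre_step(1) and dGv = pre_step(2) and pv = pre_step(3)
      show ?thesis
      proof (cases "v = s")
        case True
        then show ?thesis using P pv Gs by simp
      next
        case vs: False
        define q where "q = dep s v G"
        have mq: "m s v = enat q" and q4: "4 \<le> q"
          using desc_top[OF G s v vs[symmetric] dGs dGv] by (auto simp: q_def)
        have qM: "q \<le> M" using M[OF s v vs[symmetric] mq] .
        have dg: "Suc (dep s v g) = q"
          using dep_desc[OF G s v vs[symmetric], of s] dGs Gs by (simp add: q_def)
        have dgv: "desc g v" using dep_pos[OF g s v vs[symmetric] _ ns] dg q4 by simp
        have dgvs: "desc (g \<circ> sref v) s"
          using desc_step[OF g v s vs dgv] dg q4 dep_sym[of s v] by simp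
        have "w \<noteq> []" using dgv not_desc_id[OF v] by (auto simp: g_def)
        then obtain w' y where w': "w = w' @ [y]" by (metis rev_exhaust)
        have y: "y \<in> S" using wS w' by simp
        from good_up_or_down[OF gw w'] show ?thesis
        proof (elim disjE exE)
          \<comment> \<open>On the way down everything is forced: v is the only descent of g and s =
            y is the only one after it. Thus w ends in s, and G is the value of the shorter prefix
            w'.\<close>
          fix x' assume dn: "going_down w y x'"
          note f = going_down_facts[OF gw dn y, folded g_def]
          have "v = x'" using f(2)[OF v] dgv by blast
          then have "s = y" using f(4)[OF s] dgvs by blast
          then have "G = val w'" using w' y by (simp add: G_def g_def val_append)
          then have "fellow M x w'" using IH'[of w' x] pG good_prefix gw w' by simp
          then show ?thesis using fellow_append w' by blast
        next
          assume up: "going_up w y"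
          then have dy: "desc g y" by (simp add: going_up_def g_def)
          have yv: "y = v"
          proof (rule ccontr)
            assume "y \<noteq> v"
            moreover have "y \<noteq> s" using dy ns by blast
            ultimately show False using no_chain(1)[OF g v y s] vs dgv dy dgvs by blast
          qed
          obtain u l where ul: "w = u @ rev (alt v s l)" "dep s v g \<le> Suc l"
            using up s vs[symmetric] unfolding going_up_def yv g_def by metis
          \<comment> \<open>g has depth q - 1, one below the top G, and by the invariant at least q
            - 2 last letters of w alternate. Removing q - 2 of them leads down to depth one:
            \<open>val w0\<close> is \<open>h \<circ> sref c\<close> with h the bottom of the coset,
            while \<open>G \<circ> sref v\<close> lies on the other flank, which starts with
            c'.\<close>
          define r where "r = q - 2"
          have r: "q = Suc (Suc r)" "2 \<le> r" "r \<le> l" using q4 ul(2) dg by (auto simp: r_def)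
          obtain p where p: "alt v s l = alt v s r @ p" using alt_add[of v s r "l - r"] r(3) by auto
          define w0 where "w0 = u @ rev p"
          have w0: "w = w0 @ rev (alt v s r)" using ul(1) p by (simp add: w0_def)
          have gw0: "good w0" using good_prefix gw w0 by blast
          have lw0: "length w0 < length w" using w0 r(2) by simp
          have w0S: "w0 \<in> lists S" using good_lists[OF gw0] .
          define c where "c = (if even r then v else s)"
          define c' where "c' = (if even r then s else v)"
          have c: "c \<in> S" "c' \<in> S" "c \<noteq> c'" "{c, c'} = {s, v}" using s v vs by (auto simp: c_def c'_def)
          have mcc: "m c' c = enat q" using mq m_sym[of s v] c(4) by (auto simp: doubleton_eq_iff)
          obtain h where h: "h \<in> W" "\<not> desc h s" "\<not> desc h v" "G = h \<circ> val (rev (alt s v q))"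
          proof -
            obtain h a b where h: "h \<in> W" "\<not> desc h s" "\<not> desc h v" "{a, b} = {s, v}"
              "G = h \<circ> val (alt a b q)"
              using dihedral_decomp[OF G s v vs[symmetric]] unfolding q_def by metis
            have "val (alt a b q) = val (alt s v q)" "val (alt v s q) = val (alt s v q)"
              using h(4) val_braid[OF s v vs[symmetric] mq] by (auto simp: doubleton_eq_iff)
            then show ?thesis using that[OF h(1-3)] h(5) by (simp add: rev_alt)
          qed
          have ndc: "\<not> desc h c" "\<not> desc h c'" using h c(4) by (auto simp: doubleton_eq_iff)
          have als: "alt v s i \<in> lists S" "alt s v i \<in> lists S" for i using s v by (auto intro: alt_in_lists)
          have ge: "g = h \<circ> val (rev (alt v s (Suc r)))"
          proof -
            have "rev (alt s v q) = rev (alt v s (Suc r)) @ [s]" using r(1) by simp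
            then have "G = (h \<circ> val (rev (alt v s (Suc r)))) \<circ> sref s"
              using h(4) by (simp add: val_append comp_assoc del: alt.simps)
            then show ?thesis using Gs s by (metis comp_sref_sref)
          qed
          have g0: "val w0 = h \<circ> sref c"
          proof -
            have "g = h \<circ> sref c \<circ> val (rev (alt v s r))"
              using ge unfolding alt_snoc c_def by (simp add: val_append comp_assoc)
            moreover have "g = val w0 \<circ> val (rev (alt v s r))" using w0 by (simp add: g_def val_append)
            ultimately have "h \<circ> sref c \<circ> (val (rev (alt v s r)) \<circ> val (alt v s r))
                = val w0 \<circ> (val (rev (alt v s r)) \<circ> val (alt v s r))" by (metis comp_assoc)
            then show ?thesis using val_rev_left[OF als(1)] by simp
          qed
          have Gv: "G \<circ> sref v = h \<circ> val (alt c' c (Suc r))"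
          proof -
            have "G = h \<circ> val (rev (alt v s q))"
              using h(4) val_braid[OF s v vs[symmetric] mq] by (simp add: rev_alt)
            moreover have "rev (alt v s q) = rev (alt s v (Suc r)) @ [v]" using r(1) by simp
            moreover have "rev (alt s v (Suc r)) = alt c' c (Suc r)"
              unfolding rev_alt c_def c'_def by simp
            ultimately have "G = (h \<circ> val (alt c' c (Suc r))) \<circ> sref v"
              by (simp add: val_append comp_assoc del: alt.simps)
            then show ?thesis using v by (metis comp_sref_sref)
          qed
          have fin: ?thesis if "fellow M x w0" using that fellow_append w0 by blast
          have near0: ?thesis if "x = h \<circ> val (alt c' c i)" "i \<le> Suc r" for i
          proof -
            have "val w0 = x \<circ> val (rev (alt c' c i) @ [c])"
              unfolding g0 that(1) val_append using val_rev_right[OF alt_in_lists[OF c(2,1), of i]]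
              by (metis (no_types, lifting) comp_assoc comp_id val.simps)
            then have "near M x (val w0)" using that(2) r(1) qM c alt_in_lists[OF c(2,1)]
              by (intro near_I[of "rev (alt c' c i) @ [c]"]) auto
            then show ?thesis using fellow_I w0 by blast
          qed
          have P0: ?thesis if "pre x (val w0)" using fin IH'[OF _ gw0 that] lw0 by simp
          have hc: "h \<circ> sref c \<in> W" "h \<circ> sref c' \<in> W" using h(1) c by auto
          have dhc: "desc (h \<circ> sref c) c" "desc (h \<circ> sref c') c'"
            using desc_comp_sref[OF h(1)] c ndc by auto
          have Ph: ?thesis if "pre x h"
            using P0 pre.pre_step[OF c(1) dhc(1), of x] that c by (simp add: g0)
          have lt: "enat (Suc r) < m c' c" using mcc r(1) by simp
          \<comment> \<open>Either x lies on the other flank, hence within distance q of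
            \<open>val w0\<close> by way of h, or it lies below
            \<open>h \<circ> sref c'\<close>.\<close>
          from pre_dihedral[OF h(1) c(2,1) c(3)[symmetric] ndc(2,1) lt] pv Gv
          consider (a) i where "i \<le> Suc r" "x = h \<circ> val (alt c' c i)" | (b) "pre x (h \<circ> sref c')" by auto
          then show ?thesis
          proof cases
            case a
            then show ?thesis using near0 by blast
          next
            case b
            then show ?thesis
            proof (cases rule: pre.cases)
              case pre_refl
              then show ?thesis using near0[of "Suc 0"] by simp
            next
              case (pre_step v')
              note v' = pre_step(1)
              show ?thesis
              proof (cases "v' = c'")
                case True
                then show ?thesis using Ph pre_step(3) c by simp
              next
                case v'c: False
                \<comment> \<open>Here \<open>h \<circ> sref c'\<close> has a second descent v', so
                  h lies deep in the coset of c' and v'. The aim is to show that w0 ends in c and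
                  that its remaining prefix w1 has value h; then x lies below
                  \<open>val w1 \<circ> sref c'\<close>, and the induction hypothesis applies to
                  w1.\<close>
                have t4: "4 \<le> dep c' v' (h \<circ> sref c')"
                  using desc_top(2)[OF hc(2) c(2) v'] v'c dhc pre_step(2) by blast
                have "dep c' v' (h \<circ> sref c') = Suc (dep c' v' h)"
                  using dep_asc[OF h(1) c(2) v' _ _ ndc(2)] v'c by blast
                then have d3: "3 \<le> dep c' v' h" using t4 by simp
                have dhv: "desc h v'" using dep_pos[OF h(1) c(2) v' _ _ ndc(2)] v'c d3 by simp
                have d3': "3 \<le> dep v' c' h" using d3 dep_sym by simp
                have v'cc: "v' \<noteq> c" using ndc(1) dhv by blast
                have hv: "h \<circ> sref v' \<in> W" using h(1) v' by blast
                have dhvc: "desc (h \<circ> sref v') c'" using desc_step[OF h(1) v' c(2) v'c dhv] d3' by simp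
                have "dep v' c' h = Suc (dep v' c' (h \<circ> sref v'))"
                  using dep_desc[OF h(1) v' c(2) v'c] dhv by blast
                then have "2 \<le> dep c' v' (h \<circ> sref v')" using d3' dep_sym[of c' v'] by simp
                then have dv: "desc (h \<circ> sref v' \<circ> sref c') v'"
                  using desc_step[OF hv c(2) v' v'c[symmetric] dhvc] by blast
                have no: "\<not> desc (h \<circ> sref v') c"
                  using no_chain(1)[OF hv c(2,1) v' c(3)[symmetric] v'cc v'c dhvc] dv by blast
                \<comment> \<open>Depth three in a coset of c and e would make e a descent of h,
                  hence e = v', and then c would descend at \<open>h \<circ> sref v'\<close>, which
                  was just excluded.\<close>
                have noe: False if "e \<in> S" "e \<noteq> c" "3 \<le> dep c e (h \<circ> sref c)" for e
                proof -
                  have "dep c e (h \<circ> sref c) = Suc (dep c e h)"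
                    using dep_asc[OF h(1) c(1) that(1) that(2)[symmetric] _ ndc(1)] by blast
                  then have 2: "2 \<le> dep c e h" using that(3) by simp
                  then have de: "desc h e" using dep_pos[OF h(1) c(1) that(1) that(2)[symmetric] _ ndc(1)] by simp
                  have "e = v'"
                    using desc_unique[OF h(1) v' c(2) that(1) v'c _ _ dhv] d3' de ndc(2) by fastforce
                  then have "desc (h \<circ> sref v') c"
                    using desc_step[OF h(1) that(1) c(1) that(2) de] 2 dep_sym[of c e] by simp
                  then show False using no by blast
                qed
                have "w0 \<noteq> []" using dhc(1) g0 not_desc_id[OF c(1)] by auto
                then obtain w1 e where w1: "w0 = w1 @ [e]" by (metis rev_exhaust)
                have e: "e \<in> S" using w0S w1 by simp
                from good_up_or_down[OF gw0 w1] show ?thesis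
                proof (elim disjE exE)
                  assume up0: "going_up w0 e"
                  have de: "desc (h \<circ> sref c) e" using up0 by (simp add: going_up_def g0)
                  have ec: "e = c"
                  proof (rule ccontr)
                    assume "e \<noteq> c"
                    then show False
                      using noe[OF e] desc_top(2)[OF hc(1) c(1) e _ dhc(1) de] by fastforce
                  qed
                  then have "val w1 = h" using w1 g0 c by (metis comp_sref_sref comp_id val.simps val_append)
                  then have "fellow M x w1"
                    using IH[of w1 c' x] lw0 w1 good_prefix gw0 c b by simp
                  then show ?thesis using fin fellow_append w1 by blast
                next
                  fix x' assume dn: "going_down w0 e x'"
                  note f = going_down_facts[OF gw0 dn e, unfolded g0]
                  have "x' = c" using f(2)[OF c(1)] dhc(1) by blast
                  moreover have "e \<noteq> x'" using dn by (auto simp: going_down_def)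
                  ultimately show ?thesis using noe[OF e] f(1) by blast
                qed
              qed
            qed
          qed
        qed
      qed
    qed
  qed
qed


section \<open>Geodesic words and stability of closeness\<close>

definition reduced :: "nat list \<Rightarrow> bool" where
  "reduced w \<longleftrightarrow> w \<in> lists S \<and> length w = len (val w)"

lemma reducedI: "w \<in> lists S \<Longrightarrow> val w = g \<Longrightarrow> length w = len g \<Longrightarrow> reduced w"
  by (simp add: reduced_def)

lemma reduced_minimal: "reduced w \<Longrightarrow> v \<in> lists S \<Longrightarrow> val v = val w \<Longrightarrow> length w \<le> length v"
  using len_val_le[of v] by (simp add: reduced_def)

lemma reduced_infix:
  assumes "reduced (u @ v @ w)" shows "reduced v"
proof (rule ccontr)
  assume n: "\<not> reduced v"
  have v: "v \<in> lists S" "u \<in> lists S" "w \<in> lists S" using assms by (auto simp: reduced_def)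
  obtain v' where v': "v' \<in> lists S" "val v' = val v" "length v' = len (val v)"
    using reduced_word[OF val_in_W[OF v(1)]] .
  have "length v' < length v" using v' len_val_le[OF v(1)] n v(1) by (auto simp: reduced_def)
  moreover have "length (u @ v @ w) \<le> length (u @ v' @ w)"
    by (rule reduced_minimal[OF assms]) (use v v' in \<open>auto simp: val_append\<close>)
  ultimately show False by simp
qed

text \<open>An alternating subword of a geodesic has at most q letters, and q < 2 q - 3 because q
  \<ge> 4.\<close>

lemma reduced_good:
  assumes "reduced w" shows "good w"
  unfolding good_def
proof (intro conjI allI impI)
  show "w \<in> lists S" using assms by (simp add: reduced_def)
  show "w \<noteq> u @ [a, a] @ v" for u a v
  proof
    assume w: "w = u @ [a, a] @ v"
    then have "reduced [a, a]" using reduced_infix assms by blast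
    then have a: "a \<in> S" "length [a, a] = len (val [a, a])" by (simp_all only: reduced_def Cons_in_lists_iff)
    have "val [a, a] = id" using a(1) by simp
    then show False using a(2) by simp
  qed
  fix u a b q v assume ab: "a \<in> S" "b \<in> S" "a \<noteq> b" and q: "m a b = enat q"
  show "w \<noteq> u @ alt a b (2 * q - 3) @ v"
  proof
    assume w: "w = u @ alt a b (2 * q - 3) @ v"
    then have r: "reduced (alt a b (2 * q - 3))" using reduced_infix assms by blast
    have "alt a b (2 * q - 3) \<in> lists {a, b}" by (simp add: alt_in_lists)
    from dihedral_normal_form[OF ab this] obtain x y p where p: "{x, y} = {a, b}" "enat p \<le> m a b" "val (alt a b (2 * q - 3)) = val (alt x y p)"
      by blast
    have "x \<in> S" "y \<in> S" using p(1) ab by (auto simp: doubleton_eq_iff)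
    then have "length (alt a b (2 * q - 3)) \<le> length (alt x y p)"
      using reduced_minimal[OF r] p(3) alt_in_lists by metis
    then show False using p(2) q kap_finite(2)[OF ab q] by simp
  qed
qed

lemma reduced_last: 
  assumes "reduced (w @ [v])" shows "v \<in> S" "desc (val (w @ [v])) v" "val (w @ [v]) \<circ> sref v = val w" "reduced w"
proof -
  show v: "v \<in> S" using assms by (simp add: reduced_def)
  show e: "val (w @ [v]) \<circ> sref v = val w" using v by (simp add: val_append)
  show r: "reduced w" using reduced_infix[of "[]" w "[v]"] assms by simp
  show "desc (val (w @ [v])) v" unfolding desc_def e using assms r by (simp add: reduced_def)
qed

lemma reduced_pre: "reduced (p @ r) \<Longrightarrow> pre (val p) (val (p @ r))"
proof (induction r rule: rev_induct)
  case Nil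
  then show ?case by (simp add: pre_refl)
next
  case (snoc v r)
  have "reduced ((p @ r) @ [v])" using snoc.prems by simp
  note rl = reduced_last[OF this]
  show ?case using pre_step[OF rl(1,2)] rl(3,4) snoc.IH by simp
qed

text \<open>Together with \<open>reduced_pre\<close> this identifies the order:
  \<open>pre x g\<close> holds if and only if some geodesic from the identity to g passes through
  x.\<close>

lemma pre_reduced:
  "pre x g \<Longrightarrow> g \<in> W \<Longrightarrow> x \<in> W \<and> (\<exists>p r. reduced (p @ r) \<and> val (p @ r) = g \<and> val p = x)"
proof (induction rule: pre.induct)
  case (pre_refl g)
  obtain w where "w \<in> lists S" "val w = g" "length w = len g" using reduced_word[OF pre_refl] .
  then show ?case using reducedI pre_refl by (metis append_Nil2)
next
  case (pre_step v g x)
  have "g \<circ> sref v \<in> W" using pre_step by blast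
  then obtain p r where pr: "x \<in> W" "reduced (p @ r)" "val (p @ r) = g \<circ> sref v" "val p = x"
    using pre_step.IH by blast
  have e: "val ((p @ r) @ [v]) = g" using pr(3) pre_step(1) by (simp add: val_append[of _ "[v]"] del: append_assoc)
  have "reduced ((p @ r) @ [v])"
    unfolding reduced_def e using pr(2,3) pre_step(1) len_desc[OF pre_step.prems pre_step(1,2)]
    by (simp add: reduced_def)
  then show ?case using e pr(1,4) by (metis append.assoc)
qed

text \<open>A one-sided notion: every point on a geodesic to \<open>val w\<close> is close to a
  prefix of w. This is the direction that quasiconvexity asks for.\<close>

definition shadowed :: "nat \<Rightarrow> nat list \<Rightarrow> bool" where
  "shadowed C w \<longleftrightarrow> (\<forall>x. pre x (val w) \<longrightarrow> fellow C x w)"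

lemma max_finite_label:
  obtains M where "2 \<le> M" "\<And>a b q. a \<in> S \<Longrightarrow> b \<in> S \<Longrightarrow> a \<noteq> b \<Longrightarrow> m a b = enat q \<Longrightarrow> q \<le> M"
proof
  \<comment> \<open>The element 2 keeps the set nonempty and provides the lower bound that
    \<open>good_fellow\<close> expects; infinite labels merely contribute some further
    number.\<close>
  let ?F = "insert 2 ((\<lambda>(a, b). the_enat (m a b)) ` (S \<times> S))"
  have f: "finite ?F" using finite_S by simp
  show "2 \<le> Max ?F" using f by (intro Max_ge) auto
  show "q \<le> Max ?F" if "a \<in> S" "b \<in> S" "m a b = enat q" for a b q
    using f by (rule Max_ge) (use that in \<open>force simp: image_iff\<close>)
qed

text \<open>The second clause admits an arbitrary extra letter. The first follows from it by
  splitting off the last letter of w, and the second is used again for padding.\<close>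

lemma good_shadowed:
  obtains M where "\<And>w. good w \<Longrightarrow> shadowed M w"
    "\<And>w s x. good w \<Longrightarrow> s \<in> S \<Longrightarrow> pre x (val w \<circ> sref s) \<Longrightarrow> fellow M x w"
proof -
  obtain M where M: "2 \<le> M" "\<And>a b q. a \<in> S \<Longrightarrow> b \<in> S \<Longrightarrow> a \<noteq> b \<Longrightarrow> m a b = enat q \<Longrightarrow> q \<le> M"
    using max_finite_label by blast
  have 1: "fellow M x w" if "good w" "s \<in> S" "pre x (val w \<circ> sref s)" for w s x
    using good_fellow[of M] M that by blast
  have "shadowed M w" if w: "good w" for w
    unfolding shadowed_def
  proof (intro allI impI)
    fix x assume x: "pre x (val w)"
    show "fellow M x w"
    proof (cases w rule: rev_cases)
      case Nil
      then have "x = id" using pre_id x by simp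
      then show ?thesis using Nil by (auto simp: fellow_def near_refl)
    next
      case (snoc w1 y)
      have "fellow M x w1"
        using 1[of w1 y x] good_prefix w snoc x good_lists[OF w] by (auto simp: val_append)
      then show ?thesis using snoc fellow_append by blast
    qed
  qed
  then show ?thesis using that 1 by blast
qed

text \<open>Translation by the inverse of \<open>val w\<close> turns geodesics to
  \<open>val w\<close> into geodesics to \<open>val (rev w)\<close> traversed backwards, and values
  of prefixes of w into values of prefixes of \<open>rev w\<close>.\<close>

lemma shadowed_rev:
  assumes w: "w \<in> lists S" and sh: "shadowed C w" shows "shadowed C (rev w)"
  unfolding shadowed_def
proof (intro allI impI)
  fix x assume "pre x (val (rev w))"
  moreover have "val (rev w) \<in> W" using w by auto
  ultimately obtain p r where pr: "reduced (p @ r)" "val (p @ r) = val (rev w)" "val p = x"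
    using pre_reduced by blast
  have S: "p \<in> lists S" "r \<in> lists S" using pr(1) by (auto simp: reduced_def)
  have inv: "val (rev v) = val w" if "v \<in> lists S" "val v = val (rev w)" for v
    using val_rev_right[OF that(1)] val_rev_right[OF w] that(2) w
    by (metis comp_assoc comp_id id_comp val_rev_left)
  have e: "val (rev r @ rev p) = val w" using inv[of "p @ r"] S pr(2) by simp
  have red: "reduced (rev r @ rev p)"
    unfolding reduced_def
  proof
    show "rev r @ rev p \<in> lists S" using S by simp
    obtain v where v: "v \<in> lists S" "val v = val w" "length v = len (val w)"
      using reduced_word[OF val_in_W[OF w]] .
    have "val (rev v) = val (p @ r)"
      using inv[of "rev v"] v pr(2) w by (metis comp_assoc comp_id id_comp rev_in_lists val_rev_left val_rev_right)
    then have "length (p @ r) \<le> length (rev v)" using v(1) by (intro reduced_minimal[OF pr(1)]) simp_all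
    then show "length (rev r @ rev p) = len (val (rev r @ rev p))"
      unfolding e using v(3) len_val_le[of "rev r @ rev p"] S e by simp
  qed
  then have "pre (val (rev r)) (val w)" using reduced_pre e by metis
  then obtain p' r' where w': "w = p' @ r'" and nr: "near C (val (rev r)) (val p')"
    using sh unfolding shadowed_def fellow_def by blast
  have 1: "val (rev w) \<circ> val (rev r) = x"
    using pr(2,3) val_rev_right[OF S(2)] by (metis comp_assoc comp_id val_append)
  have p': "p' \<in> lists S" using w w' by simp
  have 2: "val (rev w) \<circ> val p' = val (rev r')"
    using val_rev_left[OF p'] w' by (simp add: val_append comp_assoc)
  have "near C x (val (rev r'))" using near_left[OF nr, of "val (rev w)"] 1 2 by simp
  then show "fellow C x (rev w)" using w' fellow_I by simp
qed

lemma fellow_near: "near C x y \<Longrightarrow> fellow D y w \<Longrightarrow> fellow (C + D) x w"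
  unfolding fellow_def using near_trans by blast

text \<open>Needed because the labels of closed walks are good, but the elements of the subgroup are
  conjugates of them by a fixed word. For one letter on the right, w is compared with a geodesic r
  of the same value: r is good, so points below \<open>val w \<circ> sref s\<close> are close to
  prefixes of r, and these are close to prefixes of w. Letters on the left are treated by
  reversal.\<close>

lemma shadowed_padding:
  obtains M where
    "\<And>w u v C. w \<in> lists S \<Longrightarrow> u \<in> lists S \<Longrightarrow> v \<in> lists S \<Longrightarrow> shadowed C w \<Longrightarrow>
      shadowed (C + M * (length u + length v)) (u @ w @ v)"
proof -
  obtain M where M: "\<And>w s x. good w \<Longrightarrow> s \<in> S \<Longrightarrow> pre x (val w \<circ> sref s) \<Longrightarrow> fellow M x w"
    using good_shadowed by metis
  have one: "shadowed (C + M) (w @ [s])" if w: "w \<in> lists S" "s \<in> S" "shadowed C w" for w s C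
    unfolding shadowed_def
  proof (intro allI impI)
    fix x assume x: "pre x (val (w @ [s]))"
    obtain r where r: "r \<in> lists S" "val r = val w" "length r = len (val w)"
      using reduced_word[OF val_in_W[OF w(1)]] .
    have rr: "reduced r" using r reducedI by simp
    have "fellow M x r"
      using M[OF reduced_good[OF rr] w(2)] x r(2) by (simp add: val_append)
    then obtain p q where pq: "r = p @ q" "near M x (val p)" unfolding fellow_def by blast
    then have "pre (val p) (val w)" using reduced_pre rr r(2) by metis
    then have "fellow C (val p) w" using w(3) unfolding shadowed_def by blast
    then have "fellow (M + C) x w" using fellow_near pq(2) by blast
    then show "fellow (C + M) x (w @ [s])" using fellow_append by (simp add: add.commute)
  qed
  have right: "shadowed (C + M * length v) (w @ v)" if "w \<in> lists S" "v \<in> lists S" "shadowed C w" for w v C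
    using that(2)
  proof (induction v rule: rev_induct)
    case Nil then show ?case using that by simp
  next
    case (snoc s v)
    then have "shadowed (C + M * length v + M) ((w @ v) @ [s])" using that by (intro one) auto
    then show ?case by (simp add: algebra_simps)
  qed
  have "shadowed (C + M * (length u + length v)) (u @ w @ v)"
    if "w \<in> lists S" "u \<in> lists S" "v \<in> lists S" "shadowed C w" for w u v C
  proof -
    have "shadowed (C + M * length u) (rev w @ rev u)"
      using right[of "rev w" "rev u" C] shadowed_rev that by simp
    then have "shadowed (C + M * length u) (u @ w)"
      using shadowed_rev[of "rev w @ rev u"] that by simp
    then show ?thesis using right[of "u @ w" v "C + M * length u"] that by (simp add: algebra_simps)
  qed
  then show ?thesis using that by blast
qed

text \<open>Matsumoto's theorem, with an abstract relation \<open>E\<close> in place of equality in the presented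
  group.\<close>

lemma reduced_words_equivalent:
  assumes equ: "\<And>u. u \<in> lists S \<Longrightarrow> E u u" "\<And>u v. E u v \<Longrightarrow> E v u" "\<And>u v w. E u v \<Longrightarrow> E v w \<Longrightarrow> E u w"
    and app: "\<And>u v s. s \<in> S \<Longrightarrow> E u v \<Longrightarrow> E (u @ [s]) (v @ [s])"
    and braid: "\<And>u a b q. u \<in> lists S \<Longrightarrow> a \<in> S \<Longrightarrow> b \<in> S \<Longrightarrow> a \<noteq> b \<Longrightarrow> m a b = enat q \<Longrightarrow>
      E (u @ alt a b q) (u @ alt b a q)"
  shows "reduced u \<Longrightarrow> reduced v \<Longrightarrow> val u = val v \<Longrightarrow> E u v"
proof (induction "length u" arbitrary: u v rule: less_induct)
  case less
  have len: "length u = length v" using less.prems by (simp add: reduced_def)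
  show ?case
  proof (cases u rule: rev_cases)
    case Nil
    then show ?thesis using len equ(1)[of "[]"] by simp
  next
    case (snoc u' s)
    then obtain v' t where v: "v = v' @ [t]" using len by (cases v rule: rev_cases) auto
    note su = reduced_last[OF less.prems(1)[unfolded snoc]] and sv = reduced_last[OF less.prems(2)[unfolded v]]
    have eq: "val (u' @ [s]) = val (v' @ [t])" using less.prems(3) snoc v by simp
    show ?thesis
    proof (cases "s = t")
      case True
      then have "val u' = val v'" using su(3) sv(3) eq by simp
      then have "E u' v'" using less.hyps[OF _ su(4) sv(4)] snoc by simp
      then show ?thesis using app su(1) snoc v True by simp
    next
      case False
      define g where "g = val u"
      have uS: "u \<in> lists S" using less.prems(1) by (simp add: reduced_def)
      have g: "g \<in> W" using uS by (auto simp: g_def)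
      have ds: "desc g s" "desc g t" using su(2) sv(2) eq snoc by (auto simp: g_def)
      define q where "q = dep s t g"
      have mq: "m s t = enat q" "4 \<le> q" using desc_top[OF g su(1) sv(1) False ds] by (auto simp: q_def)
      then have msq: "m t s = enat q" using m_sym by simp
      obtain h a b where h: "h \<in> W" "\<not> desc h s" "\<not> desc h t" "{a, b} = {s, t}" "g = h \<circ> val (alt a b q)"
        using dihedral_decomp[OF g su(1) sv(1) False] unfolding q_def by metis
      obtain r where r: "r \<in> lists S" "val r = h" "length r = len h" using reduced_word[OF h(1)] .
      have gh: "g = h \<circ> val (alt s t q)" "g = h \<circ> val (alt t s q)"
        using h(4,5) val_braid[OF su(1) sv(1) False mq(1)] by (auto simp: doubleton_eq_iff)
      have lg: "len g = len h + q"
        unfolding gh(1) using mq by (intro len_dihedral[OF h(1) su(1) sv(1) False h(2,3)]) simp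
      have red: "reduced (r @ alt s t q)" "reduced (r @ alt t s q)"
        using r gh lg su(1) sv(1) by (auto simp: reduced_def val_append alt_in_lists)
      obtain q' where q': "q = Suc q'" using mq(2) by (cases q) auto
      \<comment> \<open>Once the two letters of the braid are put in the suitable order, both words
        represent g and end in z. The induction hypothesis compares what precedes z, and one braid
        move restores the order.\<close>
      have one: "E (w' @ [z]) (r @ alt s t q)" 
        if w: "reduced (w' @ [z])" "val (w' @ [z]) = g" "length (w' @ [z]) = length u" "z \<in> {s, t}" for w' z
      proof -
        obtain x y where xy: "{x, y} = {s, t}" "z = (if even q' then x else y)"
          using w(4) by (metis insertE insert_commute singletonD)
        have x: "x \<in> S" "y \<in> S" "x \<noteq> y" "m x y = enat q"
          using xy(1) su(1) sv(1) False mq msq by (auto simp: doubleton_eq_iff)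
        have e: "r @ alt x y q = (r @ alt x y q') @ [z]" unfolding q' alt_snoc xy(2) by simp
        have rx: "reduced ((r @ alt x y q') @ [z])" "val ((r @ alt x y q') @ [z]) = g"
          using red r(2) gh xy(1) unfolding e[symmetric] by (auto simp: doubleton_eq_iff val_append)
        note rl = reduced_last[OF rx(1)]
        have "val w' = val (r @ alt x y q')"
          using reduced_last(3)[OF w(1)] rl(3) w(2) rx(2) by simp
        then have "E w' (r @ alt x y q')"
          using less.hyps[OF _ reduced_last(4)[OF w(1)] rl(4)] w(3) by simp
        then have 1: "E (w' @ [z]) (r @ alt x y q)" unfolding e using app rl(1) by blast
        have "E (r @ alt x y q) (r @ alt s t q)"
          using xy(1) braid[OF r(1) x(1-4)] equ(1) red x by (auto simp: doubleton_eq_iff reduced_def)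
        with 1 show ?thesis using equ(3) by blast
      qed
      have "E u (r @ alt s t q)" using one[of u' s] less.prems snoc by (simp add: g_def)
      moreover have "E v (r @ alt s t q)" using one[of v' t] less.prems snoc v len by (simp add: g_def)
      ultimately show ?thesis using equ by blast
    qed
  qed
qed

text \<open>Faithfulness of the geometric representation in abstract form: deleting squares makes
  words geodesic, then Matsumoto's theorem applies. E is instantiated twice, by equality in the
  presented group and by equality of the parity of lengths.\<close>

lemma val_eq_equivalent:
  assumes equ: "\<And>u. u \<in> lists S \<Longrightarrow> E u u" "\<And>u v. E u v \<Longrightarrow> E v u" "\<And>u v w. E u v \<Longrightarrow> E v w \<Longrightarrow> E u w"
    and app: "\<And>u v s. s \<in> S \<Longrightarrow> E u v \<Longrightarrow> E (u @ [s]) (v @ [s])"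
    and braid: "\<And>u a b q. u \<in> lists S \<Longrightarrow> a \<in> S \<Longrightarrow> b \<in> S \<Longrightarrow> a \<noteq> b \<Longrightarrow> m a b = enat q \<Longrightarrow>
      E (u @ alt a b q) (u @ alt b a q)"
    and square: "\<And>u s. u \<in> lists S \<Longrightarrow> s \<in> S \<Longrightarrow> E (u @ [s, s]) u"
    and uv: "u \<in> lists S" "v \<in> lists S" "val u = val v"
  shows "E u v"
proof -
  have red_eq: "E u v" if "reduced u" "reduced v" "val u = val v" for u v
    using equ app braid that by (rule reduced_words_equivalent[of E])
  have red: "\<exists>r. reduced r \<and> val r = val w \<and> E w r" if "w \<in> lists S" for w
    using that
  proof (induction w rule: rev_induct)
    case Nil
    have "reduced []" by (simp add: reduced_def)
    then show ?case using equ(1)[of "[]"] by fastforce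
  next
    case (snoc s w)
    then obtain r where r: "reduced r" "val r = val w" "E w r" by auto
    have s: "s \<in> S" using snoc.prems by simp
    have 1: "E (w @ [s]) (r @ [s])" using app s r(3) by blast
    have v: "val (w @ [s]) = val (r @ [s])" using r(2) by (simp add: val_append)
    have rS: "r \<in> lists S" using r(1) by (simp add: reduced_def)
    show ?case
    proof (cases "reduced (r @ [s])")
      case True
      then show ?thesis using 1 v by (intro exI[of _ "r @ [s]"]) simp
    next
      case False
      have g: "val r \<in> W" using rS by blast
      have "desc (val r) s"
        using False r(1) s len_asc[OF g s] by (auto simp: reduced_def val_append)
      have gs: "val r \<circ> sref s \<in> W" using g s by blast
      obtain p where p: "p \<in> lists S" "val p = val r \<circ> sref s" "length p = len (val r \<circ> sref s)"
        using reduced_word[OF gs] .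
      have pr: "reduced p" using p reducedI by blast
      have vp: "val (p @ [s]) = val r" using p(2) s by (simp add: val_append)
      have "reduced (p @ [s])"
        unfolding reduced_def vp using p s len_desc[OF g s \<open>desc (val r) s\<close>] by simp
      then have "E r (p @ [s])" using red_eq[OF r(1)] vp by simp
      then have "E (r @ [s]) (p @ [s, s])" using app[OF s] by fastforce
      then have "E (w @ [s]) p" using 1 square[OF p(1) s] equ(3) by blast
      moreover have "val p = val (w @ [s])" using p(2) v by (simp add: val_append)
      ultimately show ?thesis using pr by blast
    qed
  qed
  obtain r r' where r: "reduced r" "val r = val u" "E u r" "reduced r'" "val r' = val v" "E v r'"
    using red uv by meson
  have "E r r'" using red_eq[OF r(1,4)] r(2,5) uv(3) by simp
  then show ?thesis using r(3,6) equ(2,3) by blast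
qed

end

section \<open>Labelled graphs\<close>

type_synonym vert = nat

primrec walk :: "('v \<times> 'l \<times> 'v) set \<Rightarrow> 'v \<Rightarrow> 'l list \<Rightarrow> 'v \<Rightarrow> bool" where
  "walk E x [] z \<longleftrightarrow> x = z"
| "walk E x (s # w) z \<longleftrightarrow> (\<exists>y. (x, s, y) \<in> E \<and> walk E y w z)"

lemma walk_append: "walk E x (u @ v) z \<longleftrightarrow> (\<exists>y. walk E x u y \<and> walk E y v z)"
  by (induction u arbitrary: x) auto

text \<open>An undirected edge is a pair of opposite triples, so \<open>card E\<close> counts it
  twice; a loop is its own opposite and counts once.\<close>

definition edge_sym :: "('v \<times> 'l \<times> 'v) set \<Rightarrow> bool" where
  "edge_sym E \<longleftrightarrow> (\<forall>x s y. (x, s, y) \<in> E \<longrightarrow> (y, s, x) \<in> E)"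

lemma edge_symD: "edge_sym E \<Longrightarrow> (x, s, y) \<in> E \<Longrightarrow> (y, s, x) \<in> E"
  by (auto simp: edge_sym_def)

lemma walk_rev: "edge_sym E \<Longrightarrow> walk E x w y \<Longrightarrow> walk E y (rev w) x"
  by (induction w arbitrary: x) (auto simp: walk_append dest: edge_symD)

lemma walk_mono: "walk E x w y \<Longrightarrow> E \<subseteq> F \<Longrightarrow> walk F x w y"
  by (induction w arbitrary: x) auto

lemma walk_labels: "walk E x w y \<Longrightarrow> E \<subseteq> V \<times> S \<times> V \<Longrightarrow> w \<in> lists S"
  by (induction w arbitrary: x) auto

lemma walk_end: "walk E x w y \<Longrightarrow> E \<subseteq> V \<times> S \<times> V \<Longrightarrow> x \<in> V \<Longrightarrow> y \<in> V"
  by (induction w arbitrary: x) auto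

lemma walk_vertices:
  "walk E x w y \<Longrightarrow> \<exists>p. p 0 = x \<and> p (length w) = y \<and> (\<forall>i<length w. (p i, w ! i, p (Suc i)) \<in> E)"
proof (induction w arbitrary: x)
  case Nil
  then show ?case by auto
next
  case (Cons s w)
  then obtain z where z: "(x, s, z) \<in> E" "walk E z w y" by auto
  from Cons.IH[OF z(2)] obtain p where
    p: "p 0 = z" "p (length w) = y" "\<forall>i<length w. (p i, w ! i, p (Suc i)) \<in> E" by blast
  show ?case
    by (rule exI[of _ "\<lambda>i. case i of 0 \<Rightarrow> x | Suc j \<Rightarrow> p j"])
      (use p z in \<open>auto simp: nth_Cons split: nat.split\<close>)
qed

lemma walk_segment:
  assumes "\<And>i. n \<le> i \<Longrightarrow> i < n + length w \<Longrightarrow> (p i, w ! (i - n), p (Suc i)) \<in> E"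
  shows "walk E (p n) w (p (n + length w))"
  using assms
proof (induction w arbitrary: n)
  case (Cons s w)
  have "walk E (p (Suc n)) w (p (Suc n + length w))"
  proof (rule Cons.IH)
    fix i assume "Suc n \<le> i" "i < Suc n + length w"
    moreover from this obtain j where "i = Suc n + j" using le_Suc_ex by blast
    ultimately show "(p i, w ! (i - Suc n), p (Suc i)) \<in> E"
      using Cons.prems[of i] by simp
  qed
  then show ?case using Cons.prems[of n] by auto
qed simp

lemma nth_alt: "i < n \<Longrightarrow> alt a b n ! i = (if even i then a else b)"
  by (induction n arbitrary: a b i) (auto simp: nth_Cons split: nat.split)

lemma walk_alt:
  assumes "\<And>i. i < l \<Longrightarrow> (p i, if even i then a else b, p (Suc i)) \<in> E"
  shows "walk E (p 0) (alt a b l) (p l)"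
  using walk_segment[of 0 "alt a b l" p E] assms nth_alt[of _ l a b] by simp

context coxeter begin

definition lgraph :: "vert set \<Rightarrow> (vert \<times> nat \<times> vert) set \<Rightarrow> bool" where
  "lgraph V E \<longleftrightarrow> finite V \<and> V \<noteq> {} \<and> E \<subseteq> V \<times> S \<times> V \<and> edge_sym E \<and> (\<forall>x\<in>V. \<forall>y\<in>V. \<exists>w. walk E x w y)"

text \<open>K is the group read along closed walks at v, up to a fixed conjugation. The conjugator
  allows the base vertex to move (\<open>represents_at\<close>), so that vertices can be merged or
  deleted.\<close>

definition represents ::
  "vert set \<Rightarrow> (vert \<times> nat \<times> vert) set \<Rightarrow> ((nat \<Rightarrow> real) \<Rightarrow> nat \<Rightarrow> real) set \<Rightarrow> bool" where
  "represents V E K \<longleftrightarrow> (\<exists>v\<in>V. \<exists>c\<in>lists S. K = {val (c @ w @ rev c) |w. walk E v w v})"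

lemma lgraphD:
  assumes "lgraph V E"
  shows "finite V" "V \<noteq> {}" "E \<subseteq> V \<times> S \<times> V" "edge_sym E" "x \<in> V \<Longrightarrow> y \<in> V \<Longrightarrow> \<exists>w. walk E x w y"
  using assms by (auto simp: lgraph_def)

lemma lgraph_finite_edges: "lgraph V E \<Longrightarrow> finite E"
  using finite_S by (auto simp: lgraph_def intro: finite_subset)

lemma val_conj: "d \<in> lists S \<Longrightarrow> val d = val e \<Longrightarrow> val (u @ d @ rev e @ v) = val (u @ v)" if "e \<in> lists S"
  using that val_rev_right[of e] by (simp add: val_append) (metis comp_assoc comp_id)

lemma val_cancel: "d \<in> lists S \<Longrightarrow> val (u @ d @ rev d @ v) = val (u @ v)"
  "d \<in> lists S \<Longrightarrow> val (u @ rev d @ d @ v) = val (u @ v)"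
  using val_conj[of d d u v] val_conj[of "rev d" "rev d" u v] by simp_all

lemma represents_at:
  assumes g: "lgraph V E" "represents V E K" and x: "x \<in> V"
  obtains c where "c \<in> lists S" "K = {val (c @ w @ rev c) |w. walk E x w x}"
proof -
  from g(2) obtain v c where v: "v \<in> V" "c \<in> lists S" "K = {val (c @ w @ rev c) |w. walk E v w v}"
    by (auto simp: represents_def)
  obtain d where d: "walk E v d x" using lgraphD(5)[OF g(1) v(1) x] by blast
  have dS: "d \<in> lists S" using walk_labels[OF d lgraphD(3)[OF g(1)]] .
  have d': "walk E x (rev d) v" using walk_rev[OF lgraphD(4)[OF g(1)] d] .
  have "K = {val ((c @ d) @ w @ rev (c @ d)) |w. walk E x w x}"
  proof (intro equalityI subsetI)
    fix h assume "h \<in> K"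
    then obtain w where w: "walk E v w v" "h = val (c @ w @ rev c)" using v(3) by blast
    have "val ((c @ d) @ (rev d @ w @ d) @ rev (c @ d)) = h"
      using val_cancel(1)[OF dS, of c "w @ d @ rev d @ rev c"] val_cancel(1)[OF dS, of "c @ w" "rev c"] w(2)
      by simp
    moreover have "walk E x (rev d @ w @ d) x" using w(1) d d' by (auto simp: walk_append)
    ultimately show "h \<in> {val ((c @ d) @ w @ rev (c @ d)) |w. walk E x w x}" by blast
  next
    fix h assume "h \<in> {val ((c @ d) @ w @ rev (c @ d)) |w. walk E x w x}"
    then obtain w where w: "walk E x w x" "h = val (c @ (d @ w @ rev d) @ rev c)" by auto
    moreover have "walk E v (d @ w @ rev d) v" using w(1) d d' by (auto simp: walk_append)
    ultimately show "h \<in> K" using v(3) by blast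
  qed
  then show ?thesis using that[of "c @ d"] v(2) dS by simp
qed

text \<open>Vertex \<open>x\<close> of the first graph is sent to \<open>f x\<close>, and \<open>t x\<close> is thought of as
  the label of a path from \<open>f x\<close> to \<open>x\<close> in the union of both graphs.\<close>

definition simulates where
  "simulates E F f t \<longleftrightarrow> (\<forall>x. t x \<in> lists S) \<and> (\<forall>x s y. (x, s, y) \<in> E \<longrightarrow>
    (\<exists>w. walk F (f x) w (f y) \<and> val w = val (t x @ [s] @ rev (t y))))"

lemma simulates_walk:
  assumes "simulates E F f t" "E \<subseteq> V \<times> S \<times> V" "walk E x w y"
  shows "\<exists>w'. walk F (f x) w' (f y) \<and> val w' = val (t x @ w @ rev (t y))"
  using assms(3)
proof (induction w arbitrary: x)
  case Nil
  have "t x \<in> lists S" using assms(1) by (simp add: simulates_def)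
  then show ?case using Nil val_cancel(1)[of "t x" "[]" "[]"] by (intro exI[of _ "[]"]) simp
next
  case (Cons s w)
  then obtain z where z: "(x, s, z) \<in> E" "walk E z w y" by auto
  obtain w1 where w1: "walk F (f x) w1 (f z)" "val w1 = val (t x @ [s] @ rev (t z))"
    using assms(1) z(1) unfolding simulates_def by meson
  obtain w2 where w2: "walk F (f z) w2 (f y)" "val w2 = val (t z @ w @ rev (t y))"
    using Cons.IH[OF z(2)] by blast
  have tz: "t z \<in> lists S" using assms(1) by (simp add: simulates_def)
  have "walk F (f x) (w1 @ w2) (f y)" using w1 w2 by (auto simp: walk_append)
  moreover have "val (w1 @ w2) = val (t x @ (s # w) @ rev (t y))"
    using val_cancel(2)[OF tz, of "t x @ [s]" "w @ rev (t y)"] w1(2) w2(2)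
    by (simp add: val_append comp_assoc)
  ultimately show ?case by blast
qed

lemma simulatesI:
  assumes t: "\<And>x. t x \<in> lists S" and F: "edge_sym F" "F \<subseteq> V \<times> S \<times> V"
    and E: "E \<subseteq> V' \<times> S \<times> V'"
    and e: "\<And>x s y. (x, s, y) \<in> E \<Longrightarrow>
      (\<exists>w. walk F (f x) w (f y) \<and> val w = val (t x @ [s] @ rev (t y))) \<or>
      (\<exists>w. walk F (f y) w (f x) \<and> val w = val (t y @ [s] @ rev (t x)))"
  shows "simulates E F f t"
  unfolding simulates_def
proof (intro conjI allI impI)
  show "t x \<in> lists S" for x by (rule t)
  fix x s y assume xy: "(x, s, y) \<in> E"
  have s: "s \<in> S" using E xy by auto
  from e[OF xy] show "\<exists>w. walk F (f x) w (f y) \<and> val w = val (t x @ [s] @ rev (t y))"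
  proof (elim disjE exE conjE)
    fix w assume w: "walk F (f y) w (f x)" "val w = val (t y @ [s] @ rev (t x))"
    have "walk F (f x) (rev w) (f y)" using walk_rev[OF F(1) w(1)] .
    moreover have "val (rev w) = val (t x @ [s] @ rev (t y))"
    proof -
      let ?d = "t x @ [s] @ rev (t y)"
      have wS: "w \<in> lists S" and dS: "?d \<in> lists S" using walk_labels[OF w(1) F(2)] t s by auto
      have "val (rev w @ w @ ?d) = val ?d" using val_cancel(2)[OF wS, of "[]" ?d] by simp
      moreover have "val (w @ ?d) = id"
        using val_rev_left[OF dS] w(2) by (simp add: val_append)
      ultimately show ?thesis by (simp add: val_append)
    qed
    ultimately show ?thesis by blast
  qed blast
qed

text \<open>Simulations in both directions that fix v, with the empty label there, turn closed walks
  at v into closed walks of the same value. So both graphs read the same group.\<close>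

lemma represents_transfer:
  assumes g: "lgraph V E" "represents V E K" and v: "v \<in> V" "v \<in> V'" and F: "F \<subseteq> V' \<times> S \<times> V'"
    and s1: "simulates E F f t" "f v = v" "t v = []"
    and s2: "simulates F E f' t'" "f' v = v" "t' v = []"
  shows "represents V' F K"
proof -
  obtain c where c: "c \<in> lists S" "K = {val (c @ w @ rev c) |w. walk E v w v}"
    using represents_at[OF g v(1)] .
  have "\<exists>w'. walk F v w' v \<and> val w' = val w" if "walk E v w v" for w
    using simulates_walk[OF s1(1) lgraphD(3)[OF g(1)] that] s1(2,3) by simp
  moreover have "\<exists>w'. walk E v w' v \<and> val w' = val w" if "walk F v w v" for w
    using simulates_walk[OF s2(1) F that] s2(2,3) by simp
  moreover have "val (c @ w @ rev c) = val (c @ w' @ rev c)" if "val w = val w'" for w w'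
    using that by (simp add: val_append)
  ultimately have "{val (c @ w @ rev c) |w. walk E v w v} = {val (c @ w @ rev c) |w. walk F v w v}"
    by (intro equalityI subsetI; clarify; metis)
  then show ?thesis unfolding represents_def using v(2) c by blast
qed

lemma lgraphI:
  assumes "finite V" "v \<in> V" "E \<subseteq> V \<times> S \<times> V" "edge_sym E" "\<And>x. x \<in> V \<Longrightarrow> \<exists>w. walk E v w x"
  shows "lgraph V E"
  unfolding lgraph_def
proof (intro conjI ballI)
  fix x y assume "x \<in> V" "y \<in> V"
  then obtain w w' where "walk E v w x" "walk E v w' y" using assms(5) by meson
  then have "walk E x (rev w @ w') y" using walk_rev[OF assms(4)] by (auto simp: walk_append)
  then show "\<exists>w. walk E x w y" by blast
qed (use assms in auto)

text \<open>Merging vertices that are joined by walks of trivial value does not change the group: a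
  walk of the quotient lifts once such walks are inserted.\<close>

lemma quotient_graph:
  assumes g: "lgraph V E" "represents V E K"
    and f: "\<And>x. x \<in> V \<Longrightarrow> f x \<in> V" "\<And>x. x \<in> V \<Longrightarrow> f (f x) = f x"
      "\<And>x. x \<in> V \<Longrightarrow> \<exists>w. walk E x w (f x) \<and> val w = id"
  shows "lgraph (f ` V) ((\<lambda>(x, s, y). (f x, s, f y)) ` E)"
    "represents (f ` V) ((\<lambda>(x, s, y). (f x, s, f y)) ` E) K"
proof -
  let ?F = "(\<lambda>(x, s, y). (f x, s, f y)) ` E"
  note gd = lgraphD[OF g(1)]
  obtain v0 where v0: "v0 \<in> V" using gd(2) by blast
  define v where "v = f v0"
  have v: "v \<in> V" "f v = v" using f(1,2)[OF v0] by (auto simp: v_def)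
  have F: "?F \<subseteq> f ` V \<times> S \<times> f ` V" using gd(3) by auto
  have symF: "edge_sym ?F" unfolding edge_sym_def
  proof (intro allI impI)
    fix x s y assume "(x, s, y) \<in> ?F"
    then obtain a b where "(a, s, b) \<in> E" "x = f a" "y = f b" by auto
    then show "(y, s, x) \<in> ?F" using edge_symD[OF gd(4)] by force
  qed
  have s1: "simulates E ?F f (\<lambda>_. [])"
    unfolding simulates_def
  proof (intro conjI allI impI)
    fix x s y assume "(x, s, y) \<in> E"
    then have "(f x, s, f y) \<in> ?F" by force
    then show "\<exists>w. walk ?F (f x) w (f y) \<and> val w = val ([] @ [s] @ rev [])"
      by (intro exI[of _ "[s]"]) simp
  qed simp
  show "lgraph (f ` V) ?F"
  proof (rule lgraphI[OF _ _ F symF])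
    show "finite (f ` V)" "v \<in> f ` V" using gd(1) v0 v_def by auto
    fix x assume "x \<in> f ` V"
    then obtain x0 where x0: "x0 \<in> V" "x = f x0" by blast
    obtain w where "walk E v w x0" using gd(5)[OF v(1) x0(1)] by blast
    from simulates_walk[OF s1 gd(3) this] show "\<exists>w. walk ?F v w x" using v(2) x0(2) by auto
  qed
  have s2: "simulates ?F E id (\<lambda>_. [])"
    unfolding simulates_def
  proof (intro conjI allI impI)
    fix x s y assume "(x, s, y) \<in> ?F"
    then obtain a b where ab: "(a, s, b) \<in> E" "x = f a" "y = f b" by auto
    then have abV: "a \<in> V" "b \<in> V" using gd(3) by auto
    obtain u where u: "walk E a u (f a)" "val u = id" using f(3)[OF abV(1)] by blast
    obtain u' where u': "walk E b u' (f b)" "val u' = id" using f(3)[OF abV(2)] by blast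
    have "u \<in> lists S" using walk_labels[OF u(1) gd(3)] .
    then have "val (rev u) = id" using val_rev_left[of u] u(2) by simp
    then have "val (rev u @ [s] @ u') = val [s]" using u'(2) by (simp add: val_append)
    moreover have "walk E x (rev u @ [s] @ u') y"
      using walk_rev[OF gd(4) u(1)] ab u'(1) by (auto simp: walk_append)
    ultimately show "\<exists>w. walk E (id x) w (id y) \<and> val w = val ([] @ [s] @ rev [])"
      by (auto simp: id_apply)
  qed simp
  show "represents (f ` V) ?F K"
    by (rule represents_transfer[OF g v(1) _ F s1 v(2) _ s2]) (use v0 v_def in \<open>auto simp: id_apply\<close>)
qed

end

section \<open>Minimal graphs\<close>

text \<open>Edges are counted in both orientations, so the inequality in \<open>graph\<close> reads
  card E / 2 - card V + 1 \<le> k, a bound on the Betti number. The condition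
  \<open>no_reflection\<close> is what torsion-free subgroups, subgroups without conjugates of
  generators and subgroups of even elements have in common.\<close>

locale minimal_graph = coxeter S m for S m +
  fixes K :: "((nat \<Rightarrow> real) \<Rightarrow> nat \<Rightarrow> real) set" and k :: nat
    and V :: "vert set" and E :: "(vert \<times> nat \<times> vert) set"
  assumes k_pos: "0 < k"
    and m_ge: "a \<in> S \<Longrightarrow> b \<in> S \<Longrightarrow> a \<noteq> b \<Longrightarrow> enat (3 * k + 1) \<le> m a b"
    and no_reflection: "c \<in> lists S \<Longrightarrow> s \<in> S \<Longrightarrow> val (c @ [s] @ rev c) \<notin> K"
    and graph: "lgraph V E" "represents V E K" "card E + 2 \<le> 2 * card V + 2 * k"
    and minimal: "lgraph V' E' \<Longrightarrow> represents V' E' K \<Longrightarrow> card E' + 2 \<le> 2 * card V' + 2 * k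
      \<Longrightarrow> card E \<le> card E'"
begin

lemmas gd = lgraphD[OF graph(1)]
lemmas finE = lgraph_finite_edges[OF graph(1)]

lemma no_loop: "(x, s, x) \<notin> E"
proof
  assume xs: "(x, s, x) \<in> E"
  then have x: "x \<in> V" "s \<in> S" using gd(3) by auto
  obtain c where c: "c \<in> lists S" "K = {val (c @ w @ rev c) |w. walk E x w x}"
    using represents_at[OF graph(1,2) x(1)] .
  have "walk E x [s] x" using xs by simp
  then have "val (c @ [s] @ rev c) \<in> K" using c(2) by blast
  then show False using no_reflection c(1) x(2) by blast
qed

text \<open>Two edges with the same label at x could be merged: the walk s s between their ends has
  trivial value, and the merge removes one vertex and one edge, which keeps the Betti
  number.\<close>

lemma folded:
  assumes "(x, s, y) \<in> E" "(x, s, z) \<in> E" shows "y = z"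
proof (rule ccontr)
  assume yz: "y \<noteq> z"
  define f where "f = (\<lambda>u. if u = z then y else u)"
  have V: "x \<in> V" "y \<in> V" "z \<in> V" "s \<in> S" using assms gd(3) by auto
  have nl: "x \<noteq> y" "x \<noteq> z" using assms no_loop by auto
  have rev: "(y, s, x) \<in> E" "(z, s, x) \<in> E" using assms edge_symD[OF gd(4)] by auto
  have "walk E z [s, s] y" "val [s, s] = id" using rev assms V by auto
  moreover have "walk E u [] u" "val [] = id" for u by auto
  ultimately have tr: "\<exists>w. walk E u w (f u) \<and> val w = id" for u unfolding f_def by metis
  have fV: "f u \<in> V" "f (f u) = f u" if "u \<in> V" for u using that V yz by (auto simp: f_def)
  let ?F = "(\<lambda>(x, s, y). (f x, s, f y)) ` E"
  note q = quotient_graph[OF graph(1,2), of f, OF fV tr]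
  have "f ` V = V - {z}" using V yz by (auto simp: f_def)
  then have cV: "card (f ` V) = card V - 1" "0 < card V" using V gd(1) by (auto simp: card_gt_0_iff)
  define R where "R = {(x, s, z), (z, s, x)}"
  have "?F = (\<lambda>(x, s, y). (f x, s, f y)) ` (E - R)"
  proof (intro equalityI subsetI)
    fix t assume "t \<in> ?F"
    then obtain a l b where t: "(a, l, b) \<in> E" "t = (f a, l, f b)" by auto
    consider "(a, l, b) \<notin> R" | "(a, l, b) = (x, s, z)" | "(a, l, b) = (z, s, x)" unfolding R_def by blast
    then show "t \<in> (\<lambda>(x, s, y). (f x, s, f y)) ` (E - R)"
    proof cases
      case 1
      then show ?thesis using t by force
    next
      case 2
      then have "(x, s, y) \<in> E - R" "t = (f x, s, f y)"
        using t assms nl yz by (auto simp: R_def f_def)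
      then show ?thesis by force
    next
      case 3
      then have "(y, s, x) \<in> E - R" "t = (f y, s, f x)"
        using t rev nl yz by (auto simp: R_def f_def)
      then show ?thesis by force
    qed
  qed blast
  then have "card ?F \<le> card (E - R)" using finE by (simp add: card_image_le)
  also have "card (E - R) = card E - card R"
    using assms rev by (intro card_Diff_subset) (auto simp: R_def)
  also have "card R = 2" using nl by (simp add: R_def)
  finally have cE: "card ?F \<le> card E - 2" .
  have "R \<subseteq> E" using assms rev by (auto simp: R_def)
  then have "2 \<le> card E" using card_mono[OF finE] \<open>card R = 2\<close> by metis
  moreover from this have "card ?F + 2 \<le> 2 * card (f ` V) + 2 * k" using cE cV graph(3) by linarith
  ultimately show False using minimal[OF q] cE by simp
qed

lemma folded': "(y, s, x) \<in> E \<Longrightarrow> (z, s, x) \<in> E \<Longrightarrow> y = z"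
  using folded edge_symD[OF gd(4)] by blast

text \<open>A vertex of degree one could be pruned together with its edge.\<close>

lemma two_edges:
  assumes "(x, s, y) \<in> E"
  shows "\<exists>t z. (x, t, z) \<in> E \<and> t \<noteq> s"
proof (rule ccontr)
  assume "\<not> ?thesis"
  then have only: "(x, t, z) \<in> E \<Longrightarrow> t = s \<and> z = y" for t z using folded assms by blast
  have V: "x \<in> V" "y \<in> V" "s \<in> S" using assms gd(3) by auto
  have xy: "x \<noteq> y" using no_loop assms by auto
  define R where "R = {(x, s, y), (y, s, x)}"
  have R: "R \<subseteq> E" "card R = 2" using assms edge_symD[OF gd(4)] xy by (auto simp: R_def)
  let ?F = "E - R" and ?V = "V - {x}"
  have F: "?F \<subseteq> ?V \<times> S \<times> ?V"
  proof
    fix e assume e: "e \<in> ?F"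
    obtain a l b where abl: "e = (a, l, b)" by (cases e)
    have "a \<noteq> x" using e abl only[of l b] by (auto simp: R_def)
    moreover have "b \<noteq> x" using e abl only[of l a] edge_symD[OF gd(4), of a l b] by (auto simp: R_def)
    ultimately show "e \<in> ?V \<times> S \<times> ?V" using e abl gd(3) by auto
  qed
  have symF: "edge_sym ?F" using gd(4) by (auto simp: edge_sym_def R_def)
  define f where "f = (\<lambda>u. if u = x then y else u)"
  define t where "t = (\<lambda>u. if u = x then [s] else [])"
  have s1: "simulates E ?F f t"
  proof (rule simulatesI[OF _ symF F gd(3)])
    show "t u \<in> lists S" for u using V by (simp add: t_def)
    fix a l b assume e: "(a, l, b) \<in> E"
    show "(\<exists>w. walk ?F (f a) w (f b) \<and> val w = val (t a @ [l] @ rev (t b))) \<or>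
      (\<exists>w. walk ?F (f b) w (f a) \<and> val w = val (t b @ [l] @ rev (t a)))"
    proof (cases "(a, l, b) \<in> R")
      case True
      have "walk ?F (f x) [] (f y) \<and> val [] = val (t x @ [s] @ rev (t y))"
        using xy V by (simp add: f_def t_def)
      then show ?thesis using True unfolding R_def by blast
    next
      case False
      then have "a \<noteq> x" "b \<noteq> x" using F e by auto
      then have "walk ?F (f a) [l] (f b) \<and> val [l] = val (t a @ [l] @ rev (t b))"
        using e False by (simp add: f_def t_def)
      then show ?thesis by blast
    qed
  qed
  have s2: "simulates ?F E id (\<lambda>_. [])"
    unfolding simulates_def
  proof (intro conjI allI impI)
    fix a l b assume "(a, l, b) \<in> ?F"
    then have "walk E (id a) [l] (id b) \<and> val [l] = val ([] @ [l] @ rev [])" by (simp add: id_apply)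
    then show "\<exists>w. walk E (id a) w (id b) \<and> val w = val ([] @ [l] @ rev [])" by blast
  qed simp
  have fy: "f y = y" "t y = []" using xy by (auto simp: f_def t_def)
  have rep: "represents ?V ?F K"
    by (rule represents_transfer[OF graph(1,2) V(2) _ F s1 fy s2]) (use V xy in \<open>auto simp: id_apply\<close>)
  have lg: "lgraph ?V ?F"
  proof (rule lgraphI[OF _ _ F symF])
    show "finite ?V" "y \<in> ?V" using gd(1) V xy by auto
    fix u assume u: "u \<in> ?V"
    then obtain w where "walk E y w u" using gd(5)[OF V(2)] by blast
    from simulates_walk[OF s1 gd(3) this] show "\<exists>w. walk ?F y w u" using u fy by (auto simp: f_def)
  qed
  have "card ?F = card E - 2" using R finE by (simp add: card_Diff_subset finite_subset)
  moreover have "card ?V = card V - 1" "0 < card V" using V gd(1) by (auto simp: card_gt_0_iff)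
  moreover have "2 \<le> card E" using card_mono[OF finE R(1)] R(2) by simp
  moreover from calculation have "card ?F + 2 \<le> 2 * card ?V + 2 * k" using graph(3) by linarith
  ultimately show False using minimal[OF lg rep] by simp
qed


text \<open>At odd distance the edge leaving \<open>p i\<close> and the edge entering
  \<open>p j\<close> carry the same label, so folding shrinks the interval from both ends until a
  loop appears. At even distance the edges preceding \<open>p i\<close> and \<open>p j\<close> carry
  the same label, and folding shifts the coincidence back to the start.\<close>

lemma alt_closed_walk:
  assumes p: "\<And>i. i < N \<Longrightarrow> (p i, if even i then a else b, p (Suc i)) \<in> E"
    and ij: "i < j" "j \<le> N" "p i = p j"
  shows "\<exists>c. 1 \<le> c \<and> 2 * c = j - i \<and> p (2 * c) = p 0"
proof -
  have odd: False if "i < j" "j \<le> N" "p i = p j" "odd (j - i)" for i j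
    using that
  proof (induction "j - i" arbitrary: i j rule: less_induct)
    case less
    obtain j' where j': "j = Suc j'" using less.prems(1) by (cases j) auto
    define l where "l = (if even i then a else b)"
    have l: "l = (if even j' then a else b)" using less.prems(1,4) j' by (auto simp: l_def)
    have 1: "(p i, l, p (Suc i)) \<in> E" using p[of i] less.prems by (simp add: l_def)
    have 2: "(p j', l, p i) \<in> E" using p[of j'] less.prems j' l by simp
    have e: "p (Suc i) = p j'" using folded[OF 1 edge_symD[OF gd(4) 2]] .
    show False
    proof (cases "j' = i")
      case True
      then show False using 2 no_loop by simp
    next
      case False
      then have lt: "i < j'" using less.prems(1) j' by simp
      have "Suc i < j'"
      proof (rule ccontr)
        assume "\<not> ?thesis"
        then have "j' = Suc i" using lt by simp
        then show False using less.prems(4) j' by simp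
      qed
      moreover have "j' - Suc i < j - i" using lt j' by linarith
      moreover have "odd (j' - Suc i)" using less.prems(4) j' lt by (auto simp: Suc_diff_le)
      moreover have "j' \<le> N" using less.prems(2) j' by simp
      ultimately show False using less.hyps[of j' "Suc i"] e by blast
    qed
  qed
  have shift: "p (j - i) = p 0" if "i < j" "j \<le> N" "p i = p j" for i j
    using that
  proof (induction i arbitrary: j)
    case (Suc i)
    then obtain j' where j': "j = Suc j'" by (cases j) auto
    have ev: "even (j - Suc i)" using odd Suc.prems by blast
    define l where "l = (if even i then a else b)"
    have l: "l = (if even j' then a else b)" using ev Suc.prems(1) j' by (auto simp: l_def)
    have "(p i, l, p (Suc i)) \<in> E" using p[of i] Suc.prems by (simp add: l_def)
    moreover have "(p j', l, p (Suc i)) \<in> E" using p[of j'] Suc.prems j' l by simp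
    ultimately have "p i = p j'" by (rule folded')
    then show ?case using Suc.IH[of j'] Suc.prems j' by simp
  qed simp
  have "even (j - i)" using odd ij by blast
  then obtain c where c: "j - i = 2 * c" by (elim evenE)
  then show ?thesis using shift[OF ij] ij(1) by (intro exI[of _ c]) auto
qed

lemma val_alt_multiple:
  assumes ab: "a \<in> S" "b \<in> S" "a \<noteq> b" and q: "m a b = enat q"
  shows "val (alt a b (2 * q * n)) = id"
proof (induction n)
  case (Suc n)
  have "alt a b (2 * q * Suc n) = alt a b (2 * q) @ alt a b (2 * q * n)"
    using alt_add[of a b "2 * q" "2 * q * n"] by (simp add: add.commute)
  then show ?case using Suc val_alt_relator[OF ab q] by (simp add: val_append)
qed simp

text \<open>A short cycle of length \<open>2 c\<close> with alternating labels can be wrapped around a cycle of length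
  \<open>2 gcd c q\<close>, since the loop of length \<open>2 gcd c q\<close> is already represented.\<close>

lemma alt_cycle_dvd:
  assumes ab: "a \<in> S" "b \<in> S" "a \<noteq> b" and q: "m a b = enat q"
    and c: "1 \<le> c" and y: "\<And>i. (y i, if even i then a else b, y (Suc i)) \<in> E"
      "\<And>i. y (i + 2 * c) = y i" and inj: "inj_on y {..<2 * c}"
  shows "c dvd q"
proof (rule ccontr)
  assume nd: "\<not> c dvd q"
  define d where "d = gcd c q"
  have d: "d dvd c" "d < c" "1 \<le> d"
  proof -
    show "d dvd c" by (simp add: d_def)
    moreover have "d \<noteq> c" using nd d_def by (metis gcd_dvd2)
    ultimately show "d < c" using c by (metis dvd_imp_le le_neq_implies_less less_le_trans zero_less_one)
    show "1 \<le> d" using c by (simp add: d_def Suc_le_eq)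
  qed
  define lab where "lab i = (if even i then a else b)" for i :: nat
  have yE: "(y i, lab i, y (Suc i)) \<in> E" for i using y(1) by (simp add: lab_def)
  have yV: "y i \<in> V" for i using yE gd(3) by blast
  have yper: "y (i + 2 * c * n) = y i" for i n
  proof (induction n)
    case (Suc n)
    then show ?case using y(2)[of "i + 2 * c * n"] by (simp add: algebra_simps)
  qed simp
  have ymod: "y i = y (i mod (2 * c))" for i
    using yper[of "i mod (2 * c)" "i div (2 * c)"] by (metis mod_mult_div_eq)
  have seg: "walk E (y i) (alt (lab i) (lab (Suc i)) l) (y (i + l))" for i l
  proof -
    have "walk E (y i) (alt (lab i) (lab (Suc i)) l) (y (i + length (alt (lab i) (lab (Suc i)) l)))"
    proof (rule walk_segment)
      fix j assume j: "i \<le> j" "j < i + length (alt (lab i) (lab (Suc i)) l)"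
      then have "alt (lab i) (lab (Suc i)) l ! (j - i) = lab j"
        by (subst nth_alt) (auto simp: lab_def)
      then show "(y j, alt (lab i) (lab (Suc i)) l ! (j - i), y (Suc j)) \<in> E" using yE by simp
    qed
    then show ?thesis by simp
  qed
  define Y where "Y = y ` {..<2 * c}"
  define idx where "idx = inv_into {..<2 * c} y"
  define f where "f u = (if u \<in> Y then y (idx u mod (2 * d)) else u)" for u
  have fy: "f (y i) = y (i mod (2 * d))" for i
  proof -
    have i: "i mod (2 * c) \<in> {..<2 * c}" using c by simp
    have "y i \<in> Y" "idx (y i) = i mod (2 * c)"
      using ymod[of i] i inv_into_f_f[OF inj i] by (auto simp: Y_def idx_def)
    moreover have "(i mod (2 * c)) mod (2 * d) = i mod (2 * d)" using d(1) by (simp add: mod_mod_cancel)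
    ultimately show ?thesis by (simp add: f_def)
  qed
  have tr: "\<exists>w. walk E u w (f u) \<and> val w = id" for u
  proof (cases "u \<in> Y")
    case False
    then show ?thesis by (intro exI[of _ "[]"]) (simp add: f_def)
  next
    case True
    then obtain i where i: "u = y i" by (auto simp: Y_def)
    define r where "r = i mod (2 * d)"
    define e where "e = i div (2 * d)"
    have ire: "i = r + 2 * d * e" by (simp add: r_def e_def)
    have "q \<noteq> 0" using kap_finite(2)[OF ab q] by simp
    \<comment> \<open>By Bezout, q s = c t + d. A walk of 2 q (s e) steps consists of relators and
      has trivial value, yet modulo the period 2 c it advances by 2 d e, from \<open>y r\<close> to
      u.\<close>
    then obtain s t where st: "q * s = c * t + gcd q c" using bezout_nat by blast
    have "r + 2 * q * (s * e) = i + 2 * c * (t * e)"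
      using arg_cong[OF st, of "\<lambda>z. 2 * z * e"] by (simp add: ire d_def gcd.commute algebra_simps)
    then have "y (r + 2 * q * (s * e)) = u" using yper i by simp
    then have "walk E (y r) (alt (lab r) (lab (Suc r)) (2 * q * (s * e))) u" using seg by metis
    moreover have "val (rev (alt (lab r) (lab (Suc r)) (2 * q * (s * e)))) = id"
    proof -
      have "m (lab r) (lab (Suc r)) = enat q" "lab r \<in> S" "lab (Suc r) \<in> S" "lab r \<noteq> lab (Suc r)"
        using ab q m_sym by (auto simp: lab_def)
      then show ?thesis using m_sym[of "lab r"] by (simp add: rev_alt val_alt_multiple)
    qed
    moreover have "f u = y r" using fy i by (simp add: r_def)
    ultimately show ?thesis using walk_rev[OF gd(4)] by metis
  qed
  have fV: "f u \<in> V" if "u \<in> V" for u using that yV by (simp add: f_def)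
  have ff: "f (f u) = f u" for u
    by (cases "u \<in> Y") (auto simp: Y_def fy, auto simp: f_def Y_def)
  let ?g = "\<lambda>(x, s, y). (f x, s, f y)"
  note quo = quotient_graph[OF graph(1,2), of f, OF fV ff tr]
  define fw where "fw i = (y i, lab i, y (Suc i))" for i
  define bw where "bw i = (y (Suc i), lab i, y i)" for i
  define Cyc where "Cyc = fw ` {..<2 * c} \<union> bw ` {..<2 * c}"
  have inj': "i mod (2 * c) = j mod (2 * c)" if "y i = y j" for i j
    using inj_onD[OF inj, of "i mod (2 * c)" "j mod (2 * c)"] ymod[of i] ymod[of j] that c by auto
  have cardCyc: "card Cyc = 4 * c"
  proof -
    have "inj_on fw {..<2 * c}" using inj by (auto simp: inj_on_def fw_def)
    moreover have "inj_on bw {..<2 * c}" using inj by (auto simp: inj_on_def bw_def)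
    \<comment> \<open>Equal end points force i and j + 1 to agree modulo 2, equal labels force i and
      j to agree.\<close>
    moreover have "fw ` {..<2 * c} \<inter> bw ` {..<2 * c} = {}"
    proof (rule ccontr)
      assume "\<not> ?thesis"
      then obtain i j where "fw i = bw j" by blast
      then have e: "y i = y (Suc j)" "lab i = lab j" by (auto simp: fw_def bw_def)
      have "i mod (2 * c) = Suc j mod (2 * c)" using inj'[OF e(1)] .
      then have "(i mod (2 * c)) mod 2 = (Suc j mod (2 * c)) mod 2" by simp
      then have "i mod 2 = Suc j mod 2" by (simp add: mod_mod_cancel)
      moreover have "even i = even j" using e(2) ab by (auto simp: lab_def split: if_splits)
      ultimately show False by presburger
    qed
    ultimately show ?thesis by (simp add: Cyc_def card_Un_disjoint card_image)
  qed
  have fin: "finite Cyc" by (simp add: Cyc_def)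
  have CE: "Cyc \<subseteq> E" using yE edge_symD[OF gd(4)] by (auto simp: Cyc_def fw_def bw_def)
  have gCyc: "card (?g ` Cyc) \<le> 4 * d"
  proof -
    have lm: "lab i = lab (i mod (2 * d))" for i by (simp add: lab_def dvd_mod_iff)
    have "?g ` Cyc \<subseteq> (\<lambda>i. ?g (fw i)) ` {..<2 * d} \<union> (\<lambda>i. ?g (bw i)) ` {..<2 * d}"
    proof
      fix t assume "t \<in> ?g ` Cyc"
      then obtain i where i: "t = ?g (fw i) \<or> t = ?g (bw i)" unfolding Cyc_def by blast
      have *: "Suc (i mod (2 * d)) mod (2 * d) = Suc i mod (2 * d)" by (simp add: mod_Suc_eq)
      have "?g (fw i) = ?g (fw (i mod (2 * d)))" "?g (bw i) = ?g (bw (i mod (2 * d)))"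
        using lm[of i] * by (simp_all add: fw_def bw_def fy)
      moreover have "i mod (2 * d) \<in> {..<2 * d}" using d by simp
      ultimately show "t \<in> (\<lambda>i. ?g (fw i)) ` {..<2 * d} \<union> (\<lambda>i. ?g (bw i)) ` {..<2 * d}"
        using i by blast
    qed
    then have "card (?g ` Cyc) \<le> card ((\<lambda>i. ?g (fw i)) ` {..<2 * d} \<union> (\<lambda>i. ?g (bw i)) ` {..<2 * d})"
      by (intro card_mono) auto
    also have "\<dots> \<le> 2 * d + 2 * d"
      by (rule order.trans[OF card_Un_le add_mono]) (metis card_image_le card_lessThan finite_lessThan)+
    finally show ?thesis by simp
  qed
  have "?g ` E = ?g ` (E - Cyc) \<union> ?g ` Cyc" using CE by blast
  then have "card (?g ` E) \<le> card (?g ` (E - Cyc)) + card (?g ` Cyc)" by (metis card_Un_le)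
  also have "\<dots> \<le> card (E - Cyc) + 4 * d"
    using gCyc finE by (intro add_mono card_image_le) auto
  also have "card (E - Cyc) = card E - 4 * c" using CE fin cardCyc by (simp add: card_Diff_subset)
  finally have cE: "card (?g ` E) \<le> card E - 4 * c + 4 * d" .
  have c4: "4 * c \<le> card E" using card_mono[OF finE CE] cardCyc by simp
  have "f ` V = (V - Y) \<union> y ` {..<2 * d}"
  proof (intro equalityI subsetI)
    fix u assume "u \<in> f ` V"
    then show "u \<in> (V - Y) \<union> y ` {..<2 * d}" using d by (auto simp: f_def)
  next
    fix u assume "u \<in> (V - Y) \<union> y ` {..<2 * d}"
    then show "u \<in> f ` V"
    proof
      assume "u \<in> V - Y"
      then show ?thesis by (auto simp: f_def image_iff)
    next
      assume "u \<in> y ` {..<2 * d}"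
      then obtain i where "i < 2 * d" "u = y i" by blast
      then have "u = f (y i)" using fy by simp
      then show ?thesis using yV by blast
    qed
  qed
  moreover have "(V - Y) \<inter> y ` {..<2 * d} = {}" using d by (auto simp: Y_def)
  moreover have "card (y ` {..<2 * d}) = 2 * d"
    using inj_on_subset[OF inj, of "{..<2 * d}"] d by (simp add: card_image)
  moreover have "card (V - Y) = card V - 2 * c" "2 * c \<le> card V"
  proof -
    have YV: "Y \<subseteq> V" "card Y = 2 * c" using yV inj by (auto simp: Y_def card_image)
    then show "card (V - Y) = card V - 2 * c" using gd(1) by (simp add: card_Diff_subset finite_subset)
    show "2 * c \<le> card V" using card_mono[OF gd(1) YV(1)] YV(2) by simp
  qed
  ultimately have cV: "card (f ` V) = card V - 2 * c + 2 * d" "2 * c \<le> card V"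
    using gd(1) by (simp_all add: card_Un_disjoint)
  \<comment> \<open>Wrapping removes at least 4 (c - d) oriented edges and exactly 2 (c - d)
    vertices, so the bound on the Betti number is kept.\<close>
  have "card (?g ` E) + 2 \<le> 2 * card (f ` V) + 2 * k" using cE cV c4 graph(3) by linarith
  then have "card E \<le> card (?g ` E)" using minimal[OF quo] by blast
  then show False using cE c4 d(2) by linarith
qed


section \<open>Degrees and branch vertices\<close>

definition star :: "vert \<Rightarrow> (nat \<times> vert) set" where
  "star x = {(s, y). (x, s, y) \<in> E}"

lemma finite_star: "finite (star x)"
  by (rule finite_subset[of _ "S \<times> V"]) (use gd finite_S in \<open>auto simp: star_def\<close>)

lemma card_star_ge2: assumes "E \<noteq> {}" "x \<in> V" shows "2 \<le> card (star x)"
proof -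
  obtain u s v where usv: "(u, s, v) \<in> E" using assms(1) by (metis ex_in_conv prod_cases3)
  obtain t z where "(x, t, z) \<in> E"
  proof (cases "x = u")
    case False
    have "u \<in> V" using usv gd(3) by blast
    then obtain w where "walk E x w u" using gd(5) assms(2) by blast
    then show ?thesis using that False by (cases w) auto
  qed (use usv that in blast)
  moreover then obtain t' z' where "(x, t', z') \<in> E" "t' \<noteq> t" using two_edges by blast
  ultimately have "{(t, z), (t', z')} \<subseteq> star x" "card {(t, z), (t', z')} = 2" by (auto simp: star_def)
  then show ?thesis using card_mono[OF finite_star] by metis
qed

lemma sum_card_star: "(\<Sum>x\<in>V. card (star x)) = card E"
proof -
  have "E = (SIGMA x:V. star x)" using gd(3) by (auto simp: star_def)
  then show ?thesis using card_SigmaI[OF gd(1), of star] finite_star by simp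
qed

text \<open>The degrees sum to \<open>card E\<close>, which is at most 2 card V + 2 k - 2. Every
  vertex accounts for two by \<open>card_star_ge2\<close>, and a branch vertex for at least one
  more.\<close>

lemma card_branch:
  assumes "E \<noteq> {}" shows "card {x \<in> V. 3 \<le> card (star x)} \<le> 2 * k - 2"
proof -
  let ?B = "{x \<in> V. 3 \<le> card (star x)}"
  have "card ?B + 2 * card V = (\<Sum>x\<in>V. (if 3 \<le> card (star x) then 1 else 0) + 2)"
    unfolding sum.distrib using gd(1) by (simp add: sum.If_cases Int_def id_apply)
  also have "\<dots> \<le> (\<Sum>x\<in>V. card (star x))"
  proof (rule sum_mono)
    fix x assume "x \<in> V"
    then show "(if 3 \<le> card (star x) then 1 else 0) + 2 \<le> card (star x)"
      using card_star_ge2[OF assms \<open>x \<in> V\<close>]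
      by (cases "3 \<le> card (star x)") (simp_all add: numeral_2_eq_2)
  qed
  finally show ?thesis using graph(3) sum_card_star by linarith
qed

lemma star_pair:
  assumes "card (star x) \<le> 2" "(x, s, y) \<in> E" "(x, t, z) \<in> E" "s \<noteq> t" "(x, r, u) \<in> E"
  shows "(r, u) = (s, y) \<or> (r, u) = (t, z)"
proof (rule ccontr)
  assume n: "\<not> ?thesis"
  have "card {(r, u), (s, y), (t, z)} = 3" using n assms(4) by auto
  have "{(r, u), (s, y), (t, z)} \<subseteq> star x" using assms by (auto simp: star_def)
  then have "3 \<le> card (star x)" using card_mono[OF finite_star] \<open>card _ = 3\<close> by metis
  then show False using assms(1) by simp
qed

text \<open>The 2 k - 1 disjoint triples starting at 3 r + 1 cannot all meet a set of 2 k - 2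
  vertices. For N = 2 m - 3 the bound on N is exactly m \<ge> 3 k + 1; it leaves room for a further
  vertex after the last triple, which ends at 6 k - 3.\<close>

lemma pigeonhole_triple:
  fixes p :: "nat \<Rightarrow> 'c"
  assumes inj: "inj_on p {..N}" and B: "finite B" "card B \<le> 2 * k - 2" and N: "6 * k \<le> N + 1"
  obtains i where "i + 4 \<le> N" "p (i + 1) \<notin> B" "p (i + 2) \<notin> B" "p (i + 3) \<notin> B"
proof (rule ccontr)
  assume nt: "\<not> thesis"
  note thesisI = that
  have H: "\<exists>j\<in>{3 * r + 1, 3 * r + 2, 3 * r + 3}. p j \<in> B" if r: "r < 2 * k - 1" for r
  proof (rule ccontr)
    assume n: "\<not> (\<exists>j\<in>{3 * r + 1, 3 * r + 2, 3 * r + 3}. p j \<in> B)"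
    have thesis by (rule thesisI[of "3 * r"]) (use n N r in auto)
    then show False using nt by contradiction
  qed
  then obtain j where j: "\<And>r. r < 2 * k - 1 \<Longrightarrow> j r \<in> {3 * r + 1, 3 * r + 2, 3 * r + 3} \<and> p (j r) \<in> B" by metis
  have "inj_on (\<lambda>r. p (j r)) {..<2 * k - 1}"
  proof (rule inj_onI)
    fix r r' assume r: "r \<in> {..<2 * k - 1}" "r' \<in> {..<2 * k - 1}" "p (j r) = p (j r')"
    have "j r \<le> N" "j r' \<le> N" using j[of r] j[of r'] r N by auto
    then have "j r = j r'" using inj_onD[OF inj r(3)] by simp
    then show "r = r'" using j[of r] j[of r'] r by auto
  qed
  moreover have "(\<lambda>r. p (j r)) ` {..<2 * k - 1} \<subseteq> B" using j by auto
  ultimately have "card {..<2 * k - 1} \<le> card B" using card_inj_on_le B(1) by blast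
  then show False using B(2) k_pos by simp
qed

text \<open>Such a path has at least \<open>6 k - 1\<close> edges and meets at most \<open>2 k - 2\<close> branch vertices, so
  it contains four consecutive edges whose three inner vertices have degree two. Replacing them by an
  arc of length three, labelled with the rest of the relator, from one end of the path to the other
  would give a smaller graph.\<close>

lemma no_long_alt_path:
  assumes ab: "a \<in> S" "b \<in> S" "a \<noteq> b" and q: "m a b = enat q"
    and p: "\<And>i. i < 2 * q - 3 \<Longrightarrow> (p i, if even i then a else b, p (Suc i)) \<in> E"
    and inj: "inj_on p {..2 * q - 3}"
  shows False
proof -
  define N where "N = 2 * q - 3"
  define l where "l i = (if even i then a else b)" for i :: nat
  have pE: "(p i, l i, p (Suc i)) \<in> E" if "i < N" for i using p that by (simp add: N_def l_def)
  have pinj: "p i = p j \<longleftrightarrow> i = j" if "i \<le> N" "j \<le> N" for i j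
    using inj_onD[OF inj] that by (auto simp: N_def)
  have q4: "4 \<le> q" using kap_finite(2)[OF ab q] .
  have q3: "3 * k + 1 \<le> q" using m_ge[OF ab] q by simp
  have N: "6 * k \<le> N + 1" "5 \<le> N" "odd N" using q3 q4 by (auto simp: N_def)
  have pV: "p i \<in> V" if "i \<le> N" for i
    using pE[of i] pE[of "i - 1"] that N gd(3) by (cases "i = N") auto
  have lS: "l i \<in> S" for i using ab by (simp add: l_def)
  have Ene: "E \<noteq> {}" using pE[of 0] N by auto
  let ?B = "{x \<in> V. 3 \<le> card (star x)}"
  obtain i where i: "i + 4 \<le> N" "p (i + 1) \<notin> ?B" "p (i + 2) \<notin> ?B" "p (i + 3) \<notin> ?B"
    using pigeonhole_triple[of p N ?B] inj card_branch[OF Ene] gd(1) N by (auto simp: N_def)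
  define I where "I = {p (i + 1), p (i + 2), p (i + 3)}"
  define fw where "fw j = (p j, l j, p (Suc j))" for j
  define bw where "bw j = (p (Suc j), l j, p j)" for j
  define R where "R = fw ` {i..<i+4} \<union> bw ` {i..<i+4}"
  have IV: "I \<subseteq> V" using pV i(1) by (auto simp: I_def)
  have fR: "fw j \<in> R" "bw j \<in> R" if "i \<le> j" "j < i + 4" for j using that by (auto simp: R_def)
  have RE: "R \<subseteq> E" using pE edge_symD[OF gd(4)] i(1) by (auto simp: R_def fw_def bw_def)
  have cR: "card R = 8"
  proof -
    have "inj_on fw {i..<i+4}" "inj_on bw {i..<i+4}"
      using pinj i(1) by (auto simp: inj_on_def fw_def bw_def)
    moreover have "fw ` {i..<i+4} \<inter> bw ` {i..<i+4} = {}"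
      using pinj i(1) by (auto simp: fw_def bw_def)
    ultimately show ?thesis by (simp add: R_def card_Un_disjoint card_image)
  qed
  \<comment> \<open>The three inner vertices have degree two and already meet two edges of R each,
    so no other edge is lost when they are deleted.\<close>
  have inR: "(x, s, y) \<in> R" if xsy: "(x, s, y) \<in> E" "x \<in> I" for x s y
  proof -
    have "{i..<i + 3} = {i, i + 1, i + 2}" by auto
    then have "I = (\<lambda>j. p (Suc j)) ` {i..<i + 3}" by (simp add: I_def numeral_3_eq_3)
    then obtain j where j: "x = p (Suc j)" "i \<le> j" "j < i + 3" using xsy(2) by auto
    have "Suc j = i + 1 \<or> Suc j = i + 2 \<or> Suc j = i + 3" using j by arith
    then have "p (Suc j) \<notin> ?B" using i by metis
    moreover have "p (Suc j) \<in> V" using pV j i(1) by simp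
    ultimately have "card (star (p (Suc j))) \<le> 2" by auto
    moreover have "(p (Suc j), l (Suc j), p (Suc (Suc j))) \<in> E" using pE j i(1) by simp
    moreover have "(p (Suc j), l j, p j) \<in> E" using edge_symD[OF gd(4) pE[of j]] j i(1) by simp
    moreover have "l (Suc j) \<noteq> l j" using ab by (simp add: l_def)
    ultimately have "(s, y) = (l (Suc j), p (Suc (Suc j))) \<or> (s, y) = (l j, p j)"
      using star_pair xsy(1) j(1) by blast
    then have "(x, s, y) = fw (Suc j) \<or> (x, s, y) = bw j" using j(1) by (auto simp: fw_def bw_def)
    then show ?thesis using fR j by auto
  qed
  have symR: "(y, s, x) \<in> R" if "(x, s, y) \<in> R" for x s y
    using that by (auto simp: R_def fw_def bw_def)
  obtain z1 where z1: "z1 \<notin> V" using gd(1) infinite_UNIV_nat ex_new_if_finite by blast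
  obtain z2 where z2: "z2 \<notin> insert z1 V" using gd(1) infinite_UNIV_nat ex_new_if_finite[of "insert z1 V"] by auto
  have z: "z1 \<noteq> z2" "z1 \<notin> V" "z2 \<notin> V" using z1 z2 by auto
  \<comment> \<open>The new arc, labelled b a b, from \<open>p 0\<close> to \<open>p N\<close>
    through two fresh vertices.\<close>
  define A where "A = {(p 0, b, z1), (z1, b, p 0), (z1, a, z2), (z2, a, z1), (z2, b, p N), (p N, b, z2)}"
  define F where "F = (E - R) \<union> A"
  define V' where "V' = (V - I) \<union> {z1, z2}"
  have p0: "p 0 \<in> V - I" "p N \<in> V - I" using pV pinj i(1) by (auto simp: I_def)
  have ER: "E - R \<subseteq> (V - I) \<times> S \<times> (V - I)"
  proof
    fix e assume e: "e \<in> E - R"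
    obtain x s y where xsy: "e = (x, s, y)" by (cases e)
    have "x \<notin> I" using inR e xsy by blast
    moreover have "y \<notin> I"
    proof
      assume "y \<in> I"
      then have "(y, s, x) \<in> R" using inR edge_symD[OF gd(4)] e xsy by blast
      then show False using symR e xsy by blast
    qed
    ultimately show "e \<in> (V - I) \<times> S \<times> (V - I)" using e xsy gd(3) by auto
  qed
  have F: "F \<subseteq> V' \<times> S \<times> V'" using ER p0 ab by (auto simp: F_def V'_def A_def)
  have symF: "edge_sym F"
    unfolding edge_sym_def
  proof (intro allI impI)
    fix x s y assume "(x, s, y) \<in> F"
    then consider "(x, s, y) \<in> E" "(x, s, y) \<notin> R" | "(x, s, y) \<in> A" by (auto simp: F_def)
    then show "(y, s, x) \<in> F"
    proof cases
      case 1
      then show ?thesis using edge_symD[OF gd(4)] symR F_def by blast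
    next
      case 2
      then have "(y, s, x) \<in> A" unfolding A_def by (elim insertE emptyE) simp_all
      then show ?thesis by (simp add: F_def)
    qed
  qed
  have arc: "walk F (p 0) [b, a, b] (p N)" by (auto simp: F_def A_def)
  have w: "walk E (p n) (alt (l n) (l (Suc n)) j) (p (n + j))" if "n + j \<le> N" for n j
  proof -
    have "walk E (p n) (alt (l n) (l (Suc n)) j) (p (n + length (alt (l n) (l (Suc n)) j)))"
    proof (rule walk_segment)
      fix r assume r: "n \<le> r" "r < n + length (alt (l n) (l (Suc n)) j)"
      then have "alt (l n) (l (Suc n)) j ! (r - n) = l r" by (subst nth_alt) (auto simp: l_def)
      then show "(p r, alt (l n) (l (Suc n)) j ! (r - n), p (Suc r)) \<in> E" using pE r that by simp
    qed
    then show ?thesis by simp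
  qed
  have wF: "walk F (p n) (alt (l n) (l (Suc n)) j) (p (n + j))"
    if "n + j \<le> N" "n + j \<le> i \<or> i + 4 \<le> n" for n j
  proof -
    have "walk F (p n) (alt (l n) (l (Suc n)) j) (p (n + length (alt (l n) (l (Suc n)) j)))"
    proof (rule walk_segment)
      fix r assume r: "n \<le> r" "r < n + length (alt (l n) (l (Suc n)) j)"
      then have rN: "r < N" "r < i \<or> i + 4 \<le> r" using that by auto
      have "fw r \<notin> R"
      proof
        assume "fw r \<in> R"
        then obtain s where s: "i \<le> s" "s < i + 4" "fw r = fw s \<or> fw r = bw s" by (auto simp: R_def)
        then show False using rN pinj i(1) by (auto simp: fw_def bw_def)
      qed
      then have "(p r, l r, p (Suc r)) \<in> F" using pE[OF rN(1)] by (simp add: F_def fw_def)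
      moreover have "alt (l n) (l (Suc n)) j ! (r - n) = l r" using r by (subst nth_alt) (auto simp: l_def)
      ultimately show "(p r, alt (l n) (l (Suc n)) j ! (r - n), p (Suc r)) \<in> F" by simp
    qed
    then show ?thesis by simp
  qed
  have l01: "l 0 = a" "l (Suc 0) = b" by (auto simp: l_def)
  \<comment> \<open>N is odd, so the rest of the relator reads b a b, which is its own
    reverse.\<close>
  have val_compl: "val (alt a b N) = val [b, a, b]"
  proof -
    have "2 * q = N + 3" using q4 by (simp add: N_def)
    then have "alt a b (2 * q) = alt a b N @ alt b a 3" using alt_add[of a b N 3] N(3) by simp
    then have "val (alt a b N) \<circ> val (alt b a 3) = id"
      using val_alt_relator[OF ab q] by (simp add: val_append)
    then have "val (alt a b N) \<circ> (val (alt b a 3) \<circ> val (rev (alt b a 3))) = val (rev (alt b a 3))"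
      by (metis comp_assoc id_comp)
    then show ?thesis
      using val_rev_right[OF alt_in_lists[OF ab(2,1), of 3]] by (simp add: numeral_3_eq_3)
  qed
  define AA where "AA = alt (l 0) (l (Suc 0)) i"
  define BB where "BB = alt (l i) (l (Suc i)) 4"
  define CC where "CC = alt (l (i + 4)) (l (Suc (i + 4))) (N - (i + 4))"
  have split: "alt a b N = AA @ BB @ CC"
  proof -
    have "alt a b N = alt a b (i + (4 + (N - (i + 4))))" using i(1) by simp
    also have "\<dots> = AA @ BB @ CC"
      unfolding alt_add AA_def BB_def CC_def by (simp add: l_def)
    finally show ?thesis .
  qed
  have ABC: "AA \<in> lists S" "BB \<in> lists S" "CC \<in> lists S"
    using lS by (auto simp: AA_def BB_def CC_def intro!: alt_in_lists simp del: alt.simps)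
  \<comment> \<open>Inner vertices retract to \<open>p i\<close>, and t records the label of the
    deleted path from there. Thus only the last of the four deleted edges needs a detour in the new
    graph.\<close>
  define f where "f u = (if u \<in> I then p i else u)" for u
  define t where "t u = (if u = p (i + 1) then [l i] else if u = p (i + 2) then [l i, l (i + 1)]
    else if u = p (i + 3) then [l i, l (i + 1), l (i + 2)] else [])" for u
  have fp: "f (p i) = p i" "f (p (i + 1)) = p i" "f (p (i + 2)) = p i" "f (p (i + 3)) = p i" "f (p (i + 4)) = p (i + 4)"
    using pinj i(1) by (auto simp: f_def I_def)
  have tp: "t (p i) = []" "t (p (i + 1)) = [l i]" "t (p (i + 2)) = [l i, l (i + 1)]"
    "t (p (i + 3)) = [l i, l (i + 1), l (i + 2)]" "t (p (i + 4)) = []"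
    using pinj i(1) by (auto simp: t_def)
  have ft: "f u = u" "t u = []" if "u \<notin> I" for u using that by (auto simp: f_def t_def I_def)
  \<comment> \<open>The detour goes back to \<open>p 0\<close>, across the new arc, and backwards
    from \<open>p N\<close> to \<open>p (i + 4)\<close>.\<close>
  have bypass: "walk F (p i) (rev AA @ [b, a, b] @ rev CC) (p (i + 4))"
    "val (rev AA @ [b, a, b] @ rev CC) = val BB"
  proof -
    have "walk F (p 0) AA (p i)" using wF[of 0 i] i(1) by (simp add: AA_def)
    moreover have "walk F (p (i + 4)) CC (p N)" using wF[of "i + 4" "N - (i + 4)"] i(1) by (simp add: CC_def)
    ultimately show "walk F (p i) (rev AA @ [b, a, b] @ rev CC) (p (i + 4))"
      using walk_rev[OF symF] arc unfolding walk_append by blast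
    have "val (rev AA @ [b, a, b] @ rev CC) = val (rev AA @ AA @ BB @ CC @ rev CC)"
      using val_compl unfolding split val_append comp_assoc by (metis comp_assoc)
    also have "\<dots> = val BB"
      using val_cancel(2)[OF ABC(1), of "[]" "BB @ CC @ rev CC"] val_cancel(1)[OF ABC(3), of BB "[]"] by simp
    finally show "val (rev AA @ [b, a, b] @ rev CC) = val BB" .
  qed
  have s1: "simulates E F f t"
  proof (rule simulatesI[OF _ symF F gd(3)])
    show "t u \<in> lists S" for u using lS by (simp add: t_def)
    fix x s y assume e: "(x, s, y) \<in> E"
    let ?P = "\<lambda>x s y. \<exists>w. walk F (f x) w (f y) \<and> val w = val (t x @ [s] @ rev (t y))"
    show "?P x s y \<or> ?P y s x"
    proof (cases "(x, s, y) \<in> R")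
      case False
      then have "x \<notin> I" "y \<notin> I" using ER e by auto
      then have "walk F (f x) [s] (f y) \<and> val [s] = val (t x @ [s] @ rev (t y))"
        using e False by (simp add: ft F_def)
      then show ?thesis by blast
    next
      case True
      have step: "?P (p j) (l j) (p (Suc j))" if ij: "i \<le> j" "j < i + 4" for j
      proof -
        consider "j = i" | "j = i + 1" | "j = i + 2" | "j = i + 3" using ij by arith
        then show ?thesis
        proof cases
          case 1
          then show ?thesis using fp tp lS by (intro exI[of _ "[]"]) simp
        next
          case 2
          have "val ([l i] @ [l (i + 1)] @ rev [l i, l (i + 1)]) = val []"
            using val_cancel(1)[of "[l i, l (i + 1)]" "[]" "[]"] lS by simp
          then show ?thesis using 2 fp tp by (intro exI[of _ "[]"]) simp
        next
          case 3
          have "val ([l i, l (i + 1)] @ [l (i + 2)] @ rev [l i, l (i + 1), l (i + 2)]) = val []"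
            using val_cancel(1)[of "[l i, l (i + 1), l (i + 2)]" "[]" "[]"] lS by simp
          then show ?thesis using 3 fp tp by (intro exI[of _ "[]"]) (simp add: numeral_3_eq_3)
        next
          case 4
          have "BB = [l i, l (i + 1), l (i + 2)] @ [l (i + 3)]"
          proof -
            have "BB = [l i, l (Suc i), l i, l (Suc i)]" by (simp add: BB_def numeral_eq_Suc)
            moreover have "l (i + 2) = l i" "l (i + 3) = l (Suc i)" by (simp_all add: l_def)
            ultimately show ?thesis by simp
          qed
          then have "val (rev AA @ [b, a, b] @ rev CC) = val (t (p j) @ [l j] @ rev (t (p (Suc j))))"
            using bypass(2) tp 4 by (simp add: numeral_eq_Suc)
          moreover have "walk F (f (p j)) (rev AA @ [b, a, b] @ rev CC) (f (p (Suc j)))"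
            using bypass(1) fp 4 by (simp add: numeral_eq_Suc)
          ultimately show ?thesis by blast
        qed
      qed
      obtain j where j: "i \<le> j" "j < i + 4" "(x, s, y) = fw j \<or> (x, s, y) = bw j"
        using True unfolding R_def by auto
      then show ?thesis using step[OF j(1,2)] by (auto simp: fw_def bw_def)
    qed
  qed
  define f' where "f' u = (if u \<in> {z1, z2} then p 0 else u)" for u
  define t' where "t' u = (if u = z1 then [b] else if u = z2 then [b, a] else [])" for u
  have s2: "simulates F E f' t'"
  proof (rule simulatesI[OF _ gd(4,3) F])
    show "t' u \<in> lists S" for u using ab by (simp add: t'_def)
    fix x s y assume e: "(x, s, y) \<in> F"
    let ?P = "\<lambda>x s y. \<exists>w. walk E (f' x) w (f' y) \<and> val w = val (t' x @ [s] @ rev (t' y))"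
    have nz: "u \<notin> {z1, z2}" if "u \<in> V" for u using that z by auto
    show "?P x s y \<or> ?P y s x"
    proof (cases "(x, s, y) \<in> A")
      case False
      then have "(x, s, y) \<in> E" using e by (simp add: F_def)
      moreover from this have "x \<notin> {z1, z2}" "y \<notin> {z1, z2}" using nz gd(3) by auto
      ultimately have "walk E (f' x) [s] (f' y) \<and> val [s] = val (t' x @ [s] @ rev (t' y))"
        by (simp add: f'_def t'_def)
      then show ?thesis by blast
    next
      case True
      have p0': "p 0 \<notin> {z1, z2}" "p N \<notin> {z1, z2}" using nz p0 by auto
      have f0: "f' (p 0) = p 0" "f' (p N) = p N" "f' z1 = p 0" "f' z2 = p 0"
        "t' (p 0) = []" "t' (p N) = []" "t' z1 = [b]" "t' z2 = [b, a]"
        using p0' z by (auto simp: f'_def t'_def)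
      have 1: "?P (p 0) b z1" using f0 ab by (intro exI[of _ "[]"]) simp
      have 2: "?P z1 a z2" 
      proof -
        have "val ([b] @ [a] @ rev [b, a]) = val []" using val_cancel(1)[of "[b, a]" "[]" "[]"] ab by simp
        then show ?thesis using f0 by (intro exI[of _ "[]"]) simp
      qed
      have 3: "?P z2 b (p N)"
        using w[of 0 N] f0 val_compl by (intro exI[of _ "alt a b N"]) (simp add: l01)
      show ?thesis using True 1 2 3 unfolding A_def by blast
    qed
  qed
  have v: "p 0 \<in> V" "p 0 \<in> V'" "f (p 0) = p 0" "t (p 0) = []" "f' (p 0) = p 0" "t' (p 0) = []"
    using p0 z ft by (auto simp: V'_def f'_def t'_def)
  have rep: "represents V' F K"
    by (rule represents_transfer[OF graph(1,2) v(1,2) F s1 v(3,4) s2 v(5,6)])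
  have lg: "lgraph V' F"
  proof (rule lgraphI[OF _ v(2) F symF])
    show "finite V'" using gd(1) by (simp add: V'_def)
    fix u assume "u \<in> V'"
    then consider "u \<in> V" "u \<notin> I" | "u = z1" | "u = z2" by (auto simp: V'_def)
    then show "\<exists>w. walk F (p 0) w u"
    proof cases
      case 1
      obtain w where "walk E (p 0) w u" using gd(5)[OF v(1) 1(1)] by blast
      from simulates_walk[OF s1 gd(3) this] show ?thesis using v(3) ft[OF 1(2)] by auto
    next
      case 2
      then have "walk F (p 0) [b] u" by (simp add: F_def A_def)
      then show ?thesis by blast
    next
      case 3
      then have "walk F (p 0) [b, a] u" by (auto simp: F_def A_def)
      then show ?thesis by blast
    qed
  qed
  have cI: "card I = 3" using pinj i(1) by (auto simp: I_def)
  have "card V' = card (V - I) + card {z1, z2}"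
    unfolding V'_def using gd(1) z by (intro card_Un_disjoint) auto
  moreover have "card (V - I) = card V - 3" using IV cI gd(1) by (simp add: card_Diff_subset finite_subset)
  moreover have "3 \<le> card V" using card_mono[OF gd(1) IV] cI by simp
  moreover have "card {z1, z2} = 2" using z by simp
  moreover have "card F \<le> card (E - R) + card A" unfolding F_def by (rule card_Un_le)
  moreover have "card (E - R) = card E - 8" using RE cR finE by (simp add: card_Diff_subset finite_subset)
  moreover have "8 \<le> card E" using card_mono[OF finE RE] cR by simp
  moreover have "card A \<le> 6"
    using card_length[of "[(p 0, b, z1), (z1, b, p 0), (z1, a, z2), (z2, a, z1), (z2, b, p N), (p N, b, z2)]"]
    by (simp add: A_def)
  \<comment> \<open>Eight oriented edges and three vertices leave, at most six oriented edges and
    exactly two vertices enter: fewer edges within the same bound on the Betti number.\<close>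
  ultimately have "card F + 2 \<le> 2 * card V' + 2 * k" "card F < card E" using graph(3) by linarith+
  then show False using minimal[OF lg rep] by simp
qed


section \<open>Long alternating subwords of labels of walks\<close>

lemma long_alt_walk_cycle:
  assumes ab: "a \<in> S" "b \<in> S" "a \<noteq> b" and q: "m a b = enat q"
    and w: "walk E x (alt a b (2 * q - 3)) y"
  obtains c where "1 \<le> c" "2 * c \<le> 2 * q - 3" "walk E x (alt a b (2 * c)) x"
proof -
  obtain p where p: "p 0 = x" "p (2 * q - 3) = y"
    "\<forall>i<2 * q - 3. (p i, alt a b (2 * q - 3) ! i, p (Suc i)) \<in> E"
    using walk_vertices[OF w] by auto
  have pE: "(p i, if even i then a else b, p (Suc i)) \<in> E" if "i < 2 * q - 3" for i
    using p(3) that nth_alt[OF that, of a b] by metis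
  have "\<not> inj_on p {..2 * q - 3}" using no_long_alt_path[of a b q p] ab q pE by blast
  then obtain i j where "i < j" "j \<le> 2 * q - 3" "p i = p j"
    unfolding inj_on_def by (metis atMost_iff linorder_neqE_nat)
  then obtain c where c: "1 \<le> c" "2 * c \<le> 2 * q - 3" "p (2 * c) = p 0"
    using alt_closed_walk[of "2 * q - 3" p a b i j] pE
    by (metis (no_types, lifting) diff_le_self order.trans)
  have "walk E (p 0) (alt a b (2 * c)) (p (2 * c))" by (rule walk_alt) (use pE c(2) in simp)
  then show ?thesis using that[OF c(1,2)] c(3) p(1) by simp
qed

text \<open>Up to q letters the length is exact. Beyond that, fewer than q remaining letters would
  have to undo an element of length q.\<close>

lemma val_alt_neq_id:
  assumes ab: "a \<in> S" "b \<in> S" "a \<noteq> b" and q: "m a b = enat q" and n: "0 < n" "n < 2 * q"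
  shows "val (alt a b n) \<noteq> id"
proof
  assume e: "val (alt a b n) = id"
  have len: "len (val (alt a b i)) = i" if "i \<le> q" for i
    using len_dihedral[OF id_in_W ab, of i] not_desc_id ab q that by simp
  show False
  proof (cases "n \<le> q")
    case True
    then show False using len[OF True] e n(1) by simp
  next
    case False
    define r where "r = n - q"
    have r: "n = q + r" "r < q" using False n by (auto simp: r_def)
    define v where "v = (if even q then alt a b r else alt b a r)"
    have v: "v \<in> lists S" "length v = r" using alt_in_lists ab by (auto simp: v_def)
    have "val (alt a b q) \<circ> val v = id"
      using e unfolding r alt_add v_def by (simp add: val_append)
    then have "val (alt a b q) \<circ> (val v \<circ> val (rev v)) = val (rev v)" by (metis comp_assoc id_comp)
    then have "val (alt a b q) = val (rev v)" using val_rev_right[OF v(1)] by simp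
    then have "q \<le> r" using len[of q] len_val_le[of "rev v"] v by simp
    then show False using r(2) by simp
  qed
qed

text \<open>A long alternating subword would start on a cycle labelled by a power of the rotation a
  b with exponent positive and below q. Then K would contain a conjugate of it, a nontrivial element
  of finite order.\<close>

lemma closed_walk_good_of_torsion_free:
  assumes tf: "\<And>w n. w \<in> lists S \<Longrightarrow> val w \<in> K \<Longrightarrow> 0 < n \<Longrightarrow> val (concat (replicate n w)) = id \<Longrightarrow> val w = id"
    and w: "walk E x w y" "x \<in> V" and nd: "\<And>u a v. w \<noteq> u @ [a, a] @ v"
  shows "good w"
  unfolding good_def
proof (intro conjI allI impI)
  show "w \<in> lists S" using walk_labels[OF w(1) gd(3)] .
  show "w \<noteq> u @ [a, a] @ v" for u a v by (rule nd)
  fix u a b q v assume ab: "a \<in> S" "b \<in> S" "a \<noteq> b" and q: "m a b = enat q"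
  show "w \<noteq> u @ alt a b (2 * q - 3) @ v"
  proof
    assume "w = u @ alt a b (2 * q - 3) @ v"
    then obtain x1 x2 where x: "walk E x u x1" "walk E x1 (alt a b (2 * q - 3)) x2"
      using w(1) by (auto simp: walk_append)
    obtain c where c: "1 \<le> c" "2 * c \<le> 2 * q - 3" "walk E x1 (alt a b (2 * c)) x1"
      using long_alt_walk_cycle[OF ab q x(2)] .
    have q4: "4 \<le> q" using kap_finite(2)[OF ab q] .
    have x1: "x1 \<in> V" using walk_end[OF x(1) gd(3) w(2)] .
    obtain d where d: "d \<in> lists S" "K = {val (d @ w @ rev d) |w. walk E x1 w x1}"
      using represents_at[OF graph(1,2) x1] .
    let ?w = "alt a b (2 * c)"
    have wS: "?w \<in> lists S" using ab by (simp add: alt_in_lists)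
    have K: "val (d @ ?w @ rev d) \<in> K" using d(2) c(3) by blast
    have rep: "val (concat (replicate n (d @ ?w @ rev d))) = val (d @ concat (replicate n ?w) @ rev d)" for n
    proof (induction n)
      case 0
      then show ?case using val_cancel(1)[OF d(1), of "[]" "[]"] by simp
    next
      case (Suc n)
      have "val (concat (replicate (Suc n) (d @ ?w @ rev d)))
        = val (d @ ?w @ rev d @ d @ concat (replicate n ?w) @ rev d)"
        using Suc by (simp add: val_append comp_assoc)
      then show ?case
        using val_cancel(2)[OF d(1), of "d @ ?w" "concat (replicate n ?w) @ rev d"] by simp
    qed
    have cc: "concat (replicate n ?w) = alt a b (2 * c * n)" for n
    proof (induction n)
      case (Suc n)
      then show ?case using alt_add[of a b "2 * c" "2 * c * n"] by (simp add: algebra_simps)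
    qed simp
    have "concat (replicate q ?w) = alt a b (2 * q * c)"
      unfolding cc by (simp add: mult.commute mult.left_commute)
    then have "val (concat (replicate q ?w)) = id" using val_alt_multiple[OF ab q] by simp
    then have "val (concat (replicate q (d @ ?w @ rev d))) = id"
      unfolding rep using val_cancel(1)[OF d(1), of "[]" "[]"] by (simp add: val_append)
    then have e: "val (d @ ?w @ rev d) = id" using tf[OF _ K, of q] q4 d(1) wS by simp
    have "val ?w = val (rev d @ (d @ ?w @ rev d) @ d)"
      using val_cancel(2)[OF d(1), of "[]" "?w @ rev d @ d"] val_cancel(2)[OF d(1), of ?w "[]"] by simp
    also have "\<dots> = val (rev d @ d)" using e by (simp add: val_append[of "rev d"] val_append[of _ d] del: append_assoc)
    also have "\<dots> = id" using val_cancel(2)[OF d(1), of "[]" "[]"] by simp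
    finally show False using val_alt_neq_id[OF ab q, of "2 * c"] c q4 by simp
  qed
qed

lemma shortest_walk_good:
  assumes w: "walk E x w y" "x \<in> V" and short: "\<And>v. walk E x v y \<Longrightarrow> val v = val w \<Longrightarrow> length w \<le> length v"
  shows "good w"
  unfolding good_def
proof (intro conjI allI impI)
  show "w \<in> lists S" using walk_labels[OF w(1) gd(3)] .
  show "w \<noteq> u @ [a, a] @ v" for u a v
  proof
    assume wu: "w = u @ [a, a] @ v"
    then obtain x1 x2 x3 where x: "walk E x u x1" "(x1, a, x2) \<in> E" "(x2, a, x3) \<in> E" "walk E x3 v y"
      using w(1) by (auto simp: walk_append)
    have "x3 = x1" using folded[OF edge_symD[OF gd(4) x(2)] x(3)] by simp
    then have "walk E x (u @ v) y" using x by (auto simp: walk_append)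
    moreover have "a \<in> S" using x(2) gd(3) by auto
    then have "val (u @ v) = val w" unfolding wu using val_cancel(1)[of "[a]" u v] by simp
    ultimately show False using short[of "u @ v"] wu by simp
  qed
  fix u a b q v assume ab: "a \<in> S" "b \<in> S" "a \<noteq> b" and q: "m a b = enat q"
  show "w \<noteq> u @ alt a b (2 * q - 3) @ v"
  proof
    assume wu: "w = u @ alt a b (2 * q - 3) @ v"
    then obtain x1 x2 where x: "walk E x u x1" "walk E x1 (alt a b (2 * q - 3)) x2" "walk E x2 v y"
      using w(1) by (auto simp: walk_append)
    have q4: "4 \<le> q" using kap_finite(2)[OF ab q] .
    have ba: "m b a = enat q" using q m_sym by simp
    have ex: "\<exists>c. 1 \<le> c \<and> walk E x1 (alt a b (2 * c)) x1"
      using long_alt_walk_cycle[OF ab q x(2)] by metis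
    \<comment> \<open>The least cycle visits no vertex twice, as \<open>alt_cycle_dvd\<close>
      requires: by \<open>alt_closed_walk\<close> a repetition would close up at x1 even
      earlier.\<close>
    define c where "c = (LEAST c. 1 \<le> c \<and> walk E x1 (alt a b (2 * c)) x1)"
    have c: "1 \<le> c" "walk E x1 (alt a b (2 * c)) x1"
      using LeastI_ex[OF ex] by (auto simp: c_def)
    have cmin: "c \<le> c'" if "1 \<le> c'" "walk E x1 (alt a b (2 * c')) x1" for c'
      unfolding c_def using that by (intro Least_le) simp
    obtain p where p: "p 0 = x1" "p (2 * c) = x1"
      "\<forall>i<2 * c. (p i, alt a b (2 * c) ! i, p (Suc i)) \<in> E"
      using walk_vertices[OF c(2)] by auto
    have pE: "(p i, if even i then a else b, p (Suc i)) \<in> E" if "i < 2 * c" for i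
      using p(3) that nth_alt[OF that, of a b] by metis
    define z where "z i = p (i mod (2 * c))" for i
    have zE: "(z i, if even i then a else b, z (Suc i)) \<in> E" for i
    proof -
      have i: "i mod (2 * c) < 2 * c" using c(1) by simp
      have "z (Suc i) = p (Suc (i mod (2 * c)))"
        using p(1,2) by (simp add: z_def mod_Suc)
      moreover have "even (i mod (2 * c)) = even i" by (simp add: dvd_mod_iff)
      ultimately show ?thesis using pE[OF i] by (simp add: z_def)
    qed
    have zper: "z (i + 2 * c) = z i" for i by (simp add: z_def)
    have zseg: "walk E (z 0) (alt a b l) (z l)" for l by (rule walk_alt) (rule zE)
    have z0: "z 0 = x1" using p(1) by (simp add: z_def)
    have inj: "inj_on z {..<2 * c}"
    proof (rule ccontr)
      assume "\<not> ?thesis"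
      then obtain i j where ij: "i < j" "j < 2 * c" "z i = z j"
        unfolding inj_on_def by (metis lessThan_iff linorder_neqE_nat)
      obtain c' where c': "1 \<le> c'" "2 * c' = j - i" "z (2 * c') = z 0"
        using alt_closed_walk[of "2 * c" z a b i j] zE ij by auto
      then have "walk E x1 (alt a b (2 * c')) x1" using zseg[of "2 * c'"] z0 by simp
      then show False using cmin[OF c'(1)] c'(2) ij by linarith
    qed
    have "c dvd q" using alt_cycle_dvd[of a b q c z] ab q c(1) zE zper inj by blast
    then obtain n where n: "q = c * n" by (elim dvdE)
    have "z (2 * c * n) = z 0" by (simp add: z_def)
    then have zq: "z (2 * q) = x1" using n z0 by (simp add: mult.assoc)
    define N where "N = 2 * q - 3"
    have N: "2 * q = N + 3" "odd N" using q4 by (auto simp: N_def)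
    have det: "y1 = y2" if "walk E x0 l y1" "walk E x0 l y2" for x0 l y1 y2
      using that
    proof (induction l arbitrary: x0)
      case (Cons s l)
      then obtain t1 t2 where t: "(x0, s, t1) \<in> E" "walk E t1 l y1" "(x0, s, t2) \<in> E" "walk E t2 l y2" by auto
      show ?case using Cons.IH[OF t(2)] t(4) folded[OF t(1,3)] by simp
    qed simp
    have x2: "x2 = z N" using det[OF x(2)] zseg[of N] z0 by (simp add: N_def)
    have "walk E x1 (alt a b N @ alt b a 3) x1"
      using zseg[of "2 * q"] zq z0 alt_add[of a b N 3] N by simp
    then obtain x2' where "walk E x1 (alt a b N) x2'" "walk E x2' (alt b a 3) x1" by (auto simp: walk_append)
    then have "walk E x2 (alt b a 3) x1" using det[OF x(2)] by (simp add: N_def)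
    then have bk: "walk E x1 (rev (alt b a 3)) x2" using walk_rev[OF gd(4)] by blast
    let ?v = "u @ rev (alt b a 3) @ v"
    have "walk E x ?v y" using x(1,3) bk by (auto simp: walk_append)
    moreover have "val ?v = val w"
    proof -
      have "val (alt a b N) \<circ> val (alt b a 3) = id"
        using val_alt_relator[OF ab q] alt_add[of a b N 3] N by (simp add: val_append)
      then have "val (alt a b N) \<circ> (val (alt b a 3) \<circ> val (rev (alt b a 3))) = val (rev (alt b a 3))"
        by (metis comp_assoc id_comp)
      then have "val (alt a b N) = val (rev (alt b a 3))"
        using val_rev_right[OF alt_in_lists[OF ab(2,1), of 3]] by simp
      then show ?thesis unfolding wu by (simp add: val_append N_def)
    qed
    ultimately have "length w \<le> length ?v" using short by blast
    then show False unfolding wu using q4 by simp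
  qed
qed

end

section \<open>Quasiconvexity and free bases\<close>

context coxeter begin

text \<open>Reversing a word over S inverts its value since the generators are involutions, so for
  such U this is the subgroup generated by the values of U.\<close>

definition span :: "nat list set \<Rightarrow> ((nat \<Rightarrow> real) \<Rightarrow> nat \<Rightarrow> real) set" where
  "span U = {val (concat vs) |vs. vs \<in> lists (U \<union> rev ` U)}"

text \<open>Prepares the bouquet, where an empty generator would give a circle without
  edges.\<close>

lemma span_nonempty_words: "span (U - {[]}) = span U"
proof -
  have "span U \<subseteq> span (U - {[]})"
  proof
    fix h assume "h \<in> span U"
    then obtain vs where vs: "vs \<in> lists (U \<union> rev ` U)" "h = val (concat vs)" by (auto simp: span_def)
    have "filter (\<lambda>v. v \<noteq> []) vs \<in> lists ((U - {[]}) \<union> rev ` (U - {[]}))"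
      using vs(1) by (auto simp: in_lists_conv_set)
    moreover have "concat (filter (\<lambda>v. v \<noteq> []) vs) = concat vs" by (induction vs) auto
    ultimately show "h \<in> span (U - {[]})" using vs(2) unfolding span_def by (metis (mono_tags, lifting) mem_Collect_eq)
  qed
  moreover have "span (U - {[]}) \<subseteq> span U"
    unfolding span_def using lists_mono[of "(U - {[]}) \<union> rev ` (U - {[]})" "U \<union> rev ` U"] by blast
  ultimately show ?thesis by blast
qed

text \<open>A bouquet of subdivided circles, one for each generator; \<open>0\<close> is the base point.\<close>

lemma bouquet:
  assumes us: "set us \<subseteq> lists S" "[] \<notin> set us"
  shows "\<exists>V E. lgraph V E \<and> represents V E (span (set us)) \<and> card E + 2 \<le> 2 * card V + 2 * length us"
proof -
  define r where "r = length us"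
  define n where "n i = length (us ! i)" for i
  \<comment> \<open>Both ends of every circle are the vertex 0. Inner vertices are numbered by a
    pairing function, shifted to avoid 0.\<close>
  define z where "z i p = (if p = 0 \<or> p = n i then 0 else Suc (prod_encode (i, p)))" for i p
  define P where "P = (SIGMA i:{..<r}. {..<n i})"
  define fw where "fw = (\<lambda>(i, p). (z i p, us ! i ! p, z i (Suc p)))"
  define bw where "bw = (\<lambda>(i, p). (z i (Suc p), us ! i ! p, z i p))"
  define E where "E = fw ` P \<union> bw ` P"
  define V where "V = insert 0 ((\<lambda>x. Suc (prod_encode x)) ` (SIGMA i:{..<r}. {1..<n i}))"
  have n1: "1 \<le> n i" if "i < r" for i
  proof -
    have "us ! i \<in> set us" using that by (simp add: r_def)
    then have "us ! i \<noteq> []" using us(2) by metis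
    then show ?thesis by (simp add: n_def Suc_le_eq)
  qed
  have uS: "us ! i \<in> lists S" if "i < r" for i using us(1) that by (auto simp: r_def)
  have lS: "us ! i ! p \<in> S" if "(i, p) \<in> P" for i p
    using uS[of i] that by (auto simp: P_def n_def in_lists_conv_set)
  have zV: "z i p \<in> V" if "i < r" "p \<le> n i" for i p
    using that by (auto simp: z_def V_def)
  have E: "E \<subseteq> V \<times> S \<times> V"
    using zV lS by (auto simp: E_def fw_def bw_def P_def)
  have symE: "edge_sym E"
    unfolding edge_sym_def
  proof (intro allI impI)
    fix x s y assume "(x, s, y) \<in> E"
    then obtain i p where ip: "(i, p) \<in> P" "(x, s, y) = fw (i, p) \<or> (x, s, y) = bw (i, p)"
      unfolding E_def by auto
    from ip(2) have "(y, s, x) = bw (i, p) \<or> (y, s, x) = fw (i, p)" by (auto simp: fw_def bw_def)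
    then show "(y, s, x) \<in> E" using ip(1) unfolding E_def by blast
  qed
  have finP: "finite P" by (simp add: P_def)
  have seg: "walk E 0 (take p (us ! i)) (z i p)" "walk E (z i p) (drop p (us ! i)) 0"
    if i: "i < r" "p \<le> n i" for i p
  proof -
    have e: "(z i j, us ! i ! j, z i (Suc j)) \<in> E" if "j < n i" for j
      using that i(1) by (force simp: E_def fw_def P_def)
    have "length (take p (us ! i)) = p" "z i 0 = 0" using i(2) by (auto simp: n_def z_def)
    moreover have "walk E (z i 0) (take p (us ! i)) (z i (0 + length (take p (us ! i))))"
      by (rule walk_segment) (use e i in \<open>auto simp: n_def\<close>)
    ultimately show "walk E 0 (take p (us ! i)) (z i p)" by simp
    have "walk E (z i p) (drop p (us ! i)) (z i (p + length (drop p (us ! i))))"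
      by (rule walk_segment) (use e i in \<open>auto simp: n_def\<close>)
    then show "walk E (z i p) (drop p (us ! i)) 0" using i(2) by (simp add: z_def n_def)
  qed
  have lg: "lgraph V E"
  proof (rule lgraphI[OF _ _ E symE])
    show "finite V" "0 \<in> V" by (auto simp: V_def)
    fix x assume "x \<in> V"
    then consider "x = 0" | i p where "i < r" "1 \<le> p" "p < n i" "x = Suc (prod_encode (i, p))"
      by (auto simp: V_def)
    then show "\<exists>w. walk E 0 w x"
    proof cases
      case 1
      then show ?thesis by (intro exI[of _ "[]"]) simp
    next
      case 2
      then have "x = z i p" by (simp add: z_def)
      then show ?thesis using seg(1)[of i p] 2 by auto
    qed
  qed
  \<comment> \<open>The label of the initial part of the circle leading from 0 to x. Appending an
    edge changes it only up to whole circles, which is how walks are turned into products of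
    generators.\<close>
  define t where "t x = (case x of 0 \<Rightarrow> [] | Suc y \<Rightarrow> case prod_decode y of (i, p) \<Rightarrow> take p (us ! i))" for x :: vert
  have tz: "t (z i p) = (if p = n i then [] else take p (us ! i))" for i p
    by (auto simp: t_def z_def)
  let ?L = "lists (set us \<union> rev ` set us)"
  have step: "\<exists>vs\<in>?L. val (t x @ [s]) = val (concat vs @ t y)" if xy: "(x, s, y) \<in> E" for x s y
  proof -
    obtain i p where ip: "(i, p) \<in> P" "(x, s, y) = fw (i, p) \<or> (x, s, y) = bw (i, p)"
      using xy unfolding E_def by auto
    have i: "i < r" "p < n i" using ip(1) by (auto simp: P_def)
    have ui: "us ! i \<in> set us" using i(1) by (simp add: r_def)
    have tk: "take (Suc p) (us ! i) = take p (us ! i) @ [us ! i ! p]"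
      using i(2) by (simp add: n_def take_Suc_conv_app_nth)
    have full: "us ! i = take p (us ! i) @ [us ! i ! p]" if "Suc p = n i"
      using tk that by (simp add: n_def)
    have tp: "take p (us ! i) \<in> lists S"
      using uS[OF i(1)] set_take_subset[of p "us ! i"] by (auto simp: in_lists_conv_set)
    from ip(2) show ?thesis
    proof
      assume "(x, s, y) = fw (i, p)"
      then have x: "x = z i p" "s = us ! i ! p" "y = z i (Suc p)" by (auto simp: fw_def)
      show ?thesis
      proof (cases "Suc p = n i")
        case True
        then show ?thesis using x tz i full ui by (intro bexI[of _ "[us ! i]"]) auto
      next
        case False
        then show ?thesis using x tz i tk by (intro bexI[of _ "[]"]) auto
      qed
    next
      assume "(x, s, y) = bw (i, p)"
      then have x: "x = z i (Suc p)" "s = us ! i ! p" "y = z i p" by (auto simp: bw_def)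
      show ?thesis
      proof (cases "Suc p = n i")
        case True
        have "val (rev (us ! i) @ take p (us ! i)) = val ([us ! i ! p] @ rev (take p (us ! i)) @ take p (us ! i))"
          by (subst (1) full[OF True]) simp
        also have "\<dots> = val [us ! i ! p]" using val_cancel(2)[OF tp, of "[us ! i ! p]" "[]"] by simp
        finally show ?thesis using x tz i True ui by (intro bexI[of _ "[rev (us ! i)]"]) auto
      next
        case False
        have "val (take (Suc p) (us ! i) @ [us ! i ! p]) = val (take p (us ! i))"
          using val_cancel(1)[of "[us ! i ! p]" "take p (us ! i)" "[]"] lS[OF ip(1)] unfolding tk by simp
        then show ?thesis using x tz i False by (intro bexI[of _ "[]"]) auto
      qed
    qed
  qed
  have lift: "\<exists>vs\<in>?L. val (t x @ w) = val (concat vs @ t y)" if "walk E x w y" for x w y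
    using that
  proof (induction w arbitrary: x)
    case Nil
    then show ?case by (intro bexI[of _ "[]"]) auto
  next
    case (Cons s w)
    then obtain x' where x': "(x, s, x') \<in> E" "walk E x' w y" by auto
    obtain vs where vs: "vs \<in> ?L" "val (t x @ [s]) = val (concat vs @ t x')" using step[OF x'(1)] by blast
    obtain vs' where vs': "vs' \<in> ?L" "val (t x' @ w) = val (concat vs' @ t y)" using Cons.IH[OF x'(2)] by blast
    have "val (t x @ s # w) = val (t x @ [s]) \<circ> val w" by (simp add: val_append comp_assoc)
    also have "\<dots> = val (concat vs) \<circ> val (t x' @ w)" unfolding vs(2) by (simp add: val_append comp_assoc)
    also have "\<dots> = val (concat (vs @ vs') @ t y)" unfolding vs'(2) by (simp add: val_append comp_assoc)
    finally show ?case using vs(1) vs'(1) by (intro bexI[of _ "vs @ vs'"]) auto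
  qed
  have t0: "t 0 = []" by (simp add: t_def)
  have closed: "walk E 0 (concat vs) 0" if "vs \<in> ?L" for vs
    using that
  proof (induction vs)
    case (Cons v vs)
    have "walk E 0 u 0" if uu: "u \<in> set us" for u
    proof -
      obtain i where i: "i < r" "u = us ! i" using uu by (auto simp: in_set_conv_nth r_def)
      then have "walk E 0 (take (n i) (us ! i)) (z i (n i))" using seg(1)[of i "n i"] by simp
      then show ?thesis using i(2) by (simp add: n_def z_def)
    qed
    then have "walk E 0 v 0" using Cons.hyps walk_rev[OF symE] by auto
    then show ?case using Cons by (auto simp: walk_append)
  qed simp
  have "span (set us) = {val ([] @ w @ rev []) |w. walk E 0 w 0}"
  proof (intro equalityI subsetI)
    fix h assume "h \<in> span (set us)"
    then show "h \<in> {val ([] @ w @ rev []) |w. walk E 0 w 0}" using closed by (auto simp: span_def)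
  next
    fix h assume "h \<in> {val ([] @ w @ rev []) |w. walk E 0 w 0}"
    then obtain w where w: "walk E 0 w 0" "h = val w" by auto
    then show "h \<in> span (set us)" using lift[OF w(1)] t0 unfolding span_def by auto
  qed
  then have rep: "represents V E (span (set us))"
    unfolding represents_def by (intro bexI[of _ 0] bexI[of _ "[]"]) (auto simp: V_def)
  have "card V = Suc (\<Sum>i<r. n i - 1)"
  proof -
    have "card V = Suc (card (SIGMA i:{..<r}. {1..<n i}))"
      unfolding V_def by (subst card_insert_disjoint) (auto simp: card_image inj_on_def)
    then show ?thesis by (simp add: card_SigmaI)
  qed
  moreover have "(\<Sum>i<r. n i) = (\<Sum>i<r. n i - 1) + r"
  proof -
    have "(\<Sum>i<r. n i) = (\<Sum>i<r. (n i - 1) + 1)" 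
    proof (rule sum.cong)
      fix i assume "i \<in> {..<r}"
      then have "1 \<le> n i" using n1 by blast
      then show "n i = n i - 1 + 1" by simp
    qed simp
    then show ?thesis by (simp only: sum.distrib) (simp add: id_apply)
  qed
  \<comment> \<open>Only an inequality: a one-letter word yields a loop, whose two orientations
    coincide.\<close>
  moreover have "card E \<le> 2 * (\<Sum>i<r. n i)"
  proof -
    have "card E \<le> card (fw ` P) + card (bw ` P)" unfolding E_def by (rule card_Un_le)
    also have "\<dots> \<le> card P + card P" using finP by (intro add_mono card_image_le)
    also have "card P = (\<Sum>i<r. n i)" by (simp add: P_def card_SigmaI)
    finally show ?thesis by simp
  qed
  ultimately have "card E + 2 \<le> 2 * card V + 2 * length us" by (simp add: r_def)
  then show ?thesis using lg rep by blast
qed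

lemma minimal_graph_exists:
  assumes k: "0 < k" and m: "\<And>a b. a \<in> S \<Longrightarrow> b \<in> S \<Longrightarrow> a \<noteq> b \<Longrightarrow> enat (3 * k + 1) \<le> m a b"
    and us: "set us \<subseteq> lists S" "length us \<le> k"
    and nr: "\<And>c s. c \<in> lists S \<Longrightarrow> s \<in> S \<Longrightarrow> val (c @ [s] @ rev c) \<notin> span (set us)"
  shows "\<exists>V E. minimal_graph S m (span (set us)) k V E"
proof -
  let ?K = "span (set us)"
  define us' where "us' = filter (\<lambda>u. u \<noteq> []) us"
  have us': "set us' = set us - {[]}" "length us' \<le> k"
    using order.trans[OF length_filter_le us(2)] by (auto simp: us'_def)
  have e: "span (set us') = ?K" using span_nonempty_words us'(1) by simp
  define Q where "Q l \<longleftrightarrow> (\<exists>V E. lgraph V E \<and> represents V E ?K \<and> card E + 2 \<le> 2 * card V + 2 * k \<and> card E = l)" for l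
  have "\<exists>V E. lgraph V E \<and> represents V E ?K \<and> card E + 2 \<le> 2 * card V + 2 * length us'"
    using bouquet[of us'] us' us(1) e by auto
  then have "\<exists>l. Q l" unfolding Q_def using us'(2) by (meson add_le_mono le_refl mult_le_mono order.trans)
  then have "Q (LEAST l. Q l)" by (rule LeastI_ex)
  then obtain V E where VE: "lgraph V E" "represents V E ?K" "card E + 2 \<le> 2 * card V + 2 * k"
    "card E = (LEAST l. Q l)" unfolding Q_def by blast
  have "minimal_graph S m ?K k V E"
  proof (unfold_locales)
    fix V' E' assume "lgraph V' E'" "represents V' E' ?K" "card E' + 2 \<le> 2 * card V' + 2 * k"
    then have "Q (card E')" unfolding Q_def by blast
    then show "card E \<le> card E'" unfolding VE(4) by (rule Least_le)
  qed (use k m nr VE in auto)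
  then show ?thesis by blast
qed

definition quasiconvex :: "((nat \<Rightarrow> real) \<Rightarrow> nat \<Rightarrow> real) set \<Rightarrow> bool" where
  "quasiconvex K \<longleftrightarrow> (\<exists>B. \<forall>g\<in>K. \<forall>x. pre x g \<longrightarrow> (\<exists>h\<in>K. near B x h))"

end

context minimal_graph begin

text \<open>Among closed walks at v with a given value a shortest one has a good label, so geodesics
  stay near its prefixes; conjugation by c costs a constant by padding. Every prefix of the closed
  walk ends at a vertex of the finite graph, from which v is reached in at most D steps, and this
  completes the prefix to an element of K.\<close>

theorem quasiconvex_K: "quasiconvex K"
proof -
  obtain v c where c: "v \<in> V" "c \<in> lists S" "K = {val (c @ w @ rev c) |w. walk E v w v}"
    using graph(2) by (auto simp: represents_def)
  have "\<forall>x\<in>V. \<exists>t. walk E x t v" using gd(5) c(1) by blast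
  then obtain t where t: "\<And>x. x \<in> V \<Longrightarrow> walk E x (t x) v" by metis
  obtain M where M: "\<And>w. good w \<Longrightarrow> shadowed M w" using good_shadowed by metis
  obtain M' where M': "\<And>w u v C. w \<in> lists S \<Longrightarrow> u \<in> lists S \<Longrightarrow> v \<in> lists S \<Longrightarrow> shadowed C w \<Longrightarrow>
      shadowed (C + M' * (length u + length v)) (u @ w @ v)" using shadowed_padding by metis
  define D where "D = Max ((\<lambda>x. length (t x)) ` V)"
  have D: "length (t x) \<le> D" if "x \<in> V" for x unfolding D_def using gd(1) that by (intro Max_ge) auto
  define B where "B = M + M' * (2 * length c) + (D + length c)"
  have "\<exists>h\<in>K. near B x h" if g: "g \<in> K" "pre x g" for g x
  proof -
    obtain w0 where w0: "walk E v w0 v" "g = val (c @ w0 @ rev c)" using g(1) c(3) by blast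
    define Q where "Q w \<longleftrightarrow> walk E v w v \<and> val w = val w0" for w
    have "Q w0" using w0 by (simp add: Q_def)
    then obtain w where w: "Q w" "\<And>u. Q u \<Longrightarrow> length w \<le> length u"
      using exists_least_iff[of "\<lambda>l. \<exists>w. Q w \<and> length w = l"] by (metis linorder_not_le)
    have good: "good w"
      by (rule shortest_walk_good[of v w v]) (use w c(1) in \<open>auto simp: Q_def\<close>)
    have wS: "w \<in> lists S" using good_lists[OF good] .
    have gw: "g = val (c @ w @ rev c)" using w(1) w0(2) by (simp add: Q_def val_append)
    have "shadowed (M + M' * (length c + length (rev c))) (c @ w @ rev c)"
      using M'[OF wS c(2) _ M[OF good], of "rev c"] c(2) by simp
    then have "fellow (M + M' * (2 * length c)) x (c @ w @ rev c)"
      using g(2) gw unfolding shadowed_def by (simp add: mult_2)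
    then obtain p r where pr: "c @ w @ rev c = p @ r" "near (M + M' * (2 * length c)) x (val p)"
      unfolding fellow_def by blast
    have idK: "id \<in> K"
    proof -
      have "val (c @ [] @ rev c) = id" using val_cancel(1)[OF c(2), of "[]" "[]"] by simp
      moreover have "walk E v [] v" by simp
      ultimately show ?thesis unfolding c(3) by (metis (mono_tags, lifting) mem_Collect_eq)
    qed
    have "\<exists>h\<in>K. near (D + length c) (val p) h"
    proof -
      have all: "p \<in> lists S" "r \<in> lists S"
        using arg_cong[OF pr(1), of "\<lambda>l. l \<in> lists S"] c(2) wS by auto
      consider (1) "length p \<le> length c" | (2) "length c < length p" "length p \<le> length (c @ w)"
        | (3) "length (c @ w) < length p" by linarith
      then show ?thesis
      proof cases
        case 1
        have "val p \<circ> val (rev p) = id" using val_rev_right[OF all(1)] .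
        then have "near (length c) (val p) id" using 1 all(1) by (intro near_I[of "rev p"]) auto
        then show ?thesis using idK near_mono[of "length c"] by (meson le_add2)
      next
        case 2
        obtain w1 where w1: "p = c @ w1"
          using pr(1) 2 by (metis append_eq_append_conv_if append_take_drop_id less_imp_le)
        have e2: "w @ rev c = w1 @ r" using pr(1) w1 by simp
        obtain w2 where w2: "w = w1 @ w2"
          using e2 2 w1 by (auto simp: append_eq_append_conv2)
        obtain x1 where x1: "walk E v w1 x1" using w(1) w2 by (auto simp: Q_def walk_append)
        have x1V: "x1 \<in> V" using walk_end[OF x1 gd(3) c(1)] .
        have tS: "t x1 \<in> lists S" using walk_labels[OF t[OF x1V] gd(3)] .
        have "walk E v (w1 @ t x1) v" using x1 t[OF x1V] by (auto simp: walk_append)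
        then have "val (c @ (w1 @ t x1) @ rev c) \<in> K" using c(3) by blast
        moreover have "near (D + length c) (val p) (val (c @ (w1 @ t x1) @ rev c))"
          using tS c(2) D[OF x1V] w1 by (intro near_I[of "t x1 @ rev c"]) (auto simp: val_append comp_assoc)
        ultimately show ?thesis by blast
      next
        case 3
        have "length c + length w + length c = length p + length r"
          using arg_cong[OF pr(1), of length] by simp
        then have "near (length c) (val p) g"
          using 3 all(2) gw pr(1) by (intro near_I[of r]) (auto simp: val_append)
        then show ?thesis using g(1) near_mono[of "length c"] by (meson le_add2)
      qed
    qed
    then obtain h where "h \<in> K" "near (D + length c) (val p) h" by blast
    then show ?thesis using near_trans[OF pr(2)] unfolding B_def by blast
  qed
  then show ?thesis unfolding quasiconvex_def by blast
qed

section \<open>A breadth-first spanning tree\<close>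

definition base :: vert where "base = (SOME v. v \<in> V)"

lemma base: "base \<in> V"
  unfolding base_def using gd(2) some_in_eq by blast

definition depth :: "vert \<Rightarrow> nat" where
  "depth x = (LEAST n. \<exists>w. walk E base w x \<and> length w = n)"

definition parent :: "vert \<Rightarrow> vert \<times> nat" where
  "parent x = (SOME (y, s). (y, s, x) \<in> E \<and> depth x = Suc (depth y))"

text \<open>The first argument bounds the recursion: \<open>parent\<close> is total, and it is known
  to decrease \<open>depth\<close> only at vertices of V other than \<open>base\<close>.\<close>

primrec tree_word_aux :: "nat \<Rightarrow> vert \<Rightarrow> nat list" where
  "tree_word_aux 0 x = []"
| "tree_word_aux (Suc n) x = tree_word_aux n (fst (parent x)) @ [snd (parent x)]"

definition tree_word :: "vert \<Rightarrow> nat list" where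
  "tree_word x = tree_word_aux (depth x) x"

definition tree_edges :: "(vert \<times> nat \<times> vert) set" where
  "tree_edges = (\<Union>x\<in>V - {base}. {(fst (parent x), snd (parent x), x), (x, snd (parent x), fst (parent x))})"

lemma depth_attained: "x \<in> V \<Longrightarrow> \<exists>w. walk E base w x \<and> length w = depth x"
  unfolding depth_def by (rule LeastI_ex) (use gd(5)[OF base] in blast)

lemma depth_le: "walk E base w x \<Longrightarrow> depth x \<le> length w"
  unfolding depth_def by (rule Least_le) blast

lemma parent_edge:
  assumes "x \<in> V" "x \<noteq> base"
  shows "(fst (parent x), snd (parent x), x) \<in> E" "depth x = Suc (depth (fst (parent x)))"
proof -
  obtain w where w: "walk E base w x" "length w = depth x" using depth_attained[OF assms(1)] by blast
  obtain u s where us: "w = u @ [s]" using w(1) assms(2) by (cases w rule: rev_cases) auto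
  then obtain y where y: "walk E base u y" "(y, s, x) \<in> E" using w(1) by (auto simp: walk_append)
  have "y \<in> V" using y(2) gd(3) by auto
  then obtain u' where u': "walk E base u' y" "length u' = depth y" using depth_attained by blast
  have "depth x \<le> Suc (depth y)" using depth_le[of "u' @ [s]" x] u' y(2) by (auto simp: walk_append)
  moreover have "Suc (depth y) \<le> depth x" using depth_le[OF y(1)] us w(2) by simp
  ultimately have "case (y, s) of (y, s) \<Rightarrow> (y, s, x) \<in> E \<and> depth x = Suc (depth y)" using y(2) by simp
  then have "case parent x of (y, s) \<Rightarrow> (y, s, x) \<in> E \<and> depth x = Suc (depth y)"
    unfolding parent_def by (rule someI)
  then show "(fst (parent x), snd (parent x), x) \<in> E" "depth x = Suc (depth (fst (parent x)))"
    by (auto simp: case_prod_beta)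
qed

lemma tree_word_base: "tree_word base = []"
  using depth_le[of "[]" base] by (simp add: tree_word_def)

lemma tree_word_step:
  "x \<in> V \<Longrightarrow> x \<noteq> base \<Longrightarrow> tree_word x = tree_word (fst (parent x)) @ [snd (parent x)]"
  using parent_edge(2)[of x] by (simp add: tree_word_def)

lemma tree_edges_sub: "tree_edges \<subseteq> E"
  using parent_edge(1) edge_symD[OF gd(4)] by (auto simp: tree_edges_def)

lemma tree_edges_sym: "edge_sym tree_edges"
  unfolding edge_sym_def tree_edges_def by blast

lemma tree_walk: "x \<in> V \<Longrightarrow> walk tree_edges base (tree_word x) x"
proof (induction "depth x" arbitrary: x)
  case 0
  then have "x = base" using parent_edge(2) by fastforce
  then show ?case by (simp add: tree_word_base)
next
  case (Suc n)
  show ?case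
  proof (cases "x = base")
    case True
    then show ?thesis by (simp add: tree_word_base)
  next
    case False
    note pe = parent_edge[OF Suc.prems False]
    have "fst (parent x) \<in> V" using pe(1) gd(3) by blast
    then have "walk tree_edges base (tree_word (fst (parent x))) (fst (parent x))"
      using Suc.hyps pe(2) by simp
    moreover have "(fst (parent x), snd (parent x), x) \<in> tree_edges"
      using Suc.prems False by (auto simp: tree_edges_def)
    ultimately show ?thesis
      using tree_word_step[OF Suc.prems False] by (auto simp: walk_append)
  qed
qed

lemma tree_word_lists: "x \<in> V \<Longrightarrow> tree_word x \<in> lists S"
  using walk_labels[OF tree_walk] tree_edges_sub gd(3) by blast

lemma val_tree_edge:
  assumes "(x, s, y) \<in> tree_edges" shows "val (tree_word x @ [s] @ rev (tree_word y)) = id"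
proof -
  have V: "x \<in> V" "y \<in> V" "s \<in> S" using assms tree_edges_sub gd(3) by auto
  have "tree_word y = tree_word x @ [s] \<or> tree_word x = tree_word y @ [s]"
    using assms tree_word_step by (auto simp: tree_edges_def)
  then show ?thesis
  proof
    assume "tree_word y = tree_word x @ [s]"
    then have "tree_word x @ [s] @ rev (tree_word y) = tree_word y @ rev (tree_word y)" by simp
    then show ?thesis using val_rev_right[OF tree_word_lists[OF V(2)]] val_append by metis
  next
    assume e: "tree_word x = tree_word y @ [s]"
    have "val (tree_word x @ [s] @ rev (tree_word y)) = val (tree_word y @ [s] @ rev [s] @ rev (tree_word y))"
      unfolding e by simp
    also have "\<dots> = val (tree_word y @ rev (tree_word y))"
      using val_cancel(1)[of "[s]" "tree_word y" "rev (tree_word y)"] V(3) by simp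
    finally show ?thesis using val_rev_right[OF tree_word_lists[OF V(2)]] by (simp add: val_append)
  qed
qed

text \<open>A shortest tree walk with the given ends and value has no two equal adjacent letters,
  since by folding these would be a backtrack.\<close>

lemma reduced_tree_walk:
  assumes "walk tree_edges x w y"
  obtains u where "walk tree_edges x u y" "val u = val w" "distinct_adj u"
proof -
  define Q where "Q u \<longleftrightarrow> walk tree_edges x u y \<and> val u = val w" for u
  have "Q w" using assms by (simp add: Q_def)
  then obtain u where u: "Q u" "\<And>v. Q v \<Longrightarrow> length u \<le> length v"
    using exists_least_iff[of "\<lambda>l. \<exists>w. Q w \<and> length w = l"] by (metis linorder_not_le)
  have "distinct_adj u"
  proof (rule ccontr)
    assume "\<not> ?thesis"
    then obtain i where i: "Suc i < length u" "u ! i = u ! Suc i"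
      by (auto simp: distinct_adj_conv_nth less_diff_conv)
    define a where "a = u ! i"
    have e: "u = take i u @ [a, a] @ drop (Suc (Suc i)) u"
      using i id_take_nth_drop[of i u] Cons_nth_drop_Suc[of "Suc i" u] by (simp add: a_def)
    obtain x1 x2 x3 where x: "walk tree_edges x (take i u) x1" "(x1, a, x2) \<in> tree_edges"
      "(x2, a, x3) \<in> tree_edges" "walk tree_edges x3 (drop (Suc (Suc i)) u) y"
      using u(1) unfolding Q_def by (subst (asm) e) (auto simp: walk_append)
    have xE: "(x1, a, x2) \<in> E" "(x2, a, x3) \<in> E" using x tree_edges_sub by auto
    have "x3 = x1" using folded[OF edge_symD[OF gd(4) xE(1)] xE(2)] by simp
    then have "walk tree_edges x (take i u @ drop (Suc (Suc i)) u) y" using x by (auto simp: walk_append)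
    moreover have "val (take i u @ drop (Suc (Suc i)) u) = val u"
      using val_cancel(1)[of "[a]" "take i u" "drop (Suc (Suc i)) u"] xE gd(3) by (subst (3) e) auto
    ultimately have "Q (take i u @ drop (Suc (Suc i)) u)" using u(1) by (simp add: Q_def)
    from u(2)[OF this] i show False by simp
  qed
  then show ?thesis using that u(1) unfolding Q_def by blast
qed

section \<open>The edges outside the tree as a free basis\<close>

definition free_edges :: "(vert \<times> nat \<times> vert) set" where
  "free_edges = {(x, s, y) \<in> E - tree_edges. x < y}"

fun orient :: "(vert \<times> nat \<times> vert) \<times> bool \<Rightarrow> vert \<times> nat \<times> vert" where
  "orient ((x, s, y), b) = (if b then (x, s, y) else (y, s, x))"

fun edge_loop :: "vert \<times> nat \<times> vert \<Rightarrow> nat list" where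
  "edge_loop (x, s, y) = tree_word x @ [s] @ rev (tree_word y)"

definition loops :: "((vert \<times> nat \<times> vert) \<times> bool) list \<Rightarrow> nat list" where
  "loops zs = concat (map (edge_loop \<circ> orient) zs)"

lemma orient_edge: "e \<in> free_edges \<Longrightarrow> orient (e, b) \<in> E - tree_edges"
  using edge_symD[OF gd(4)] edge_symD[OF tree_edges_sym]
  by (cases e; cases b) (auto simp: free_edges_def)

text \<open>As there are no loops, exactly one orientation of an edge outside the tree is
  increasing; \<open>free_edges\<close> picks that one.\<close>

lemma orient_surj: 
  assumes "(x, s, y) \<in> E - tree_edges" obtains e b where "e \<in> free_edges" "orient (e, b) = (x, s, y)"
proof (cases "x < y")
  case True
  then show ?thesis using that[of "(x, s, y)" True] assms by (simp add: free_edges_def)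
next
  case False
  then have "y < x" using assms no_loop[of x s] by (cases "x = y") auto
  then have "(y, s, x) \<in> free_edges"
    using assms edge_symD[OF gd(4)] edge_symD[OF tree_edges_sym] by (auto simp: free_edges_def)
  then show ?thesis using that[of "(y, s, x)" False] by simp
qed

lemma orient_reverse:
  assumes "e \<in> free_edges" "e' \<in> free_edges" "orient (e, b) = (x, s, y)" "orient (e', b') = (y, s, x)"
  shows "e' = e \<and> b' = (\<not> b)"
  using assms by (cases e; cases e'; cases b; cases b') (auto simp: free_edges_def)

text \<open>Inserting the tree path to the base and back after each edge splits the walk into loops,
  and tree edges contribute trivial ones.\<close>

lemma loops_span:
  assumes "walk E base w y"
  shows "\<exists>zs\<in>lists (free_edges \<times> UNIV). val w = val (loops zs @ tree_word y)"
  using assms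
proof (induction w arbitrary: y rule: rev_induct)
  case Nil
  then show ?case by (intro bexI[of _ "[]"]) (auto simp: loops_def tree_word_base)
next
  case (snoc s w)
  then obtain x where x: "walk E base w x" "(x, s, y) \<in> E" by (auto simp: walk_append)
  obtain zs where zs: "zs \<in> lists (free_edges \<times> UNIV)" "val w = val (loops zs @ tree_word x)"
    using snoc.IH[OF x(1)] by blast
  have V: "x \<in> V" "y \<in> V" using x(2) gd(3) by auto
  have "val (w @ [s]) = val (loops zs @ tree_word x @ [s])" using zs(2) by (simp add: val_append comp_assoc)
  also have "\<dots> = val (loops zs @ (tree_word x @ [s] @ rev (tree_word y)) @ tree_word y)"
    using val_cancel(2)[OF tree_word_lists[OF V(2)], of "loops zs @ tree_word x @ [s]" "[]"] by simp
  finally have e: "val (w @ [s]) = val (loops zs @ (tree_word x @ [s] @ rev (tree_word y)) @ tree_word y)" .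
  show ?case
  proof (cases "(x, s, y) \<in> tree_edges")
    case True
    have "val (loops zs @ (tree_word x @ [s] @ rev (tree_word y)) @ tree_word y)
      = val (loops zs) \<circ> (val (tree_word x @ [s] @ rev (tree_word y)) \<circ> val (tree_word y))"
      by (simp only: val_append)
    then have "val (w @ [s]) = val (loops zs @ tree_word y)"
      unfolding e val_tree_edge[OF True] by (simp add: val_append)
    then show ?thesis using zs(1) by blast
  next
    case False
    then obtain f b where fb: "f \<in> free_edges" "orient (f, b) = (x, s, y)" using orient_surj x(2) by blast
    have "val (w @ [s]) = val (loops (zs @ [(f, b)]) @ tree_word y)"
      unfolding e using fb(2) by (simp add: loops_def comp_apply[of edge_loop])
    then show ?thesis using zs(1) fb(1) by (intro bexI[of _ "zs @ [(f, b)]"]) auto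
  qed
qed

text \<open>The closing tree word is kept apart from r so that the next loop can absorb it: it is
  merged with the opening tree word of that loop into one tree walk without backtracks. Folding then
  shows that this tree walk cannot cancel against the edges outside the tree on either side.\<close>

lemma loops_reduced_walk:
  assumes "zs @ [(f, b)] \<in> lists (free_edges \<times> UNIV)"
    and "\<And>u e c v. zs @ [(f, b)] \<noteq> u @ [(e, c), (e, \<not> c)] @ v"
    and "orient (f, b) = (x, s, y)"
  shows "\<exists>r. walk E base r x \<and> distinct_adj (r @ [s]) \<and> val (loops (zs @ [(f, b)])) = val (r @ [s] @ rev (tree_word y))"
  using assms
proof (induction zs arbitrary: f b x s y rule: rev_induct)
  case Nil
  have xy: "(x, s, y) \<in> E - tree_edges" using orient_edge[of f b] Nil by simp
  then have V: "x \<in> V" "y \<in> V" using gd(3) by auto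
  obtain u where u: "walk tree_edges base u x" "val u = val (tree_word x)" "distinct_adj u"
    using reduced_tree_walk[OF tree_walk[OF V(1)]] .
  have "u = [] \<or> last u \<noteq> s"
  proof (rule ccontr)
    assume "\<not> ?thesis"
    then obtain u' where "u = u' @ [s]" by (metis append_butlast_last_id)
    then obtain x' where x': "(x', s, x) \<in> tree_edges" using u(1) by (auto simp: walk_append)
    then have "(x, s, x') \<in> tree_edges" using edge_symD[OF tree_edges_sym] by blast
    then show False using folded[of x s y x'] xy tree_edges_sub by auto
  qed
  then have "distinct_adj (u @ [s])" using u(3) by (auto simp: distinct_adj_append_iff)
  moreover have "walk E base u x" using walk_mono[OF u(1) tree_edges_sub] .
  moreover have "val (loops ([] @ [(f, b)])) = val (u @ [s] @ rev (tree_word y))"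
    using u(2) Nil.prems(3) by (simp add: loops_def comp_apply[of edge_loop] val_append comp_assoc)
  ultimately show ?case by blast
next
  case (snoc z zs)
  obtain f0 b0 where z: "z = (f0, b0)" by (cases z)
  obtain x0 s0 y0 where o0: "orient (f0, b0) = (x0, s0, y0)" by (metis prod_cases3)
  have pr: "zs @ [(f0, b0)] \<in> lists (free_edges \<times> UNIV)" "f0 \<in> free_edges" "f \<in> free_edges"
    using snoc.prems(1) z by auto
  have fr: "zs @ [(f0, b0)] \<noteq> u @ [(e, c), (e, \<not> c)] @ v" for u e c v
    using snoc.prems(2)[of u e c "v @ [(f, b)]"] z by auto
  obtain r where r: "walk E base r x0" "distinct_adj (r @ [s0])"
    "val (loops (zs @ [(f0, b0)])) = val (r @ [s0] @ rev (tree_word y0))"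
    using snoc.IH[OF pr(1) fr o0] by blast
  have xy: "(x, s, y) \<in> E - tree_edges" using orient_edge[of f b] pr snoc.prems(3) by simp
  have xy0: "(x0, s0, y0) \<in> E - tree_edges" using orient_edge[of f0 b0] pr o0 by simp
  have V: "x \<in> V" "y \<in> V" "x0 \<in> V" "y0 \<in> V" using xy xy0 gd(3) by auto
  have "walk tree_edges y0 (rev (tree_word y0) @ tree_word x) x"
    using tree_walk[OF V(1)] walk_rev[OF tree_edges_sym tree_walk[OF V(4)]] by (auto simp: walk_append)
  then obtain u where u: "walk tree_edges y0 u x" "val u = val (rev (tree_word y0) @ tree_word x)" "distinct_adj u"
    using reduced_tree_walk by metis
  have last: "u = [] \<or> last u \<noteq> s"
  proof (rule ccontr)
    assume "\<not> ?thesis"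
    then obtain u' where "u = u' @ [s]" by (metis append_butlast_last_id)
    then obtain x' where x': "(x', s, x) \<in> tree_edges" using u(1) by (auto simp: walk_append)
    then have "(x, s, x') \<in> tree_edges" using edge_symD[OF tree_edges_sym] by blast
    then show False using folded[of x s y x'] xy tree_edges_sub by auto
  qed
  have hd: "u = [] \<or> s0 \<noteq> hd u"
  proof (rule ccontr)
    assume "\<not> ?thesis"
    then obtain u' where "u = s0 # u'" by (cases u) auto
    then obtain x' where x': "(y0, s0, x') \<in> tree_edges" using u(1) by auto
    then have "x' = x0" using folded[of y0 s0 x' x0] xy0 edge_symD[OF gd(4)] tree_edges_sub by auto
    then show False using x' xy0 edge_symD[OF tree_edges_sym] by auto
  qed
  \<comment> \<open>With nothing in between, equal labels make the two edges opposite by folding, so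
    a letter of the word would be followed by its inverse.\<close>
  have mid: "s0 \<noteq> s" if "u = []"
  proof
    assume e: "s0 = s"
    have "y0 = x" using u(1) that by simp
    then have "x0 = y" using folded[of x s x0 y] xy xy0 edge_symD[OF gd(4)] e by auto
    then have "f = f0 \<and> b = (\<not> b0)" using orient_reverse[OF pr(2,3) o0] snoc.prems(3) e \<open>y0 = x\<close> by simp
    then show False using snoc.prems(2)[of zs f0 b0 "[]"] z by simp
  qed
  let ?r = "r @ [s0] @ u"
  have "distinct_adj (?r @ [s])"
    using r(2) u(3) last hd mid by (cases "u = []") (auto simp: distinct_adj_append_iff distinct_adj_Cons)
  moreover have "walk E base ?r x" using r(1) xy0 walk_mono[OF u(1) tree_edges_sub] by (auto simp: walk_append)
  moreover have "val (loops ((zs @ [z]) @ [(f, b)])) = val (?r @ [s] @ rev (tree_word y))"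
  proof -
    have "val (loops ((zs @ [z]) @ [(f, b)])) = val (loops (zs @ [(f0, b0)])) \<circ> val (tree_word x @ [s] @ rev (tree_word y))"
      using z snoc.prems(3) by (simp add: loops_def comp_apply[of edge_loop] val_append comp_assoc)
    also have "\<dots> = val (r @ [s0]) \<circ> val (rev (tree_word y0) @ tree_word x) \<circ> val ([s] @ rev (tree_word y))"
      unfolding r(3) by (simp add: val_append comp_assoc)
    also have "\<dots> = val (?r @ [s] @ rev (tree_word y))"
      unfolding u(2)[symmetric] by (simp add: val_append comp_assoc)
    finally show ?thesis .
  qed
  ultimately show ?case by blast
qed

text \<open>The closing tree word is replaced by a tree walk without backtracks. The result is a
  closed walk without equal adjacent letters, whose label is good by torsion-freeness and hence
  nontrivial.\<close>

theorem loops_free: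
  assumes tf: "\<And>w n. w \<in> lists S \<Longrightarrow> val w \<in> K \<Longrightarrow> 0 < n \<Longrightarrow> val (concat (replicate n w)) = id \<Longrightarrow> val w = id"
    and zs: "zs \<in> lists (free_edges \<times> UNIV)" "zs \<noteq> []"
    and fr: "\<And>u e c v. zs \<noteq> u @ [(e, c), (e, \<not> c)] @ v"
  shows "val (loops zs) \<noteq> id"
proof -
  obtain zs' f b where z: "zs = zs' @ [(f, b)]" using zs(2) by (metis rev_exhaust surj_pair)
  obtain x s y where o: "orient (f, b) = (x, s, y)" by (metis prod_cases3)
  obtain r where r: "walk E base r x" "distinct_adj (r @ [s])"
    "val (loops zs) = val (r @ [s] @ rev (tree_word y))"
    using loops_reduced_walk[of zs' f b x s y] zs(1) fr o z by auto
  have xy: "(x, s, y) \<in> E - tree_edges" using orient_edge[of f b] zs(1) z o by simp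
  have V: "x \<in> V" "y \<in> V" using xy gd(3) by auto
  obtain u where u: "walk tree_edges y u base" "val u = val (rev (tree_word y))" "distinct_adj u"
    using reduced_tree_walk[OF walk_rev[OF tree_edges_sym tree_walk[OF V(2)]]] .
  have hd: "u = [] \<or> s \<noteq> hd u"
  proof (rule ccontr)
    assume "\<not> ?thesis"
    then obtain u' where "u = s # u'" by (cases u) auto
    then obtain x' where x': "(y, s, x') \<in> tree_edges" using u(1) by auto
    then have "x' = x" using folded[of y s x' x] xy edge_symD[OF gd(4)] tree_edges_sub by auto
    then show False using x' xy edge_symD[OF tree_edges_sym] by auto
  qed
  let ?w = "r @ [s] @ u"
  have da: "distinct_adj ?w"
    using r(2) u(3) hd by (cases "u = []") (auto simp: distinct_adj_append_iff distinct_adj_Cons)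
  have w: "walk E base ?w base" using r(1) xy walk_mono[OF u(1) tree_edges_sub] by (auto simp: walk_append)
  have "?w \<noteq> u' @ [a, a] @ v'" for u' a v'
    using da by (metis append_Cons distinct_adj_Cons_Cons distinct_adj_appendD2)
  with tf w base have "good ?w" by (rule closed_walk_good_of_torsion_free)
  then have "val ?w \<noteq> id" using good_val_neq_id by blast
  moreover have "val ?w = val (loops zs)" using r(3) u(2) by (simp add: val_append)
  ultimately show ?thesis by simp
qed

lemma loops_closed_walk:
  "zs \<in> lists (free_edges \<times> UNIV) \<Longrightarrow> walk E base (loops zs) base"
proof (induction zs)
  case (Cons z zs)
  obtain f b where z: "z = (f, b)" by (cases z)
  obtain x s y where o: "orient (f, b) = (x, s, y)" by (metis prod_cases3)
  have xy: "(x, s, y) \<in> E" using orient_edge[of f b] Cons.prems z o by simp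
  have V: "x \<in> V" "y \<in> V" using xy gd(3) by auto
  have "walk E base (tree_word x) x" "walk E base (tree_word y) y"
    using walk_mono[OF tree_walk tree_edges_sub] V by auto
  then have "walk E base (edge_loop (orient z)) base"
    using xy walk_rev[OF gd(4), of base "tree_word y" y] unfolding z o by (auto simp: walk_append)
  then show ?case using Cons by (auto simp: loops_def comp_apply[of edge_loop] walk_append)
qed (simp add: loops_def)


end

context coxeter begin

section \<open>Parity of length and the subgroup of even elements\<close>

lemma val_eq_parity:
  assumes "u \<in> lists S" "v \<in> lists S" "val u = val v" shows "even (length u) = even (length v)"
  \<comment> \<open>Braid moves keep the length, and deleting a square changes it by two.\<close>
  by (rule val_eq_equivalent[of "\<lambda>u v. even (length u) = even (length v)"]) (use assms in auto)

lemma span_append: "val u \<in> span U \<Longrightarrow> val v \<in> span U \<Longrightarrow> val (u @ v) \<in> span U"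
proof -
  assume "val u \<in> span U" "val v \<in> span U"
  then obtain us vs where u: "us \<in> lists (U \<union> rev ` U)" "val u = val (concat us)"
    and v: "vs \<in> lists (U \<union> rev ` U)" "val v = val (concat vs)" unfolding span_def by auto
  have "val (u @ v) = val (concat (us @ vs))" using u(2) v(2) by (simp add: val_append)
  moreover have "us @ vs \<in> lists (U \<union> rev ` U)" using u(1) v(1) by simp
  ultimately show ?thesis unfolding span_def by blast
qed

lemma span_gen: "u \<in> U \<Longrightarrow> val u \<in> span U" "u \<in> U \<Longrightarrow> val (rev u) \<in> span U"
proof -
  assume "u \<in> U"
  then have "[u] \<in> lists (U \<union> rev ` U)" "[rev u] \<in> lists (U \<union> rev ` U)" by auto
  moreover have "val u = val (concat [u])" "val (rev u) = val (concat [rev u])" by simp_all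
  ultimately show "val u \<in> span U" "val (rev u) \<in> span U" unfolding span_def by blast+
qed

lemma span_id: "id \<in> span U"
proof -
  have "id = val (concat [])" by simp
  then show ?thesis unfolding span_def by blast
qed

lemma concat_in_lists:
  assumes "vs \<in> lists (U \<union> rev ` U)" "U \<subseteq> lists S" shows "concat vs \<in> lists S"
  using assms by (induction vs) auto

lemma span_W: "U \<subseteq> lists S \<Longrightarrow> g \<in> span U \<Longrightarrow> g \<in> W"
  unfolding span_def using concat_in_lists by auto

lemma span_concat:
  assumes "\<And>u. u \<in> U \<Longrightarrow> val u \<in> span U'" "\<And>u. u \<in> U \<Longrightarrow> val (rev u) \<in> span U'"
  shows "span U \<subseteq> span U'"
proof
  fix h assume "h \<in> span U"
  then obtain vs where vs: "vs \<in> lists (U \<union> rev ` U)" "h = val (concat vs)" unfolding span_def by auto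
  have "val (concat vs) \<in> span U'"
    using vs(1) by (induction vs) (use span_id assms in \<open>auto intro: span_append\<close>)
  then show "h \<in> span U'" using vs(2) by simp
qed

theorem quasiconvex_span:
  assumes k: "0 < k" and m: "\<And>a b. a \<in> S \<Longrightarrow> b \<in> S \<Longrightarrow> a \<noteq> b \<Longrightarrow> enat (3 * k + 1) \<le> m a b"
    and us: "set us \<subseteq> lists S" "length us \<le> k"
    and nr: "\<And>c s. c \<in> lists S \<Longrightarrow> s \<in> S \<Longrightarrow> val (c @ [s] @ rev c) \<notin> span (set us)"
  shows "quasiconvex (span (set us))"
proof -
  have "\<exists>V E. minimal_graph S m (span (set us)) k V E"
    using k m us nr by (rule minimal_graph_exists)
  then obtain V E where "minimal_graph S m (span (set us)) k V E" by blast
  then interpret minimal_graph S m "span (set us)" k V E .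
  show ?thesis by (rule quasiconvex_K)
qed

lemma even_span_no_reflection:
  assumes "U \<subseteq> lists S" "\<And>u. u \<in> U \<Longrightarrow> even (length u)" "c \<in> lists S" "s \<in> S"
  shows "val (c @ [s] @ rev c) \<notin> span U"
proof
  assume "val (c @ [s] @ rev c) \<in> span U"
  then obtain vs where vs: "vs \<in> lists (U \<union> rev ` U)" "val (c @ [s] @ rev c) = val (concat vs)"
    unfolding span_def by auto
  have "even (length (concat vs))" using vs(1) by (induction vs) (use assms(2) in auto)
  moreover have "concat vs \<in> lists S" using concat_in_lists[OF vs(1) assms(1)] .
  ultimately have "even (length (c @ [s] @ rev c))"
    using val_eq_parity[of "c @ [s] @ rev c" "concat vs"] vs(2) assms(3,4) by auto
  then show False by simp
qed

text \<open>A geodesic to \<open>g' \<circ> val u\<close> stays near a geodesic r to g' followed by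
  u. Prefixes ending on r lie near K' by assumption, and those ending in u lie within the length of
  u from g'.\<close>

lemma quasiconvex_translate:
  assumes K': "quasiconvex K'" "K' \<subseteq> K" "K' \<subseteq> W" and u: "u \<in> lists S"
    and K: "K \<subseteq> K' \<union> (\<lambda>g. g \<circ> val u) ` K'"
  shows "quasiconvex K"
proof -
  obtain B where B: "\<And>g x. g \<in> K' \<Longrightarrow> pre x g \<Longrightarrow> \<exists>h\<in>K'. near B x h"
    using K'(1) unfolding quasiconvex_def by blast
  obtain M where M: "\<And>w. good w \<Longrightarrow> shadowed M w" using good_shadowed by metis
  obtain M' where M': "\<And>w u v C. w \<in> lists S \<Longrightarrow> u \<in> lists S \<Longrightarrow> v \<in> lists S \<Longrightarrow> shadowed C w \<Longrightarrow>
      shadowed (C + M' * (length u + length v)) (u @ w @ v)" using shadowed_padding by metis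
  define C where "C = M + M' * length u"
  have "\<exists>h\<in>K. near (C + (B + length u)) x h" if g: "g \<in> K" "pre x g" for g x
  proof (cases "g \<in> K'")
    case True
    then obtain h where "h \<in> K'" "near B x h" using B g(2) by blast
    then show ?thesis using near_mono[of B x h "C + (B + length u)"] K'(2) by auto
  next
    case False
    then obtain g' where g': "g' \<in> K'" "g = g' \<circ> val u" using K g(1) by blast
    then have "g' \<in> W" using K'(3) by blast
    then obtain r where r: "r \<in> lists S" "val r = g'" "length r = len g'" using reduced_word by blast
    have red: "reduced r" using r reducedI by blast
    have "shadowed C (r @ u)"
      using M'[OF r(1) _ u M[OF reduced_good[OF red]], of "[]"] by (simp add: C_def)
    then have "fellow C x (r @ u)" using g(2) g'(2) r(2) unfolding shadowed_def by (simp add: val_append)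
    then obtain p t where p: "r @ u = p @ t" "near C x (val p)" unfolding fellow_def by blast
    have "\<exists>h\<in>K. near (B + length u) (val p) h"
    proof (cases "length p \<le> length r")
      case True
      then obtain r' where "r = p @ r'" using p(1) by (auto simp: append_eq_append_conv2)
      then have "pre (val p) g'" using reduced_pre red r(2) by blast
      then obtain h where "h \<in> K'" "near B (val p) h" using B g'(1) by blast
      then show ?thesis using near_mono[of B "val p" h "B + length u"] K'(2) by auto
    next
      case False
      then obtain u1 where u1: "p = r @ u1" "u = u1 @ t" using p(1) by (auto simp: append_eq_append_conv2)
      then have "u1 \<in> lists S" using u by simp
      then have "near (B + length u) (val p) g'"
        using u1 r(2) val_rev_right[of u1]
        by (intro near_I[of "rev u1"]) (auto simp: val_append comp_assoc)
      then show ?thesis using g'(1) K'(2) by blast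
    qed
    then show ?thesis using near_trans[OF p(2)] by blast
  qed
  then show ?thesis unfolding quasiconvex_def by blast
qed

text \<open>The elements of even length form a subgroup of index at most two, which contains no reflection
  and is generated by \<open>2 r - 1\<close> Schreier generators.\<close>

theorem quasiconvex_span_half:
  assumes k: "0 < k" and m: "\<And>a b. a \<in> S \<Longrightarrow> b \<in> S \<Longrightarrow> a \<noteq> b \<Longrightarrow> enat (3 * k + 1) \<le> m a b"
    and us: "set us \<subseteq> lists S" "2 * length us \<le> k + 1"
  shows "quasiconvex (span (set us))"
proof (cases "\<forall>u\<in>set us. even (length u)")
  case True
  then show ?thesis
    using quasiconvex_span[OF k m us(1)] us(2) even_span_no_reflection[OF us(1)] k by simp
next
  case False
  then obtain u0 where u0: "u0 \<in> set us" "odd (length u0)" by blast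
  have u0S: "u0 \<in> lists S" using u0(1) us(1) by blast
  \<comment> \<open>Schreier generators for the transversal 1, u0: an even u and its conjugate by
    u0, or an odd u corrected by u0 on either side.\<close>
  define sch where "sch u = (if even (length u) then [u, u0 @ u @ rev u0] else [u @ rev u0, u0 @ u])" for u
  \<comment> \<open>Of the two Schreier generators of u0 itself one is trivial and the other is u0
    u0, whence 1 + 2 (r - 1) \<le> k generators.\<close>
  define us' where "us' = (u0 @ u0) # concat (map sch (remove1 u0 us))"
  have "length (concat (map sch vs)) = 2 * length vs" for vs
    by (induction vs) (auto simp: sch_def)
  then have "length us' = 1 + 2 * (length us - 1)"
    using u0(1) by (simp add: us'_def length_remove1)
  then have len: "length us' \<le> k"
    using us(2) length_pos_if_in_set[OF u0(1)] by linarith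
  have sub: "set (remove1 u0 us) \<subseteq> set us" by (rule set_remove1_subset)
  have mem: "v \<in> set us' \<Longrightarrow> v = u0 @ u0 \<or> (\<exists>u\<in>set us. v \<in> set (sch u))" for v
    using sub by (auto simp: us'_def)
  have S': "set us' \<subseteq> lists S"
  proof
    fix v assume "v \<in> set us'"
    then show "v \<in> lists S" using mem[of v] us(1) u0S by (auto simp: sch_def split: if_splits)
  qed
  have ev: "even (length v)" if "v \<in> set us'" for v
    using mem[OF that] u0(2) by (auto simp: sch_def split: if_splits)
  let ?K = "span (set us)" and ?K' = "span (set us')"
  have qc: "quasiconvex ?K'"
    using quasiconvex_span[OF k m S' len] even_span_no_reflection[OF S' ev] by blast
  have gen: "val u \<in> ?K" "val (rev u) \<in> ?K" if "u \<in> set us" for u using span_gen that by auto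
  have "?K' \<subseteq> ?K"
  proof (rule span_concat)
    fix v assume v: "v \<in> set us'"
    show "val v \<in> ?K" using mem[OF v] gen u0(1) by (auto simp: sch_def split: if_splits intro!: span_append)
    show "val (rev v) \<in> ?K" using mem[OF v] gen u0(1) by (auto simp: sch_def split: if_splits intro!: span_append)
  qed
  \<comment> \<open>P describes the union of ?K' and its translate by u0. It is preserved by right
    multiplication with generators and their inverses, which yields the covering required by
    \<open>quasiconvex_translate\<close>.\<close>
  define P where "P h \<longleftrightarrow> h \<in> ?K' \<or> (\<exists>v. val v \<in> ?K' \<and> h = val (v @ u0))" for h
  have PI: "P (val (x @ y))" if xy: "val x \<in> ?K'" "P (val y)" for x y
  proof (cases "val y \<in> ?K'")
    case True
    then show ?thesis using span_append[OF xy(1)] P_def by blast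
  next
    case False
    then obtain v where v: "val v \<in> ?K'" "val y = val (v @ u0)" using xy(2) unfolding P_def by blast
    have "val (x @ y) = val ((x @ v) @ u0)" using v(2) by (simp add: val_append comp_assoc)
    then show ?thesis using span_append[OF xy(1) v(1)] P_def by blast
  qed
  have P1: "P (val y)" if "val y \<in> ?K'" for y using that by (simp add: P_def)
  have P2: "P (val y)" if "val (y @ rev u0) \<in> ?K'" for y
  proof -
    have "val y = val ((y @ rev u0) @ u0)" using val_cancel(2)[OF u0S, of y "[]"] by simp
    then show ?thesis using that unfolding P_def by blast
  qed
  have sg: "val v \<in> ?K'" "val (rev v) \<in> ?K'" if "v \<in> set (sch u)" "u \<in> set us" "u \<noteq> u0" for u v
  proof -
    have "v \<in> set us'" using that by (auto simp: us'_def)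
    then show "val v \<in> ?K'" "val (rev v) \<in> ?K'" using span_gen by auto
  qed
  have s0: "val (u0 @ u0) \<in> ?K'" "val (rev u0 @ rev u0) \<in> ?K'"
    using span_gen[of "u0 @ u0" "set us'"] by (auto simp: us'_def)
  have step: "P (val v) \<and> P (val (u0 @ v))" if v: "v \<in> set us \<union> rev ` set us" for v
  proof -
    obtain u where u: "u \<in> set us" "v = u \<or> v = rev u" using v by auto
    have can: "val (u0 @ rev u0) = id" "val ((u0 @ u0) @ rev u0) = val u0"
      using val_cancel(1)[OF u0S, of "[]" "[]"] val_cancel(1)[OF u0S, of u0 "[]"] by simp_all
    show ?thesis
    proof (cases "u = u0")
      case True
      have "P (val u0)" using P2[of u0] can(1) span_id by simp
      moreover have "P (val (u0 @ u0))" using P1 s0 by blast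
      moreover have "P (val (rev u0))" using P2[of "rev u0"] s0(2) by simp
      moreover have "P (val (u0 @ rev u0))" using P1[of "u0 @ rev u0"] can(1) span_id by simp
      ultimately show ?thesis using u(2) True by blast
    next
      case False
      note s = sg[OF _ u(1) False]
      show ?thesis
      proof (cases "even (length u)")
        case True
        have s1: "val u \<in> ?K'" "val (rev u) \<in> ?K'" using s[of u] True by (auto simp: sch_def)
        have s2: "val (u0 @ u @ rev u0) \<in> ?K'" "val (u0 @ rev u @ rev u0) \<in> ?K'"
          using s[of "u0 @ u @ rev u0"] True by (auto simp: sch_def)
        have "P (val (u0 @ u))" "P (val (u0 @ rev u))" using P2[of "u0 @ u"] P2[of "u0 @ rev u"] s2 by simp_all
        then show ?thesis using u(2) P1 s1 by blast
      next
        case odd: False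
        have s1: "val (u @ rev u0) \<in> ?K'" "val (u0 @ rev u) \<in> ?K'"
          using s[of "u @ rev u0"] odd by (auto simp: sch_def)
        have s2: "val (u0 @ u) \<in> ?K'" "val (rev u @ rev u0) \<in> ?K'"
          using s[of "u0 @ u"] odd by (auto simp: sch_def)
        have "P (val u)" "P (val (rev u))" using P2 s1(1) s2(2) by blast+
        then show ?thesis using u(2) P1 s1(2) s2(1) by blast
      qed
    qed
  qed
  have all: "P (val (concat vs))" if "vs \<in> lists (set us \<union> rev ` set us)" for vs
    using that
  proof (induction vs rule: rev_induct)
    case Nil
    then show ?case using span_id by (simp add: P_def)
  next
    case (snoc v vs)
    have IH: "P (val (concat vs))" and v: "v \<in> set us \<union> rev ` set us" using snoc by auto
    from IH show ?case unfolding P_def[of "val (concat vs)"]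
    proof (elim disjE exE conjE)
      assume "val (concat vs) \<in> ?K'"
      then show ?case using PI[of "concat vs" v] step[OF v] by simp
    next
      fix x assume x: "val x \<in> ?K'" "val (concat vs) = val (x @ u0)"
      have "val (concat (vs @ [v])) = val (x @ (u0 @ v))" using x(2) by (simp add: val_append comp_assoc)
      then show ?case using PI[OF x(1), of "u0 @ v"] step[OF v] by simp
    qed
  qed
  have "?K \<subseteq> ?K' \<union> (\<lambda>g. g \<circ> val u0) ` ?K'"
  proof
    fix h assume "h \<in> ?K"
    then obtain vs where "vs \<in> lists (set us \<union> rev ` set us)" "h = val (concat vs)"
      unfolding span_def by auto
    then have "P h" using all by simp
    then show "h \<in> ?K' \<union> (\<lambda>g. g \<circ> val u0) ` ?K'" unfolding P_def by (auto simp: val_append)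
  qed
  then show ?thesis using quasiconvex_translate[OF qc \<open>?K' \<subseteq> ?K\<close> _ u0S] span_W[OF S'] by blast
qed

end

section \<open>Transfer to the presented group\<close>

definition freely_reduced :: "('x \<times> bool) list \<Rightarrow> bool" where
  "freely_reduced u \<longleftrightarrow> (\<forall>p e c q. u \<noteq> p @ [(e, c), (e, \<not> c)] @ q)"

lemma pres_eq_freely_reduced:
  "u \<in> group_words X \<Longrightarrow> \<exists>r\<in>group_words X. pres_eq X R u r \<and> freely_reduced r"
proof (induction "length u" arbitrary: u rule: less_induct)
  case less
  show ?case
  proof (cases "freely_reduced u")
    case False
    then obtain p e c q where u: "u = p @ [(e, c), (e, \<not> c)] @ q" unfolding freely_reduced_def by blast
    have S: "p \<in> group_words X" "q \<in> group_words X" "e \<in> X" using less.prems u by auto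
    then have pq: "p @ q \<in> group_words X" by simp
    have "length (p @ q) < length u" using u by simp
    from less.hyps[OF this pq] obtain r where r: "r \<in> group_words X" "pres_eq X R (p @ q) r" "freely_reduced r"
      by blast
    have "pres_eq X R u (p @ q)" unfolding u using S by (rule pres_eq.cancel)
    then show ?thesis using r pres_eq.trans by blast
  next
    case True
    then show ?thesis using less.prems pres_eq.refl by blast
  qed
qed

text \<open>Injectivity comes from free reduction: if u and v have the same image, the reduced form
  of the inverse of u followed by v has trivial image, hence is empty. The letters belong to the
  element type of H, as \<open>free_group\<close> prescribes, but they are names only: \<phi>
  decides which elements they stand for.\<close>

lemma free_group_criterion:
  fixes H :: "('a, 'b) monoid_scheme" and X :: "'a set" and \<phi> :: "('a \<times> bool) list \<Rightarrow> 'a"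
  assumes H: "group H"
    and \<phi>: "\<And>u. u \<in> group_words X \<Longrightarrow> \<phi> u \<in> carrier H"
      "\<And>u v. u \<in> group_words X \<Longrightarrow> v \<in> group_words X \<Longrightarrow> \<phi> (u @ v) = \<phi> u \<otimes>\<^bsub>H\<^esub> \<phi> v"
      "\<And>x b. x \<in> X \<Longrightarrow> \<phi> [(x, b), (x, \<not> b)] = \<one>\<^bsub>H\<^esub>"
    and surj: "carrier H \<subseteq> \<phi> ` group_words X"
    and free: "\<And>u. u \<in> group_words X \<Longrightarrow> u \<noteq> [] \<Longrightarrow> freely_reduced u \<Longrightarrow> \<phi> u \<noteq> \<one>\<^bsub>H\<^esub>"
  shows "free_group H"
proof -
  interpret H: group H by fact
  let ?P = "presented_group X {}" and ?r = "\<lambda>u. pres_rel X {} `` {u}"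
  have phi0: "\<phi> [] = \<one>\<^bsub>H\<^esub>"
    using \<phi>(2)[of "[]" "[]"] \<phi>(1)[of "[]"] H.l_cancel_one' by force
  have resp: "\<phi> u = \<phi> v" if "pres_eq X {} u v" for u v
    using that
  proof induction
    case (cancel u v x b)
    have c: "[(x, b), (x, \<not> b)] \<in> group_words X" using cancel by simp
    have "\<phi> (u @ [(x, b), (x, \<not> b)] @ v) = \<phi> u \<otimes>\<^bsub>H\<^esub> (\<phi> [(x, b), (x, \<not> b)] \<otimes>\<^bsub>H\<^esub> \<phi> v)"
      using \<phi>(2) cancel c by (metis append_in_lists_conv)
    then show ?case using \<phi> cancel by simp
  qed auto
  have cls: "?r u = ?r v \<longleftrightarrow> pres_eq X {} u v" if "u \<in> group_words X" "v \<in> group_words X" for u v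
    using eq_equiv_class_iff[OF equiv_pres_rel that] by (simp add: pres_rel_def)
  have carr: "carrier ?P = ?r ` group_words X" by (auto simp: presented_group_def quotient_def)
  define f where "f C = \<phi> (SOME u. u \<in> group_words X \<and> ?r u = C)" for C
  have f: "f (?r u) = \<phi> u" if u: "u \<in> group_words X" for u
  proof -
    let ?v = "SOME v. v \<in> group_words X \<and> ?r v = ?r u"
    have "?v \<in> group_words X \<and> ?r ?v = ?r u" by (rule someI[of _ u]) (use u in simp)
    then have "pres_eq X {} ?v u" using cls u by blast
    then show ?thesis unfolding f_def by (rule resp)
  qed
  have inj: "pres_eq X {} u v" if u: "u \<in> group_words X" and v: "v \<in> group_words X" and e: "\<phi> u = \<phi> v" for u v
  proof -
    let ?i = "rev (map (\<lambda>(x, b). (x, \<not> b)) u)"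
    have i: "?i \<in> group_words X" by (rule inverse_word_closed[OF u])
    have iu: "pres_eq X {} (?i @ u) []" by (rule pres_eq_inverse[OF u])
    then have "\<phi> ?i \<otimes>\<^bsub>H\<^esub> \<phi> u = \<one>\<^bsub>H\<^esub>" using resp \<phi>(2)[OF i u] phi0 by metis
    then have 1: "\<phi> (?i @ v) = \<one>\<^bsub>H\<^esub>" using \<phi>(2)[OF i v] e by simp
    have iv: "?i @ v \<in> group_words X" using i v by simp
    obtain r where r: "r \<in> group_words X" "pres_eq X {} (?i @ v) r" "freely_reduced r"
      using pres_eq_freely_reduced[OF iv] by blast
    have "r = []" using free[OF r(1) _ r(3)] resp[OF r(2)] 1 by metis
    then have "pres_eq X {} (u @ ?i @ v) (u @ [])" using pres_eq_append_left[OF _ u] r(2) by blast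
    moreover have "pres_eq X {} ((u @ ?i) @ v) ([] @ v)"
    proof -
      have "pres_eq X {} (rev (map (\<lambda>(x, b). (x, \<not> b)) ?i) @ ?i) []" by (rule pres_eq_inverse[OF i])
      moreover have "rev (map (\<lambda>(x, b). (x, \<not> b)) ?i) = u"
        by (simp add: rev_map comp_apply case_prod_beta map_idI)
      ultimately show ?thesis using pres_eq_append_right[OF _ v] by metis
    qed
    ultimately show ?thesis using pres_eq.sym pres_eq.trans by fastforce
  qed
  have "f \<in> iso ?P H"
  proof (rule isoI)
    show "f \<in> hom ?P H"
    proof (rule homI)
      fix C assume "C \<in> carrier ?P"
      then obtain u where u: "u \<in> group_words X" "C = ?r u" using carr by blast
      then show "f C \<in> carrier H" using f \<phi>(1) by simp
      fix D assume "D \<in> carrier ?P"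
      then obtain v where v: "v \<in> group_words X" "D = ?r v" using carr by blast
      have "u @ v \<in> group_words X" using u v by simp
      then show "f (C \<otimes>\<^bsub>?P\<^esub> D) = f C \<otimes>\<^bsub>H\<^esub> f D"
        using presented_group_mult[OF u(1) v(1), of "{}"] u v f \<phi>(2) by simp
    qed
    show "bij_betw f (carrier ?P) (carrier H)"
      unfolding bij_betw_def
    proof
      show "inj_on f (carrier ?P)"
      proof (rule inj_onI)
        fix C D assume CD: "C \<in> carrier ?P" "D \<in> carrier ?P" "f C = f D"
        obtain u where u: "u \<in> group_words X" "C = ?r u" using CD(1) carr by blast
        obtain v where v: "v \<in> group_words X" "D = ?r v" using CD(2) carr by blast
        have "\<phi> u = \<phi> v" using CD(3) f u v by simp
        then show "C = D" using inj[OF u(1) v(1)] cls[OF u(1) v(1)] u(2) v(2) by blast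
      qed
      show "f ` carrier ?P = carrier H"
      proof (intro equalityI subsetI)
        fix h assume "h \<in> f ` carrier ?P"
        then show "h \<in> carrier H" using carr f \<phi>(1) by auto
      next
        fix h assume "h \<in> carrier H"
        then obtain u where u: "u \<in> group_words X" "h = \<phi> u" using surj by blast
        then have "h = f (?r u)" using f by simp
        then show "h \<in> f ` carrier ?P" using carr u(1) by blast
      qed
    qed
  qed
  then have "?P \<cong> H" by (rule is_isoI)
  then have "H \<cong> ?P" by (rule group.iso_sym[OF group_presented_group])
  then show ?thesis unfolding free_group_def using H by blast
qed

section \<open>The Coxeter presentation and its geometric representation\<close>

locale coxeter_presentation =
  fixes n :: nat and m :: "nat \<Rightarrow> nat \<Rightarrow> enat" and S :: "nat set"
  assumes S_eq: "S = {1..n}" and m4: "1 \<le> i \<Longrightarrow> i < j \<Longrightarrow> j \<le> n \<Longrightarrow> 4 \<le> m i j"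
begin

text \<open>Symmetric extension of the entries above the diagonal, in the form that
  \<open>coxeter\<close> expects; the diagonal value is a filler.\<close>

definition msym :: "nat \<Rightarrow> nat \<Rightarrow> enat" where
  "msym i j = (if i = j then \<infinity> else m (min i j) (max i j))"

sublocale coxeter S msym
proof
  fix i j assume "i \<in> S" "j \<in> S" "i \<noteq> j"
  then show "4 \<le> msym i j" using m4[of "min i j" "max i j"]
    by (auto simp: msym_def min_def max_def S_eq)
qed (auto simp: msym_def min.commute max.commute S_eq)

abbreviation "G \<equiv> coxeter_group n m"
abbreviation "Rel \<equiv> coxeter_relators n m"

text \<open>Unsigned words over S represent every element, because the generators are involutions;
  see \<open>pres_eq_positive\<close>.\<close>

definition emb :: "nat list \<Rightarrow> nat group_word" where
  "emb w = map (\<lambda>i. (i, True)) w"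

definition cls :: "nat list \<Rightarrow> nat group_word set" where
  "cls w = pres_rel S Rel `` {emb w}"

lemma emb_append: "emb (u @ v) = emb u @ emb v"
  by (simp add: emb_def)

lemma emb_words: "w \<in> lists S \<Longrightarrow> emb w \<in> group_words S"
  by (induction w) (auto simp: emb_def)

lemma G_eq: "G = presented_group S Rel"
  by (simp add: coxeter_group_def S_eq)

lemma group_G: "group G"
  unfolding G_eq by (rule group_presented_group)

lemma relatorI:
  "s \<in> S \<Longrightarrow> [(s, True), (s, True)] \<in> Rel"
  "a \<in> S \<Longrightarrow> b \<in> S \<Longrightarrow> a < b \<Longrightarrow> m a b = enat p \<Longrightarrow> concat (replicate p [(a, True), (b, True)]) \<in> Rel"
  unfolding coxeter_relators_def S_eq by auto

lemma relatorE:
  assumes "r \<in> Rel"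
  obtains s where "s \<in> S" "r = [(s, True), (s, True)]"
  | a b p where "a \<in> S" "b \<in> S" "a < b" "m a b = enat p" "r = concat (replicate p [(a, True), (b, True)])"
  using assms unfolding coxeter_relators_def S_eq by (elim UnE CollectE exE conjE) auto

sublocale G: group G
  by (rule group_G)

definition eqv :: "nat list \<Rightarrow> nat list \<Rightarrow> bool" where
  "eqv u v \<longleftrightarrow> pres_eq S Rel (emb u) (emb v)"

lemma emb_alt: "emb (alt i j (2 * p)) = concat (replicate p [(i, True), (j, True)])"
  by (induction p) (auto simp: emb_def)

lemma eqv_refl: "u \<in> lists S \<Longrightarrow> eqv u u"
  unfolding eqv_def by (rule pres_eq.refl[OF emb_words])

lemma eqv_sym: "eqv u v \<Longrightarrow> eqv v u"
  unfolding eqv_def by (rule pres_eq.sym)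

lemma eqv_trans: "eqv u v \<Longrightarrow> eqv v w \<Longrightarrow> eqv u w"
  unfolding eqv_def by (rule pres_eq.trans)

lemma eqv_relator:
  assumes "u \<in> lists S" "v \<in> lists S" "r \<in> lists S" "emb r \<in> Rel"
  shows "eqv (u @ r @ v) (u @ v)"
  unfolding eqv_def emb_append by (rule pres_eq.relator) (use assms emb_words in auto)

lemma eqv_square:
  assumes "u \<in> lists S" "v \<in> lists S" "s \<in> S" shows "eqv (u @ [s, s] @ v) (u @ v)"
  by (rule eqv_relator) (use assms relatorI(1) in \<open>auto simp: emb_def\<close>)

lemma eqv_append:
  assumes "eqv u v" "w \<in> lists S" shows "eqv (u @ w) (v @ w)" "eqv (w @ u) (w @ v)"
  using pres_eq_append_right[OF assms(1)[unfolded eqv_def] emb_words[OF assms(2)]]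
    pres_eq_append_left[OF assms(1)[unfolded eqv_def] emb_words[OF assms(2)]]
  by (simp_all add: eqv_def emb_append)

lemma eqv_cancel: "w \<in> lists S \<Longrightarrow> v \<in> lists S \<Longrightarrow> eqv (rev w @ w @ v) v"
proof (induction w)
  case Nil
  then show ?case by (simp add: eqv_refl)
next
  case (Cons s w)
  then have "eqv (rev w @ [s, s] @ (w @ v)) (rev w @ (w @ v))" by (intro eqv_square) auto
  then show ?case using Cons eqv_trans by auto
qed

lemma eqv_braid:
  assumes ab: "a \<in> S" "b \<in> S" "a \<noteq> b" and q: "msym a b = enat q"
  shows "eqv (alt a b q) (alt b a q)"
proof -
  have main: "eqv (alt a b q) (alt b a q)"
    if ab: "a \<in> S" "b \<in> S" "a < b" and q: "msym a b = enat q" for a b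
  proof -
    have S: "alt a b l \<in> lists S" "alt b a l \<in> lists S" for l using ab by (auto intro: alt_in_lists)
    have "m a b = enat q" using q ab(3) by (simp add: msym_def min_def max_def)
    then have "emb (alt a b (2 * q)) \<in> Rel"
      unfolding emb_alt using ab relatorI(2) by blast
    then have "eqv ([] @ alt a b (2 * q) @ alt b a q) ([] @ alt b a q)" by (intro eqv_relator) (use S in auto)
    moreover have "alt a b (2 * q) = alt a b q @ rev (alt b a q)"
      unfolding mult_2 alt_add rev_alt by simp
    ultimately have 1: "eqv (alt a b q @ rev (alt b a q) @ alt b a q) (alt b a q)" by simp
    have "eqv (alt a b q @ (rev (alt b a q) @ alt b a q @ [])) (alt a b q @ [])"
      by (rule eqv_append(2)[OF eqv_cancel]) (use S in auto)
    then have 2: "eqv (alt a b q @ rev (alt b a q) @ alt b a q) (alt a b q)" by simp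
    show ?thesis by (rule eqv_trans[OF eqv_sym[OF 2] 1])
  qed
  show ?thesis
  proof (cases "a < b")
    case True
    then show ?thesis using main ab q by blast
  next
    case False
    then show ?thesis using main[of b a] ab q m_sym[of a b] eqv_sym by auto
  qed
qed

lemma val_eq_imp_eqv:
  assumes "u \<in> lists S" "v \<in> lists S" "val u = val v" shows "eqv u v"
proof (rule val_eq_equivalent[of eqv, OF eqv_refl eqv_sym eqv_trans])
  show "eqv (u @ [s]) (v @ [s])" if "s \<in> S" "eqv u v" for u v s
    using eqv_append(1)[OF that(2), of "[s]"] that(1) by simp
  show "eqv (u @ alt a b q) (u @ alt b a q)"
    if "u \<in> lists S" "a \<in> S" "b \<in> S" "a \<noteq> b" "msym a b = enat q" for u a b q
    by (rule eqv_append(2)[OF eqv_braid]) (use that in auto)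
  show "eqv (u @ [s, s]) u" if "u \<in> lists S" "s \<in> S" for u s
    using eqv_square[of u "[]" s] that by simp
qed (use assms in auto)

text \<open>Signs can be forgotten because each reflection is its own inverse; both kinds of
  relators act trivially.\<close>

lemma pres_eq_imp_val_eq:
  "pres_eq S Rel x y \<Longrightarrow> val (map fst x) = val (map fst y)"
proof (induction rule: pres_eq.induct)
  case (cancel u v x b)
  then show ?case using val_cancel(1)[of "[x]" "map fst u" "map fst v"] by simp
next
  case (relator u v r)
  have "val (map fst r) = id"
    using relator(3)
  proof (cases rule: relatorE)
    case (1 s)
    then show ?thesis by simp
  next
    case (2 a b p)
    have "map fst r = alt a b (2 * p)"
      unfolding 2(5) emb_alt[symmetric] by (simp add: emb_def comp_def)
    moreover have "msym a b = enat p" using 2 by (simp add: msym_def min_def max_def)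
    ultimately show ?thesis using val_alt_relator[of a b p] 2 by simp
  qed
  then show ?case by (simp add: val_append)
qed auto

lemma map_fst_emb: "map fst (emb w) = w"
  by (simp add: emb_def comp_def)

text \<open>The bridge to the geometric representation: relators act trivially, and conversely
  \<open>val_eq_equivalent\<close> turns equal maps into equal classes.\<close>

lemma cls_eq_iff:
  assumes "u \<in> lists S" "v \<in> lists S" shows "cls u = cls v \<longleftrightarrow> val u = val v"
proof -
  have "cls u = cls v \<longleftrightarrow> eqv u v"
    unfolding cls_def eqv_def using eq_equiv_class_iff[OF equiv_pres_rel emb_words emb_words] assms
    by (simp add: pres_rel_def)
  also have "\<dots> \<longleftrightarrow> val u = val v"
    using val_eq_imp_eqv[OF assms] pres_eq_imp_val_eq[of "emb u" "emb v"]
    unfolding eqv_def map_fst_emb by blast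
  finally show ?thesis .
qed

lemma pres_eq_positive:
  "x \<in> group_words S \<Longrightarrow> pres_eq S Rel x (emb (map fst x))"
proof (induction x)
  case Nil
  then show ?case by (auto simp: emb_def intro: pres_eq.refl)
next
  case (Cons a x)
  obtain i b where a: "a = (i, b)" by (cases a)
  have i: "i \<in> S" and x: "x \<in> group_words S" using Cons.prems a by auto
  have 1: "pres_eq S Rel [(i, b)] [(i, True)]"
  proof (cases b)
    case True
    then show ?thesis using i by (auto intro: pres_eq.refl)
  next
    case False
    \<comment> \<open>The inverse letter may be followed by the relator i i, and then cancels
      against its first letter.\<close>
    have "pres_eq S Rel ([(i, False)] @ [(i, True), (i, True)] @ []) ([(i, False)] @ [])"
      by (rule pres_eq.relator) (use i relatorI(1) in auto)
    moreover have "pres_eq S Rel ([] @ [(i, False), (i, \<not> False)] @ [(i, True)]) ([] @ [(i, True)])"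
      by (rule pres_eq.cancel) (use i in auto)
    ultimately show ?thesis using False pres_eq.sym pres_eq.trans by fastforce
  qed
  have "pres_eq S Rel ([(i, b)] @ x) ([(i, True)] @ x)" by (rule pres_eq_append_right[OF 1 x])
  moreover have "pres_eq S Rel ([(i, True)] @ x) ([(i, True)] @ emb (map fst x))"
    by (rule pres_eq_append_left[OF Cons.IH[OF x]]) (use i in auto)
  ultimately show ?case using pres_eq.trans a by (simp add: emb_def)
qed

lemma carrier_G: "carrier G = cls ` lists S"
proof (intro equalityI subsetI)
  fix g assume "g \<in> carrier G"
  then obtain x where x: "x \<in> group_words S" "g = pres_rel S Rel `` {x}"
    by (auto simp: G_eq presented_group_def quotient_def)
  have "(x, emb (map fst x)) \<in> pres_rel S Rel" using pres_eq_positive[OF x(1)] by (simp add: pres_rel_def)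
  then have "g = cls (map fst x)" using equiv_class_eq[OF equiv_pres_rel] x(2) by (simp add: cls_def)
  moreover have "map fst x \<in> lists S" using x(1) by (auto simp: in_lists_conv_set)
  ultimately show "g \<in> cls ` lists S" by blast
next
  fix g assume "g \<in> cls ` lists S"
  then obtain w where "w \<in> lists S" "g = cls w" by blast
  then show "g \<in> carrier G"
    using emb_words[of w] by (auto simp: G_eq presented_group_def quotient_def cls_def)
qed

lemma cls_carrier [simp]: "w \<in> lists S \<Longrightarrow> cls w \<in> carrier G"
  by (simp add: carrier_G)

lemma cls_mult: "u \<in> lists S \<Longrightarrow> v \<in> lists S \<Longrightarrow> cls u \<otimes>\<^bsub>G\<^esub> cls v = cls (u @ v)"
  unfolding G_eq cls_def emb_append by (rule presented_group_mult) (auto intro: emb_words)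

lemma cls_one: "\<one>\<^bsub>G\<^esub> = cls []"
  by (simp add: G_eq presented_group_def cls_def emb_def)

lemma cls_inv:
  assumes "u \<in> lists S" shows "inv\<^bsub>G\<^esub> (cls u) = cls (rev u)"
proof (rule G.inv_equality)
  have "cls (rev u @ u) = cls []" using assms val_rev_left[OF assms] by (simp add: cls_eq_iff val_append)
  then show "cls (rev u) \<otimes>\<^bsub>G\<^esub> cls u = \<one>\<^bsub>G\<^esub>" using assms by (simp add: cls_mult cls_one)
qed (use assms in auto)

lemma cls_gen: "coxeter_gen n m i = cls [i]"
  by (simp only: coxeter_gen_def cls_def emb_def S_eq[symmetric] list.map)

lemma cls_pow: "w \<in> lists S \<Longrightarrow> cls w [^]\<^bsub>G\<^esub> (l::nat) = cls (concat (replicate l w))"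
proof (induction l)
  case 0
  then show ?case by (simp add: cls_one)
next
  case (Suc l)
  have "concat (replicate l w) \<in> lists S" using Suc.prems by (induction l) auto
  moreover have "concat (replicate l w) @ w = w @ concat (replicate l w)" by (induction l) auto
  ultimately show ?case using Suc by (simp add: cls_mult)
qed

lemma generate_span:
  assumes U: "U \<subseteq> lists S" and w: "w \<in> lists S"
  shows "cls w \<in> generate G (cls ` U) \<longleftrightarrow> val w \<in> span U"
proof
  have "\<exists>vs\<in>lists (U \<union> rev ` U). g = cls (concat vs)" if "g \<in> generate G (cls ` U)" for g
    using that
  proof induction
    case one
    then show ?case by (intro bexI[of _ "[]"]) (auto simp: cls_one)
  next
    case (incl h)
    then obtain u where "u \<in> U" "h = cls u" by blast
    then show ?case by (intro bexI[of _ "[u]"]) auto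
  next
    case (inv h)
    then obtain u where "u \<in> U" "h = cls u" by blast
    then show ?case using U cls_inv[of u] by (intro bexI[of _ "[rev u]"]) auto
  next
    case (eng h1 h2)
    then obtain vs1 vs2 where vs: "vs1 \<in> lists (U \<union> rev ` U)" "h1 = cls (concat vs1)"
      "vs2 \<in> lists (U \<union> rev ` U)" "h2 = cls (concat vs2)" by blast
    then show ?case using concat_in_lists[OF _ U] cls_mult by (intro bexI[of _ "vs1 @ vs2"]) auto
  qed
  moreover assume "cls w \<in> generate G (cls ` U)"
  ultimately obtain vs where "vs \<in> lists (U \<union> rev ` U)" "cls w = cls (concat vs)" by blast
  then show "val w \<in> span U"
    using cls_eq_iff[OF w] concat_in_lists[OF _ U] unfolding span_def by blast
next
  assume "val w \<in> span U"
  then obtain vs where vs: "vs \<in> lists (U \<union> rev ` U)" "val w = val (concat vs)" unfolding span_def by auto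
  have "cls (concat vs) \<in> generate G (cls ` U)"
    using vs(1)
  proof (induction vs)
    case Nil
    then show ?case using generate.one[of G "cls ` U"] by (simp add: cls_one)
  next
    case (Cons v vs)
    have v: "v \<in> lists S" using Cons.hyps(1) U by auto
    have "cls v \<in> generate G (cls ` U)"
      using Cons.hyps(1)
    proof
      assume "v \<in> U"
      then show ?thesis by (intro generate.incl) blast
    next
      assume "v \<in> rev ` U"
      then obtain u where u: "u \<in> U" "v = rev u" by blast
      then have "cls v = inv\<^bsub>G\<^esub> (cls u)" using cls_inv[of u] U by auto
      then show ?thesis using u(1) generate.inv[of "cls u" "cls ` U" G] by simp
    qed
    then have "cls v \<otimes>\<^bsub>G\<^esub> cls (concat vs) \<in> generate G (cls ` U)" using Cons.IH generate.eng by metis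
    then show ?case using cls_mult[OF v] concat_in_lists[OF Cons.hyps(2) U] by simp
  qed
  then show "cls w \<in> generate G (cls ` U)"
    using cls_eq_iff[OF w concat_in_lists[OF vs(1) U]] vs(2) by simp
qed

lemma generated_obtain:
  assumes "generated_by_at_most G c H"
  obtains us where "set us \<subseteq> lists S" "real (length us) \<le> c" "subgroup H G"
    "\<And>w. w \<in> lists S \<Longrightarrow> cls w \<in> H \<longleftrightarrow> val w \<in> span (set us)"
proof -
  obtain A where A: "A \<subseteq> carrier G" "finite A" "real (card A) \<le> c" "H = generate G A"
    using assms unfolding generated_by_at_most_def by blast
  define wd where "wd g = (SOME w. w \<in> lists S \<and> cls w = g)" for g
  have wd: "wd g \<in> lists S \<and> cls (wd g) = g" if "g \<in> A" for g
  proof -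
    have "g \<in> cls ` lists S" using that A(1) carrier_G by auto
    then obtain w where "w \<in> lists S \<and> cls w = g" by auto
    then show ?thesis unfolding wd_def by (rule someI)
  qed
  obtain gs where gs: "set gs = A" "distinct gs" using finite_distinct_list[OF A(2)] by blast
  let ?us = "map wd gs"
  have us: "set ?us \<subseteq> lists S" using wd gs by auto
  have "cls ` set ?us = (\<lambda>g. cls (wd g)) ` A" using gs(1) by (simp add: image_image)
  also have "\<dots> = (\<lambda>g. g) ` A" using wd by (intro image_cong) auto
  finally have cA: "cls ` set ?us = A" by simp
  have "real (length ?us) \<le> c" using gs A(3) distinct_card[OF gs(2)] by simp
  moreover have "subgroup H G" using G.generate_is_subgroup[OF A(1)] A(4) by simp
  moreover have "cls w \<in> H \<longleftrightarrow> val w \<in> span (set ?us)" if "w \<in> lists S" for w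
    using generate_span[OF us that] cA A(4) by simp
  ultimately show ?thesis using that us by blast
qed

section \<open>The word metric of the standard generators\<close>

definition gens :: "nat group_word set set" where
  "gens = (\<lambda>i. cls [i]) ` S"

lemma letters_gens: "letters G gens = gens"
  unfolding letters_def gens_def by (auto simp: cls_inv)

lemma lists_gens: "lists gens = map (\<lambda>i. cls [i]) ` lists S"
  unfolding gens_def by (rule lists_image)

lemma word_val_gens: "v \<in> lists S \<Longrightarrow> word_val G (map (\<lambda>i. cls [i]) v) = cls v"
proof (induction v)
  case Nil
  then show ?case by (simp add: word_val_def cls_one id_apply)
next
  case (Cons i v)
  have "word_val G (map (\<lambda>i. cls [i]) (i # v)) = cls [i] \<otimes>\<^bsub>G\<^esub> word_val G (map (\<lambda>i. cls [i]) v)"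
    by (simp add: word_val_def comp_apply)
  then show ?case using Cons cls_mult[of "[i]" v] by simp
qed

lemma word_length_gens:
  assumes w: "w \<in> lists S" shows "word_length G gens (cls w) = len (val w)"
proof -
  have "(\<exists>x\<in>lists gens. length x = l \<and> word_val G x = cls w) \<longleftrightarrow>
    (\<exists>v\<in>lists S. length v = l \<and> val v = val w)" for l
    unfolding lists_gens using word_val_gens cls_eq_iff[OF _ w] by auto
  then show ?thesis unfolding word_length_def len_def letters_gens by simp
qed

text \<open>Geodesic words in the standard generators are the reduced words, so their prefixes lie
  below the end point in the weak order. The nearby element of K supplied by quasiconvexity is at
  the same word distance by left invariance.\<close>

lemma quasiconvex_subgroup_G:
  assumes H: "subgroup H G" and qc: "quasiconvex K"
    and HK: "\<And>w. w \<in> lists S \<Longrightarrow> cls w \<in> H \<longleftrightarrow> val w \<in> K"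
  shows "quasiconvex_subgroup H G"
proof -
  obtain B where B: "\<And>g x. g \<in> K \<Longrightarrow> pre x g \<Longrightarrow> \<exists>h\<in>K. near B x h" using qc unfolding quasiconvex_def by blast
  have gen: "generate G gens = carrier G"
  proof
    show "generate G gens \<subseteq> carrier G" by (rule G.generate_incl) (auto simp: gens_def)
    show "carrier G \<subseteq> generate G gens"
    proof
      fix g assume "g \<in> carrier G"
      then obtain w where w: "w \<in> lists S" "g = cls w" using carrier_G by blast
      have "val w \<in> span ((\<lambda>i. [i]) ` S)"
      proof -
        have "map (\<lambda>i. [i]) w \<in> lists ((\<lambda>i. [i]) ` S)" using w(1) by (induction w) auto
        then have "map (\<lambda>i. [i]) w \<in> lists ((\<lambda>i. [i]) ` S \<union> rev ` (\<lambda>i. [i]) ` S)"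
          using lists_mono[OF Un_upper1] by blast
        moreover have "concat (map (\<lambda>i. [i]) w) = w" by (induction w) auto
        ultimately show ?thesis unfolding span_def by (metis (mono_tags, lifting) mem_Collect_eq)
      qed
      moreover have "(\<lambda>i. [i]) ` S \<subseteq> lists S" by auto
      moreover have "cls ` (\<lambda>i. [i]) ` S = gens" by (auto simp: gens_def)
      ultimately show "g \<in> generate G gens" using generate_span[OF _ w(1)] w(2) by metis
    qed
  qed
  have close: "\<exists>h\<in>H. word_dist G gens (word_val G (take i w)) h \<le> B"
    if w: "geodesic_word G gens w" "word_val G w \<in> H" for w i
  proof -
    obtain v where v: "v \<in> lists S" "w = map (\<lambda>i. cls [i]) v"
      using w(1) unfolding geodesic_word_def letters_gens lists_gens by blast
    have red: "reduced v"
      using w(1) word_val_gens[OF v(1)] word_length_gens[OF v(1)] v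
      by (simp add: geodesic_word_def reduced_def)
    have t: "take i v \<in> lists S" using v(1) set_take_subset[of i v] by (auto simp: in_lists_conv_set)
    have wt: "word_val G (take i w) = cls (take i v)" using word_val_gens[OF t] v(2) by (simp add: take_map)
    have "val v \<in> K" using w(2) v word_val_gens HK by simp
    moreover have "pre (val (take i v)) (val v)"
      using reduced_pre[of "take i v" "drop i v"] red by simp
    ultimately obtain h where h: "h \<in> K" "near B (val (take i v)) h" using B by blast
    then obtain u where u: "u \<in> lists S" "length u \<le> B" "h = val (take i v) \<circ> val u"
      unfolding near_def by blast
    have tu: "take i v @ u \<in> lists S" using t u(1) by simp
    have "cls (take i v @ u) \<in> H" using HK[OF tu] h(1) u(3) by (simp add: val_append)
    moreover have "word_dist G gens (word_val G (take i w)) (cls (take i v @ u)) \<le> B"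
    proof -
      have "word_dist G gens (word_val G (take i w)) (cls (take i v @ u))
        = word_length G gens (cls (rev (take i v) @ take i v @ u))"
        using t u(1) cls_mult[of "rev (take i v)" "take i v @ u"] by (simp add: word_dist_def wt cls_inv)
      also have "\<dots> = len (val (rev (take i v) @ take i v @ u))"
        using t u(1) by (intro word_length_gens) simp
      also have "\<dots> = len (val u)" using val_cancel(2)[OF t, of "[]" u] by simp
      also have "\<dots> \<le> B" using len_val_le[OF u(1)] u(2) by simp
      finally show ?thesis .
    qed
    ultimately show ?thesis by blast
  qed
  have "finite gens" "gens \<subseteq> carrier G" using finite_S by (auto simp: gens_def)
  then show ?thesis
    unfolding quasiconvex_subgroup_def using H gen close
    by (intro conjI exI[of _ gens] exI[of _ B] allI impI) auto
qed


lemma torsion_free_val: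
  assumes H: "subgroup H G" and HK: "\<And>w. w \<in> lists S \<Longrightarrow> cls w \<in> H \<longleftrightarrow> val w \<in> K"
    and tf: "torsion_free (G\<lparr>carrier := H\<rparr>)"
    and w: "w \<in> lists S" "val w \<in> K" "0 < l" "val (concat (replicate l w)) = id"
  shows "val w = id"
proof -
  have rep: "concat (replicate l w) \<in> lists S" for l using w(1) by (induction l) auto
  have "cls w \<in> H" using HK w(1,2) by simp
  moreover have "cls w [^]\<^bsub>G\<lparr>carrier := H\<rparr>\<^esub> l = \<one>\<^bsub>G\<lparr>carrier := H\<rparr>\<^esub>"
  proof -
    have "cls w [^]\<^bsub>G\<lparr>carrier := H\<rparr>\<^esub> l = cls w [^]\<^bsub>G\<^esub> l" using G.nat_pow_consistent by metis
    also have "\<dots> = cls (concat (replicate l w))" by (rule cls_pow[OF w(1)])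
    also have "\<dots> = cls []" using cls_eq_iff[OF rep, of "[]"] w(4) by simp
    finally show ?thesis by (simp add: cls_one)
  qed
  ultimately have "cls w = cls []" using tf w(3) unfolding torsion_free_def by (auto simp: cls_one)
  then show ?thesis using cls_eq_iff[OF w(1), of "[]"] by simp
qed

text \<open>The basis consists of the loops of the edges outside the spanning tree, conjugated by
  c.\<close>

lemma free_subgroup:
  assumes H: "subgroup H G" and HK: "\<And>w. w \<in> lists S \<Longrightarrow> cls w \<in> H \<longleftrightarrow> val w \<in> K"
    and tf: "torsion_free (G\<lparr>carrier := H\<rparr>)" and mg: "minimal_graph S msym K k V E"
  shows "free_group (G\<lparr>carrier := H\<rparr>)"
proof -
  interpret minimal_graph S msym K k V E by (rule mg)
  let ?H = "G\<lparr>carrier := H\<rparr>"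
  obtain c where c: "c \<in> lists S" "K = {val (c @ w @ rev c) |w. walk E base w base}"
    using represents_at[OF graph(1,2) base] .
  \<comment> \<open>\<open>free_group\<close> takes its letters from the type of group elements, so
    each edge is coded injectively as a singleton set of words. These sets are names; the elements
    they stand for are given by \<phi>.\<close>
  define code where "code e = (case e of (x, s, y) \<Rightarrow> {[(x, True), (s, True), (y, True)]})"
    for e :: "vert \<times> nat \<times> vert"
  have code_inj: "inj code" by (auto simp: inj_def code_def)
  define dec where "dec = map (\<lambda>(x, b). (inv_into UNIV code x, b :: bool))"
  define enc where "enc = map (\<lambda>(e, b). (code e, b :: bool))"
  define X where "X = code ` free_edges"
  have dec_enc: "dec (enc zs) = zs" for zs
    by (induction zs) (auto simp: dec_def enc_def inv_f_f[OF code_inj])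
  have enc_dec: "u = enc (dec u)" if "u \<in> group_words X" for u
    using that by (induction u) (auto simp: dec_def enc_def X_def inv_f_f[OF code_inj])
  have dec_lists: "dec u \<in> lists (free_edges \<times> UNIV)" if "u \<in> group_words X" for u
    using that by (induction u) (auto simp: dec_def X_def inv_f_f[OF code_inj])
  have enc_lists: "enc zs \<in> group_words X" if "zs \<in> lists (free_edges \<times> UNIV)" for zs
    using that by (induction zs) (auto simp: enc_def X_def)
  define \<phi> where "\<phi> u = cls (c @ loops (dec u) @ rev c)" for u
  have lw: "walk E base (loops (dec u)) base" if "u \<in> group_words X" for u
    using loops_closed_walk dec_lists that by blast
  have lS: "loops (dec u) \<in> lists S" if "u \<in> group_words X" for u
    using walk_labels[OF lw[OF that] gd(3)] .
  have id_iff: "\<phi> u = \<one>\<^bsub>?H\<^esub> \<longleftrightarrow> val (loops (dec u)) = id" if u: "u \<in> group_words X" for u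
  proof -
    let ?l = "loops (dec u)"
    have "\<phi> u = \<one>\<^bsub>?H\<^esub> \<longleftrightarrow> val (c @ ?l @ rev c) = id"
      using cls_eq_iff[of "c @ ?l @ rev c" "[]"] c(1) lS[OF u] by (simp add: \<phi>_def cls_one)
    also have "\<dots> \<longleftrightarrow> val ?l = id"
    proof
      assume e: "val (c @ ?l @ rev c) = id"
      have "val ?l = val (rev c @ (c @ ?l @ rev c) @ c)"
        using val_cancel(2)[OF c(1), of "[]" "?l @ rev c @ c"] val_cancel(2)[OF c(1), of ?l "[]"] by simp
      also have "\<dots> = val (rev c) \<circ> val (c @ ?l @ rev c) \<circ> val c" by (simp only: val_append comp_assoc)
      finally show "val ?l = id" using e val_rev_left[OF c(1)] by simp
    next
      assume "val ?l = id"
      then show "val (c @ ?l @ rev c) = id" using val_rev_right[OF c(1)] by (simp add: val_append)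
    qed
    finally show ?thesis .
  qed
  show ?thesis
  proof (rule free_group_criterion[where X = X and \<phi> = \<phi>])
    show "group ?H" using subgroup.subgroup_is_group[OF H group_G] .
    show "\<phi> u \<in> carrier ?H" if "u \<in> group_words X" for u
    proof -
      have "val (c @ loops (dec u) @ rev c) \<in> K" using c(2) lw[OF that] by blast
      then show ?thesis using HK[of "c @ loops (dec u) @ rev c"] c(1) lS[OF that] by (simp add: \<phi>_def)
    qed
    show "\<phi> (u @ v) = \<phi> u \<otimes>\<^bsub>?H\<^esub> \<phi> v" if "u \<in> group_words X" "v \<in> group_words X" for u v
    proof -
      let ?u = "loops (dec u)" and ?v = "loops (dec v)"
      have uv: "loops (dec (u @ v)) = ?u @ ?v" by (simp add: dec_def loops_def)
      have "\<phi> u \<otimes>\<^bsub>?H\<^esub> \<phi> v = cls ((c @ ?u @ rev c) @ (c @ ?v @ rev c))"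
        using c(1) lS that cls_mult[of "c @ ?u @ rev c" "c @ ?v @ rev c"] by (simp add: \<phi>_def)
      also have "\<dots> = cls (c @ (?u @ ?v) @ rev c)"
        using c(1) lS that val_cancel(2)[OF c(1), of "c @ ?u" "?v @ rev c"] by (subst cls_eq_iff) auto
      finally show ?thesis by (simp add: \<phi>_def uv)
    qed
    show "\<phi> [(x, b), (x, \<not> b)] = \<one>\<^bsub>?H\<^esub>" if x: "x \<in> X" for x b
    proof -
      obtain e where e: "e \<in> free_edges" "x = code e" using x by (auto simp: X_def)
      obtain p s q where o: "orient (e, b) = (p, s, q)" by (metis prod_cases3)
      have o': "orient (e, \<not> b) = (q, s, p)" using o by (cases e; cases b) auto
      have pq: "(p, s, q) \<in> E" using orient_edge[OF e(1), of b] o by simp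
      let ?l = "tree_word p @ [s] @ rev (tree_word q)"
      have "?l \<in> lists S" using pq gd(3) tree_word_lists by auto
      moreover have "loops (dec [(x, b), (x, \<not> b)]) = ?l @ rev ?l"
        using o o' by (simp add: dec_def e(2) inv_f_f[OF code_inj] loops_def comp_apply[of edge_loop])
      ultimately have "val (loops (dec [(x, b), (x, \<not> b)])) = id"
        using val_rev_right[of ?l] by (simp only: val_append)
      then show ?thesis using id_iff[of "[(x, b), (x, \<not> b)]"] x by simp
    qed
    show "carrier ?H \<subseteq> \<phi> ` group_words X"
    proof
      fix h assume "h \<in> carrier ?H"
      then have h: "h \<in> H" by simp
      then have "h \<in> carrier G" using subgroup.subset[OF H] by blast
      then obtain w where w: "w \<in> lists S" "h = cls w" using carrier_G by blast
      then have "val w \<in> K" using HK h by simp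
      then obtain w' where w': "walk E base w' base" "val w = val (c @ w' @ rev c)" using c(2) by blast
      obtain zs where zs: "zs \<in> lists (free_edges \<times> UNIV)" "val w' = val (loops zs)"
        using loops_span[OF w'(1)] by (auto simp: tree_word_base)
      have u: "enc zs \<in> group_words X" using enc_lists zs(1) by blast
      have "val w = val (c @ loops zs @ rev c)" using w'(2) zs(2) by (simp add: val_append)
      moreover have "c @ loops zs @ rev c \<in> lists S" using lS[OF u] c(1) by (simp add: dec_enc)
      ultimately have "h = \<phi> (enc zs)" using w cls_eq_iff[OF w(1)] by (simp add: \<phi>_def dec_enc)
      then show "h \<in> \<phi> ` group_words X" using u by blast
    qed
    show "\<phi> u \<noteq> \<one>\<^bsub>?H\<^esub>" if u: "u \<in> group_words X" "u \<noteq> []" "freely_reduced u" for u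
    proof -
      have "dec u \<noteq> p @ [(e, b), (e, \<not> b)] @ q" for p e b q
      proof
        assume "dec u = p @ [(e, b), (e, \<not> b)] @ q"
        then have "u = enc p @ [(code e, b), (code e, \<not> b)] @ enc q"
          using enc_dec[OF u(1)] by (simp add: enc_def)
        then show False using u(3) unfolding freely_reduced_def by blast
      qed
      moreover have "dec u \<noteq> []" using u(2) by (simp add: dec_def)
      ultimately have "val (loops (dec u)) \<noteq> id"
        using loops_free[OF _ dec_lists[OF u(1)]] torsion_free_val[OF H HK tf] by blast
      then show ?thesis using id_iff[OF u(1)] by blast
    qed
  qed
qed

section \<open>The three statements in the presented group\<close>

context
  fixes k :: nat
  assumes k_pos: "0 < k"
    and m_ge: "\<And>i j. 1 \<le> i \<Longrightarrow> i < j \<Longrightarrow> j \<le> n \<Longrightarrow> enat (3 * k + 1) \<le> m i j"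
begin

lemma msym_ge: "a \<in> S \<Longrightarrow> b \<in> S \<Longrightarrow> a \<noteq> b \<Longrightarrow> enat (3 * k + 1) \<le> msym a b"
  using m_ge[of "min a b" "max a b"] by (auto simp: msym_def min_def max_def S_eq)

lemma torsion_free_subgroups:
  assumes gen: "generated_by_at_most G (real k) H" and tf: "torsion_free (G\<lparr>carrier := H\<rparr>)"
  shows "free_group (G\<lparr>carrier := H\<rparr>) \<and> quasiconvex_subgroup H G"
proof -
  obtain us where us: "set us \<subseteq> lists S" "real (length us) \<le> real k" "subgroup H G"
    "\<And>w. w \<in> lists S \<Longrightarrow> cls w \<in> H \<longleftrightarrow> val w \<in> span (set us)" using generated_obtain[OF gen] by metis
  have len: "length us \<le> k" using us(2) by simp
  \<comment> \<open>A conjugate of a generator has trivial square, so torsion-freeness would make it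
    trivial, against the odd length of its word.\<close>
  have nr: "val (c @ [s] @ rev c) \<notin> span (set us)" if cs: "c \<in> lists S" "s \<in> S" for c s
  proof
    let ?w = "c @ [s] @ rev c"
    assume K: "val ?w \<in> span (set us)"
    have w: "?w \<in> lists S" using cs by simp
    have "val (?w @ rev ?w) = id" using val_rev_right[OF w] by (simp only: val_append)
    then have "val (concat (replicate 2 ?w)) = id" by (simp add: numeral_2_eq_2)
    then have "val ?w = id" using torsion_free_val[OF us(3,4) tf w K, of 2] by simp
    then have "even (length ?w)" using val_eq_parity[OF w, of "[]"] by simp
    then show False by simp
  qed
  obtain V E where "minimal_graph S msym (span (set us)) k V E"
    using minimal_graph_exists[OF k_pos msym_ge us(1) len nr] by blast
  then have "free_group (G\<lparr>carrier := H\<rparr>)" using free_subgroup[OF us(3,4) tf] by blast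
  moreover have "quasiconvex (span (set us))" using k_pos msym_ge us(1) len nr by (rule quasiconvex_span)
  ultimately show ?thesis using quasiconvex_subgroup_G[OF us(3) _ us(4)] by blast
qed

lemma reflection_free_subgroups:
  assumes gen: "generated_by_at_most G (real k) H"
    and nc: "\<And>i g. i \<in> S \<Longrightarrow> g \<in> carrier G \<Longrightarrow> g \<otimes>\<^bsub>G\<^esub> coxeter_gen n m i \<otimes>\<^bsub>G\<^esub> inv\<^bsub>G\<^esub> g \<notin> H"
  shows "quasiconvex_subgroup H G"
proof -
  obtain us where us: "set us \<subseteq> lists S" "real (length us) \<le> real k" "subgroup H G"
    "\<And>w. w \<in> lists S \<Longrightarrow> cls w \<in> H \<longleftrightarrow> val w \<in> span (set us)" using generated_obtain[OF gen] by metis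
  have len: "length us \<le> k" using us(2) by simp
  have nr: "val (c @ [s] @ rev c) \<notin> span (set us)" if cs: "c \<in> lists S" "s \<in> S" for c s
    using nc[OF cs(2) cls_carrier[OF cs(1)]] us(4)[of "c @ [s] @ rev c"] cs cls_mult[of c "[s]"]
      cls_mult[of "c @ [s]" "rev c"] by (simp add: cls_gen cls_inv)
  have "quasiconvex (span (set us))" using k_pos msym_ge us(1) len nr by (rule quasiconvex_span)
  then show ?thesis using quasiconvex_subgroup_G[OF us(3) _ us(4)] by blast
qed

lemma low_rank_subgroups:
  assumes gen: "generated_by_at_most G ((real k + 1) / 2) H"
  shows "quasiconvex_subgroup H G"
proof -
  obtain us where us: "set us \<subseteq> lists S" "real (length us) \<le> (real k + 1) / 2" "subgroup H G"
    "\<And>w. w \<in> lists S \<Longrightarrow> cls w \<in> H \<longleftrightarrow> val w \<in> span (set us)" using generated_obtain[OF gen] by metis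
  \<comment> \<open>Doubling turns the real bound into 2 r \<le> k + 1, that is, at most k of the 2
    r - 1 Schreier generators.\<close>
  have "real (2 * length us) \<le> real (k + 1)" using us(2) by simp
  then have len: "2 * length us \<le> k + 1" by (simp only: of_nat_le_iff)
  have "quasiconvex (span (set us))" using k_pos msym_ge us(1) len by (rule quasiconvex_span_half)
  then show ?thesis using quasiconvex_subgroup_G[OF us(3) _ us(4)] by blast
qed

end

end

theorem theoremA:
  fixes k n :: nat and m :: "nat \<Rightarrow> nat \<Rightarrow> enat"
    and G :: "nat group_word set monoid"
  assumes k_pos: "k > 0"
    and G: "G = coxeter_group n m"
    and m_ge: "\<And>i j. 1 \<le> i \<Longrightarrow> i < j \<Longrightarrow> j \<le> n \<Longrightarrow> enat (3 * k + 1) \<le> m i j"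
  shows
    "(\<forall>H. generated_by_at_most G (real k) H \<and> torsion_free (G\<lparr>carrier := H\<rparr>) \<longrightarrow>
        free_group (G\<lparr>carrier := H\<rparr>) \<and> quasiconvex_subgroup H G) \<and>
     (\<forall>H. generated_by_at_most G (real k) H \<and>
        (\<forall>i\<in>{1..n}. \<forall>g\<in>carrier G. g \<otimes>\<^bsub>G\<^esub> coxeter_gen n m i \<otimes>\<^bsub>G\<^esub> inv\<^bsub>G\<^esub> g \<notin> H) \<longrightarrow>
        quasiconvex_subgroup H G) \<and>
     ((\<forall>i j p. 1 \<le> i \<and> i < j \<and> j \<le> n \<and> m i j = enat p \<longrightarrow> even p) \<longrightarrow>
        (\<forall>H. generated_by_at_most G ((real k + 1) / 2) H \<longrightarrow> quasiconvex_subgroup H G))"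
proof -
  interpret coxeter_presentation n m "{1..n}"
  proof
    fix i j assume "1 \<le> i" "i < j" "j \<le> n"
    from m_ge[OF this] show "4 \<le> m i j"
      using k_pos order.trans[of 4 "enat (3 * k + 1)"] by (simp add: numeral_eq_enat)
  qed (rule HOL.refl)
  show ?thesis
    unfolding G
    using torsion_free_subgroups[OF k_pos m_ge] reflection_free_subgroups[OF k_pos m_ge]
      low_rank_subgroups[OF k_pos m_ge] by blast
qed

end
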